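(* (Integral 1, difference equations.) Let $n\ge1$. (i) For partitions $\lambda,\mu$ with at most $n$ rows, the integrals $a_{\lambda\mu}(z)=\int_{U(n)}\mathbf s_\lambda(M)\mathbf s_\mu(\bar M)e^{z\operatorname{Tr}(M+\bar M)}dM$ satisfy $$\sum_{i=1}^n\Big((\lambda_i-i+n)a_{\lambda-e_i,\mu}-(\mu_i-i+n+1)a_{\lambda,\mu+e_i}\Big)+z\Big(na_{\lambda\mu}-\sum_{i=1}^na_{\lambda,\mu+2e_i}+\sum_{1\le i\le n-1,\ \mu_i=\mu_{i+1}}a_{\lambda,\mu+e_i+e_{i+1}}\Big)=0,$$ $$(|\lambda|-|\mu|)a_{\lambda\mu}+z\sum_{i=1}^n\big(a_{\lambda+e_i,\mu}-a_{\lambda,\mu+e_i}\big)=0,$$ $$\sum_{i=1}^n\Big((\mu_i-i+n)a_{\lambda,\mu-e_i}-(\lambda_i-i+n+1)a_{\lambda+e_i,\mu}\Big)+z\Big(na_{\lambda\mu}-\sum_{i=1}^na_{\lambda+2e_i,\mu}+\sum_{1\le i\le n-1,\ \lambda_i=\lambda_{i+1}}a_{\lambda+e_i+e_{i+1},\mu}\Big)=0.$$ (ii) For strictly increasing tuples $x=(x_1<\dots<x_n)$, $y=(y_1<\dots<y_n)$ in $\mathbb Z_{\ge0}$ and $k\ge0$, let $b^{(k)}_{xy}$ be the number of ways that $n$ non-intersecting walkers in $\mathbb Z$ move from $x$ to $y$ in $k$ steps. Then $$-\sum_{i=1}^n\Big((y_i+1)b^{(k)}_{x,y+e_i}-x_ib^{(k)}_{x-e_i,y}\Big)+k\Big(nb^{(k-1)}_{x,y}-\sum_{i=1}^nb^{(k-1)}_{x,y+2e_i}+\sum_{1\le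 i\le n-1,\ y_{i+1}-y_i=1}b^{(k-1)}_{x,y+e_i+e_{i+1}}\Big)=0,$$ $$-b^{(k)}_{xy}\sum_{i=1}^n(y_i-x_i)+k\Big(\sum_{i=1}^nb^{(k-1)}_{x+e_i,y}-\sum_{i=1}^nb^{(k-1)}_{x,y+e_i}\Big)=0,$$ $$-\sum_{i=1}^n\Big((x_i+1)b^{(k)}_{x+e_i,y}-y_ib^{(k)}_{x,y-e_i}\Big)+k\Big(nb^{(k-1)}_{x,y}-\sum_{i=1}^nb^{(k-1)}_{x+2e_i,y}+\sum_{1\le i\le n-1,\ x_{i+1}-x_i=1}b^{(k-1)}_{x+e_i+e_{i+1},y}\Big)=0.$$
   Context: $dM$ is normalized Haar measure on the unitary group $U(n)$, $\bar M$ the complex conjugate of $M$; $\mathbf s_\lambda(M)$ is the Schur function of $\lambda$ evaluated at the eigenvalues of $M$. $e_i$ is the $i$-th unit vector. Conventions: $a_{\lambda\mu}=0$ if $\lambda$ or $\mu$ is not a partition (weakly decreasing with nonnegative entries, at most $n$ rows); $b^{(k)}_{xy}=0$ if $x$ or $y$ is not strictly increasing; terms multiplied by $k$ vanish for $k=0$. $|\lambda|=\sum_i\lambda_i$. Walk: at each step exactly one walker moves, one unit to the left or one unit to the right; non-intersecting means that the positions remain strictly increasing at all times. Partitions and positions correspond via $x_i=\lambda_{n-i+1}+i-1$, $y_i=\mu_{n-i+1}+i-1$, and then $a_{\lambda\mu}(z)=\sum_{k\ge0}\frac{z^k}{k!}b^{(k)}_{xy}$. *)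

theory Defs
  imports
    "HOL-Probability.Probability"
    "HOL-Computational_Algebra.Computational_Algebra"
    "HOL-Combinatorics.Permutations"
    "HOL-Library.Function_Algebras"
begin

text \<open>An \<open>n\<close>-tuple \<open>(v\<^sub>1, \<dots>, v\<^sub>n)\<close> of integers is a function \<open>nat \<Rightarrow> int\<close> of which only the values
  at \<open>1, \<dots>, n\<close> are ever used. Sums and differences of tuples are pointwise
  (\<^theory>\<open>HOL-Library.Function_Algebras\<close>). Entries are integers since \<open>\<lambda> - e\<^sub>i\<close> may leave the
  partitions, and since the walkers may visit negative positions.\<close>

definition unit_tuple :: "nat \<Rightarrow> nat \<Rightarrow> int" ("\<e>") where
  "\<e> i = (\<lambda>j. if j = i then 1 else 0)"

definition is_partition :: "nat \<Rightarrow> (nat \<Rightarrow> int) \<Rightarrow> bool" where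
  "is_partition n lam \<longleftrightarrow>
     (\<forall>i\<in>{1..n}. 0 \<le> lam i) \<and> (\<forall>i\<in>{1..<n}. lam (i + 1) \<le> lam i)"

definition strictly_increasing :: "nat \<Rightarrow> (nat \<Rightarrow> int) \<Rightarrow> bool" where
  "strictly_increasing n x \<longleftrightarrow> (\<forall>i\<in>{1..<n}. x i < x (i + 1))"


section \<open>Schur functions at the eigenvalues of a matrix\<close>

text \<open>The sum of all monomials of degree \<open>r\<close> in the variables \<open>xs\<close>; the list \<open>as\<close> is the
  exponent vector.\<close>

definition complete_homogeneous :: "complex list \<Rightarrow> int \<Rightarrow> complex" where
  "complete_homogeneous xs r =
     (\<Sum>as\<in>{as :: nat list. length as = length xs \<and> int (sum_list as) = r}.
        \<Prod>i<length xs. (xs ! i) ^ (as ! i))"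

text \<open>Schur functions are defined by \<open>s\<^sub>\<lambda> = det (h\<^bsub>\<lambda>\<^sub>i - i + j\<^esub>)\<close>, \<open>1 \<le> i, j \<le> n\<close>, where \<open>h\<^sub>r = 0\<close> for
  \<open>r < 0\<close> (the sum above is then empty). The determinant is expanded by the Leibniz formula since
  the index set is \<open>{1..n}\<close> rather than a type.\<close>

definition schur :: "nat \<Rightarrow> (nat \<Rightarrow> int) \<Rightarrow> complex list \<Rightarrow> complex" where
  "schur n lam xs =
     (\<Sum>p | p permutes {1..n}.
        of_int (sign p) *
        (\<Prod>i=1..n. complete_homogeneous xs (lam i - int i + int (p i))))"

definition charpoly :: "complex^'n^'n \<Rightarrow> complex poly" where
  "charpoly M = det (mat [:0, 1:] - (\<chi> i j. [:M $ i $ j:]))"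

text \<open>The \<open>n\<close> eigenvalues with algebraic multiplicity, in some order; they are only used as
  arguments of symmetric functions.\<close>

definition eigenvalue_list :: "complex^'n^'n \<Rightarrow> complex list" where
  "eigenvalue_list M = (SOME xs. mset xs = proots (charpoly M))"

definition schur_matrix :: "(nat \<Rightarrow> int) \<Rightarrow> complex^'n^'n \<Rightarrow> complex" where
  "schur_matrix lam M = schur CARD('n) lam (eigenvalue_list M)"


section \<open>Haar measure on the unitary group and the integrals\<close>

definition cnj_matrix :: "complex^'n^'n \<Rightarrow> complex^'n^'n" where
  "cnj_matrix M = (\<chi> i j. cnj (M $ i $ j))"

definition unitary_group :: "(complex^'n^'n) set" where
  "unitary_group =
     {M. M ** transpose (cnj_matrix M) = mat 1 \<and> transpose (cnj_matrix M) ** M = mat 1}"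

text \<open>Normalized Haar measure: the left-invariant Borel probability measure on \<open>U(n)\<close>.\<close>

definition normalized_haar :: "(complex^'n^'n) measure \<Rightarrow> bool" where
  "normalized_haar H \<longleftrightarrow>
     prob_space H \<and>
     sets H = sets (restrict_space borel unitary_group) \<and>
     (\<forall>U\<in>unitary_group. distr H H (\<lambda>M. U ** M) = H)"

definition unitary_integral ::
  "(complex^'n^'n) measure \<Rightarrow> (nat \<Rightarrow> int) \<Rightarrow> (nat \<Rightarrow> int) \<Rightarrow> complex \<Rightarrow> complex" where
  "unitary_integral H lam mu z =
     (if is_partition CARD('n) lam \<and> is_partition CARD('n) mu
      then LINT M|H. schur_matrix lam M * schur_matrix mu (cnj_matrix M)
                     * exp (z * trace (M + cnj_matrix M))
      else 0)"


section \<open>Non-intersecting walkers\<close>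

text \<open>A walk is the sequence of the configurations at times \<open>0, \<dots>, k\<close>; extensional functions make
  walks with the same positions equal, so that they are counted once. There is no walk if \<open>x\<close> or
  \<open>y\<close> is not strictly increasing, since these are the configurations at times \<open>0\<close> and \<open>k\<close>.\<close>

definition walks :: "nat \<Rightarrow> nat \<Rightarrow> (nat \<Rightarrow> int) \<Rightarrow> (nat \<Rightarrow> int) \<Rightarrow> (nat \<Rightarrow> nat \<Rightarrow> int) set" where
  "walks n k x y =
     {w \<in> {0..k} \<rightarrow>\<^sub>E ({1..n} \<rightarrow>\<^sub>E (UNIV :: int set)).
        (\<forall>i\<in>{1..n}. w 0 i = x i) \<and>
        (\<forall>i\<in>{1..n}. w k i = y i) \<and>
        (\<forall>t\<in>{0..k}. strictly_increasing n (w t)) \<and>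
        (\<forall>t<k. \<exists>i\<in>{1..n}. \<exists>d\<in>{1, -1}. w (t + 1) = (w t)(i := w t i + d))}"

definition walk_count :: "nat \<Rightarrow> nat \<Rightarrow> (nat \<Rightarrow> int) \<Rightarrow> (nat \<Rightarrow> int) \<Rightarrow> int" where
  "walk_count n k x y = int (card (walks n k x y))"

end

theory Submission
  imports Defs
begin

text \<open>
  For the integrals, left invariance gives \<open>\<integral> d/dt F(exp (tX) M) dM = 0\<close> for anti-hermitian \<open>X\<close>, hence
  by linearity for every complex \<open>X\<close>. With \<open>F = s\<^sub>\<lambda>(M) s\<^sub>\<mu>(M\<^sup>*) exp (z Tr(M + M\<^sup>*))\<close> and \<open>X = 1\<close> this is
  the second equation; applied to \<open>(M\<^sup>*)\<^sub>j\<^sub>k F\<close> in the direction of the matrix unit \<open>E\<^sub>j\<^sub>k\<close> and summed over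
  \<open>j, k\<close>, it becomes a derivative along \<open>X = M\<^sup>* = M\<^sup>-\<^sup>1\<close>, which acts on the eigenvalues as \<open>\<Sum>\<^sub>j \<partial>\<^sub>j\<close>, and
  yields the first equation. The third is its complex conjugate. The derivatives are computed on the
  Jacobi-Trudi determinant, whose entries are polynomials in the traces \<open>Tr M\<^sup>k\<close> by Newton's identities.

  The number of non-intersecting walks is an alternating sum over permutations of numbers of
  unrestricted walks (reflection principle), for which the identities hold coordinate by coordinate.
\<close>

section \<open>Determinants over a finite index set\<close>

text \<open>\<open>eigenvalue_list\<close> picks an arbitrary ordering, so nothing can be
  differentiated in the eigenvalues themselves; power traces are polynomials in the entries, which
  is why the Jacobi-Trudi determinant is rewritten in them. Let N be the adjoint of M. The direction
  X = N varies with M, so invariance applies only after multiplication by the entries of N, and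
  differentiating these costs n Tr N. That term is needed: Tr N s_mu(N) is the sum of all
  s_(mu+e_i), and it raises the factor mu_i - i + 1 to mu_i - i + n + 1.

  Both halves of the theorem share one obstacle. The computations live on alternating sums defined
  for all integer tuples, whereas the statement sets non-partitions and unordered positions to 0. A
  unit step out of the allowed tuples reaches only tuples where the alternating sum vanishes anyway,
  but a double step can pass a neighbour; the result is then a transposed copy of the tuple with
  both neighbours moved once, with opposite sign. This is the origin of the sums over mu_i =
  mu_(i+1) and y_(i+1) - y_i = 1.\<close>

lemma unit_tuple_apply: "\<e> i j = (if j = i then 1 else 0)"
  by (simp add: unit_tuple_def)

text \<open>Needed both for {1..n} as a set of naturals (Jacobi-Trudi) and for \<open>UNIV\<close>
  of a matrix index type (characteristic polynomials), over numbers, polynomials and power series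
  alike.\<close>

definition leibniz_det :: "'i set \<Rightarrow> ('i \<Rightarrow> 'i \<Rightarrow> 'a::comm_ring_1) \<Rightarrow> 'a" where
  "leibniz_det S f = (\<Sum>p | p permutes S. of_int (sign p) * (\<Prod>i\<in>S. f i (p i)))"

text \<open>The coefficient of t in det (f + t g). Expanding it once by rows and once by columns
  drives all the Schur function identities below.\<close>

definition leibniz_det_deriv ::
  "'i set \<Rightarrow> ('i \<Rightarrow> 'i \<Rightarrow> 'a::comm_ring_1) \<Rightarrow> ('i \<Rightarrow> 'i \<Rightarrow> 'a) \<Rightarrow> 'a" where
  "leibniz_det_deriv S f g =
     (\<Sum>p | p permutes S. of_int (sign p) * (\<Sum>i\<in>S. g i (p i) * (\<Prod>j\<in>S - {i}. f j (p j))))"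

text \<open>Reindexing by \<tau> reverses all signs, so the sum equals its own negative;
  characteristic 0 permits dividing by 2.\<close>

lemma antisymmetric_sum_eq_0:
  fixes F :: "('i \<Rightarrow> 'i) \<Rightarrow> 'a::{idom,semiring_char_0}"
  assumes "finite S" "a \<in> S" "b \<in> S" "a \<noteq> b"
    and "\<And>p. p permutes S \<Longrightarrow> F (\<tau> p) = F p"
    and "bij_betw \<tau> {p. p permutes S} {p. p permutes S}"
    and "\<And>p. p permutes S \<Longrightarrow> sign (\<tau> p) = - sign p"
  shows "(\<Sum>p | p permutes S. of_int (sign p) * F p) = 0"
proof -
  let ?D = "\<Sum>p | p permutes S. of_int (sign p) * F p"
  have "?D = (\<Sum>p | p permutes S. of_int (sign (\<tau> p)) * F (\<tau> p))"
    by (rule sum.reindex_bij_betw[OF assms(6), symmetric])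
  also have "\<dots> = - ?D"
    by (simp add: assms(5,7) sum_negf)
  finally have "2 * ?D = 0" by simp
  then show ?thesis by simp
qed

lemma bij_betw_compose_left_permutes:
  assumes "q permutes S" shows "bij_betw (\<lambda>p. q \<circ> p) {p. p permutes S} {p. p permutes S}"
  by (rule bij_betw_byWitness[where f' = "\<lambda>p. inv q \<circ> p"])
    (auto simp: o_assoc[symmetric] permutes_inv_o[OF assms] o_assoc intro!: permutes_compose permutes_inv assms)

lemma bij_betw_compose_right_permutes:
  assumes "q permutes S" shows "bij_betw (\<lambda>p. p \<circ> q) {p. p permutes S} {p. p permutes S}"
  by (rule bij_betw_byWitness[where f' = "\<lambda>p. p \<circ> inv q"])
    (auto simp: o_assoc[symmetric] permutes_inv_o[OF assms] intro!: permutes_compose permutes_inv assms)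

lemma sign_transpose_compose:
  assumes "finite S" "p permutes S" "a \<noteq> b"
  shows "sign (Transposition.transpose a b \<circ> p) = - sign p" "sign (p \<circ> Transposition.transpose a b) = - sign p"
  using assms permutes_imp_permutation[OF assms(1,2)]
  by (simp_all add: sign_compose permutation_swap_id sign_swap_id)

lemma leibniz_det_cong:
  assumes "\<And>i j. i \<in> S \<Longrightarrow> j \<in> S \<Longrightarrow> f i j = g i j"
  shows "leibniz_det S f = leibniz_det S g"
  unfolding leibniz_det_def
  by (intro sum.cong refl arg_cong2[of _ _ _ _ "(*)"] prod.cong)
    (auto intro!: assms simp: permutes_in_image)

lemma leibniz_det_deriv_cong:
  assumes "\<And>i j. i \<in> S \<Longrightarrow> j \<in> S \<Longrightarrow> f i j = f' i j" "\<And>i j. i \<in> S \<Longrightarrow> j \<in> S \<Longrightarrow> g i j = g' i j"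
  shows "leibniz_det_deriv S f g = leibniz_det_deriv S f' g'"
  unfolding leibniz_det_deriv_def
  by (intro sum.cong refl arg_cong2[of _ _ _ _ "(*)"] prod.cong)
    (auto intro!: assms simp: permutes_in_image)

lemma leibniz_det_equal_columns:
  fixes f :: "'i \<Rightarrow> 'i \<Rightarrow> 'a::{idom,semiring_char_0}"
  assumes S: "finite S" "a \<in> S" "b \<in> S" "a \<noteq> b" and eq: "\<And>i. i \<in> S \<Longrightarrow> f i a = f i b"
  shows "leibniz_det S f = 0"
  unfolding leibniz_det_def
proof (rule antisymmetric_sum_eq_0[OF S, where \<tau> = "\<lambda>p. Transposition.transpose a b \<circ> p"])
  show "(\<Prod>i\<in>S. f i ((Transposition.transpose a b \<circ> p) i)) = (\<Prod>i\<in>S. f i (p i))" for p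
    by (intro prod.cong) (auto simp: Transposition.transpose_def eq)
qed (simp_all add: S sign_transpose_compose(1)[OF S(1) _ S(4)] bij_betw_compose_left_permutes permutes_swap_id)

lemma leibniz_det_swap_rows:
  fixes f :: "'i \<Rightarrow> 'i \<Rightarrow> 'a::comm_ring_1"
  assumes S: "finite S" "a \<in> S" "b \<in> S" "a \<noteq> b"
  shows "leibniz_det S (\<lambda>i. f (Transposition.transpose a b i)) = - leibniz_det S f"
proof -
  let ?t = "Transposition.transpose a b"
  have t: "?t permutes S" by (simp add: S permutes_swap_id)
  have "leibniz_det S (\<lambda>i. f (?t i)) =
      (\<Sum>p | p permutes S. of_int (sign (p \<circ> ?t)) * (\<Prod>i\<in>S. f (?t i) ((p \<circ> ?t) i)))"
    unfolding leibniz_det_def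
    by (rule sum.reindex_bij_betw[OF bij_betw_compose_right_permutes[OF t], symmetric])
  also have "\<dots> = (\<Sum>p | p permutes S. - (of_int (sign p) * (\<Prod>i\<in>S. f i (p i))))"
  proof (intro sum.cong refl)
    fix p assume "p \<in> {p. p permutes S}"
    then have "sign (p \<circ> ?t) = - sign p" using S by (simp add: sign_transpose_compose)
    moreover have "(\<Prod>i\<in>S. f (?t i) ((p \<circ> ?t) i)) = (\<Prod>i\<in>S. f i (p i))"
      using prod.reindex_bij_betw[OF permutes_imp_bij[OF t], of "\<lambda>i. f i (p i)"] by simp
    ultimately show "of_int (sign (p \<circ> ?t)) * (\<Prod>i\<in>S. f (?t i) ((p \<circ> ?t) i)) =
        - (of_int (sign p) * (\<Prod>i\<in>S. f i (p i)))" by simp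
  qed
  finally show ?thesis by (simp add: leibniz_det_def sum_negf)
qed

lemma leibniz_det_equal_rows:
  fixes f :: "'i \<Rightarrow> 'i \<Rightarrow> 'a::{idom,semiring_char_0}"
  assumes S: "finite S" "a \<in> S" "b \<in> S" "a \<noteq> b" and eq: "\<And>j. j \<in> S \<Longrightarrow> f a j = f b j"
  shows "leibniz_det S f = 0"
proof -
  have "leibniz_det S (\<lambda>i. f (Transposition.transpose a b i)) = leibniz_det S f"
    by (intro leibniz_det_cong) (auto simp: Transposition.transpose_def eq)
  with leibniz_det_swap_rows[OF S, of f] have "2 * leibniz_det S f = 0" by simp
  then show ?thesis by simp
qed

text \<open>A summand picks the row that is differentiated. For Jacobi-Trudi determinants this
  expansion shifts a single entry of \<open>lam\<close> and so produces neighbouring tuples.\<close>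

lemma leibniz_det_deriv_rows:
  assumes "finite S"
  shows "leibniz_det_deriv S f g = (\<Sum>i\<in>S. leibniz_det S (f(i := g i)))"
proof -
  have *: "(\<Prod>j\<in>S. (f(i := g i)) j (p j)) = g i (p i) * (\<Prod>j\<in>S - {i}. f j (p j))" if "i \<in> S" for i p
    using assms that by (subst prod.remove[OF assms that]) (auto intro!: arg_cong2[of _ _ _ _ "(*)"] prod.cong)
  show ?thesis
    unfolding leibniz_det_deriv_def leibniz_det_def
    by (subst sum.swap) (simp add: * sum_distrib_left del: fun_upd_apply)
qed

text \<open>A permutation meets every column exactly once, so the choice of a row i is also the
  choice of the column p i.\<close>

lemma leibniz_det_deriv_columns:
  assumes "finite S"
  shows "leibniz_det_deriv S f g = (\<Sum>l\<in>S. leibniz_det S (\<lambda>i j. if j = l then g i j else f i j))"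
proof -
  have *: "(\<Sum>i\<in>S. g i (p i) * (\<Prod>j\<in>S - {i}. f j (p j))) =
      (\<Sum>l\<in>S. \<Prod>i\<in>S. if p i = l then g i (p i) else f i (p i))" if p: "p permutes S" for p
  proof -
    have "(\<Sum>l\<in>S. \<Prod>i\<in>S. if p i = l then g i (p i) else f i (p i)) =
        (\<Sum>k\<in>S. \<Prod>i\<in>S. if p i = p k then g i (p i) else f i (p i))"
      by (rule sum.reindex_bij_betw[OF permutes_imp_bij[OF p], symmetric])
    also have "\<dots> = (\<Sum>i\<in>S. g i (p i) * (\<Prod>j\<in>S - {i}. f j (p j)))"
    proof (intro sum.cong refl)
      fix k assume k: "k \<in> S"
      have inj: "p i = p k \<longleftrightarrow> i = k" for i using p by (metis permutes_inverses(2))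
      show "(\<Prod>i\<in>S. if p i = p k then g i (p i) else f i (p i)) = g k (p k) * (\<Prod>j\<in>S - {k}. f j (p j))"
        unfolding inj using assms k by (subst prod.remove[OF assms k]) (auto intro!: prod.cong arg_cong2[of _ _ _ _ "(*)"])
    qed
    finally show ?thesis by simp
  qed
  show ?thesis
    unfolding leibniz_det_deriv_def leibniz_det_def
    by (subst sum.swap) (simp add: * sum_distrib_left)
qed

lemma leibniz_det_deriv_add:
  "leibniz_det_deriv S f (\<lambda>i j. g i j + h i j) = leibniz_det_deriv S f g + leibniz_det_deriv S f h"
  by (simp add: leibniz_det_deriv_def algebra_simps sum.distrib)

lemma leibniz_det_deriv_scale:
  "leibniz_det_deriv S f (\<lambda>i j. c * g i j) = c * leibniz_det_deriv S f g"
  by (simp add: leibniz_det_deriv_def mult_ac sum_distrib_left)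

text \<open>Linearity in column l: replacing it by a column m \<noteq> l creates two equal columns,
  so only the multiple b l of the original determinant survives.\<close>

lemma leibniz_det_column_combination:
  fixes f :: "'i \<Rightarrow> 'i \<Rightarrow> 'a::{idom,semiring_char_0}"
  assumes S: "finite S" and l: "l \<in> S"
  shows "leibniz_det S (\<lambda>i j. if j = l then \<Sum>m\<in>S. f i m * b m else f i j) = b l * leibniz_det S f"
proof -
  have lin: "(\<Prod>i\<in>S. if p i = l then \<Sum>m\<in>S. f i m * b m else f i (p i)) =
      (\<Sum>m\<in>S. b m * (\<Prod>i\<in>S. if p i = l then f i m else f i (p i)))" if p: "p permutes S" for p
  proof -
    define k where "k = inv p l"
    have k: "k \<in> S" "p k = l" using p l by (auto simp: k_def permutes_inverses permutes_in_image[OF permutes_inv])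
    have inj: "p i = l \<longleftrightarrow> i = k" for i using p k by (metis permutes_inverses(2))
    have "(\<Prod>i\<in>S. if p i = l then u i else f i (p i)) = u k * (\<Prod>i\<in>S-{k}. f i (p i))" for u
      unfolding inj by (subst prod.remove[OF S k(1)]) (auto intro!: prod.cong arg_cong2[of _ _ _ _ "(*)"])
    then show ?thesis by (simp add: sum_distrib_left sum_distrib_right mult_ac)
  qed
  have "leibniz_det S (\<lambda>i j. if j = l then \<Sum>m\<in>S. f i m * b m else f i j) =
      (\<Sum>m\<in>S. b m * leibniz_det S (\<lambda>i j. if j = l then f i m else f i j))"
    unfolding leibniz_det_def sum_distrib_left
    by (subst sum.swap) (simp add: lin sum_distrib_left mult_ac)
  also have "\<dots> = (\<Sum>m\<in>S. if m = l then b l * leibniz_det S f else 0)"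
  proof (intro sum.cong refl)
    fix m assume m: "m \<in> S"
    show "b m * leibniz_det S (\<lambda>i j. if j = l then f i m else f i j) =
        (if m = l then b l * leibniz_det S f else 0)"
    proof (cases "m = l")
      case True
      then have "(\<lambda>i j. if j = l then f i m else f i j) = f" by (auto simp: fun_eq_iff)
      with True show ?thesis by simp
    next
      case False
      then have "leibniz_det S (\<lambda>i j. if j = l then f i m else f i j) = 0"
        using S l m by (intro leibniz_det_equal_columns[of S l m]) auto
      with False show ?thesis by simp
    qed
  qed
  finally show ?thesis using S l by simp
qed

text \<open>Jacobi's formula, in a form that needs no inverse: \<open>D (det f) = tr B \<cdot> det f\<close> whenever \<open>D f = f B\<close>.\<close>

lemma leibniz_det_deriv_mult:
  fixes f :: "'i \<Rightarrow> 'i \<Rightarrow> 'a::{idom,semiring_char_0}"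
  assumes S: "finite S" and g: "\<And>i j. i \<in> S \<Longrightarrow> j \<in> S \<Longrightarrow> g i j = (\<Sum>m\<in>S. f i m * B m j)"
  shows "leibniz_det_deriv S f g = (\<Sum>j\<in>S. B j j) * leibniz_det S f"
proof -
  have "leibniz_det_deriv S f g = (\<Sum>l\<in>S. leibniz_det S (\<lambda>i j. if j = l then \<Sum>m\<in>S. f i m * B m l else f i j))"
    unfolding leibniz_det_deriv_columns[OF S] by (intro sum.cong refl leibniz_det_cong) (auto simp: g)
  also have "\<dots> = (\<Sum>l\<in>S. B l l * leibniz_det S f)"
    by (intro sum.cong refl leibniz_det_column_combination S)
  finally show ?thesis by (simp add: sum_distrib_right)
qed

section \<open>Non-intersecting walks\<close>

text \<open>Without the exclusion rule the walkers form a single walk in n dimensions, so only the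
  displacement d counts; the step set is symmetric, so the sign of d is immaterial.\<close>

primrec free_walk_count :: "nat \<Rightarrow> nat \<Rightarrow> (nat \<Rightarrow> int) \<Rightarrow> int" where
  "free_walk_count n 0 d = (if \<forall>i\<in>{1..n}. d i = 0 then 1 else 0)"
| "free_walk_count n (Suc k) d =
     (\<Sum>i=1..n. free_walk_count n k (d + \<e> i) + free_walk_count n k (d - \<e> i))"

lemma free_walk_count_uminus: "free_walk_count n k (- d) = free_walk_count n k d"
proof (induction k arbitrary: d)
  case (Suc k)
  have "- d + \<e> i = - (d - \<e> i)" "- d - \<e> i = - (d + \<e> i)" for i by simp_all
  then show ?case by (simp only: free_walk_count.simps Suc.IH add.commute)
qed auto

lemma free_walk_count_permute:
  assumes p: "p permutes {1..n}"
  shows "free_walk_count n k (\<lambda>i. d (p i)) = free_walk_count n k d"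
proof (induction k arbitrary: d)
  case 0
  have "(\<forall>i\<in>{1..n}. d (p i) = 0) \<longleftrightarrow> (\<forall>i\<in>p ` {1..n}. d i = 0)" by simp
  then show ?case by (simp only: free_walk_count.simps permutes_image[OF p])
next
  case (Suc k)
  have *: "(\<lambda>i. d (p i)) + \<e> i = (\<lambda>j. (d + \<e> (p i)) (p j))"
    "(\<lambda>i. d (p i)) - \<e> i = (\<lambda>j. (d - \<e> (p i)) (p j))" for i
    using permutes_inj[OF p] by (auto simp: fun_eq_iff unit_tuple_apply inj_def)
  show ?case unfolding free_walk_count.simps * Suc.IH
    by (rule sum.reindex_bij_betw[OF permutes_imp_bij[OF p]])
qed

text \<open>In terms of the generating Laurent polynomial \<open>W = \<Sum>\<^sub>i (t\<^sub>i + 1/t\<^sub>i)\<close> this is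
  \<open>t\<^sub>i \<partial>\<^sub>i W\<^sup>k = k W\<^bsup>k-1\<^esup> (t\<^sub>i - 1/t\<^sub>i)\<close>.\<close>

lemma free_walk_count_coordinate:
  assumes i: "i \<in> {1..n}"
  shows "d i * free_walk_count n k d =
    int k * (free_walk_count n (k - 1) (d - \<e> i) - free_walk_count n (k - 1) (d + \<e> i))"
proof (induction k arbitrary: d)
  case 0
  then show ?case using i by auto
next
  case (Suc k)
  let ?Q = "free_walk_count n"
  have "d i * ?Q (Suc k) d =
      (\<Sum>j=1..n. (d + \<e> j) i * ?Q k (d + \<e> j) + (d - \<e> j) i * ?Q k (d - \<e> j)
        + (if j = i then ?Q k (d - \<e> i) - ?Q k (d + \<e> i) else 0))"
    unfolding free_walk_count.simps sum_distrib_left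
    by (intro sum.cong refl) (auto simp: unit_tuple_apply algebra_simps)
  also have "\<dots> = (\<Sum>j=1..n. (d + \<e> j) i * ?Q k (d + \<e> j) + (d - \<e> j) i * ?Q k (d - \<e> j))
      + (?Q k (d - \<e> i) - ?Q k (d + \<e> i))"
    using i by (simp add: sum.distrib)
  also have "(\<Sum>j=1..n. (d + \<e> j) i * ?Q k (d + \<e> j) + (d - \<e> j) i * ?Q k (d - \<e> j)) =
      int k * (\<Sum>j=1..n. (?Q (k-1) (d - \<e> i + \<e> j) + ?Q (k-1) (d - \<e> i - \<e> j))
         - (?Q (k-1) (d + \<e> i + \<e> j) + ?Q (k-1) (d + \<e> i - \<e> j)))"
    unfolding Suc.IH sum_distrib_left
    by (intro sum.cong refl) (simp add: algebra_simps)
  also have "\<dots> = int k * (?Q k (d - \<e> i) - ?Q k (d + \<e> i))"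
    by (cases k) (simp_all add: sum_subtractf)
  finally show ?case
    unfolding diff_Suc_1 of_nat_Suc by (simp only: distrib_right mult_1_left add.commute)
qed

text \<open>The alternating sum of the reflection principle over all matchings of starting points
  with end points. Since only one walker moves per step, it is not a determinant of one-walker
  counts; it is defined for arbitrary integer tuples and antisymmetric in each of them.\<close>

definition signed_walk_count :: "nat \<Rightarrow> nat \<Rightarrow> (nat \<Rightarrow> int) \<Rightarrow> (nat \<Rightarrow> int) \<Rightarrow> int" where
  "signed_walk_count n k x y =
     (\<Sum>p | p permutes {1..n}. of_int (sign p) * free_walk_count n k (\<lambda>i. y (p i) - x i))"

text \<open>Inverting p and reversing the walks exchanges the end points. Statements about shifts of
  \<open>y\<close> are carried over to \<open>x\<close> in this way.\<close>

lemma signed_walk_count_commute: "signed_walk_count n k x y = signed_walk_count n k y x"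
proof -
  have "free_walk_count n k (\<lambda>i. y (inv p i) - x i) = free_walk_count n k (\<lambda>i. x (p i) - y i)"
    if p: "p permutes {1..n}" for p
  proof -
    have "free_walk_count n k (\<lambda>i. y (inv p i) - x i) = free_walk_count n k (\<lambda>i. y (inv p (p i)) - x (p i))"
      by (rule free_walk_count_permute[OF p, symmetric])
    also have "\<dots> = free_walk_count n k (- (\<lambda>i. y (inv p (p i)) - x (p i)))"
      by (rule free_walk_count_uminus[symmetric])
    also have "- (\<lambda>i. y (inv p (p i)) - x (p i)) = (\<lambda>i. x (p i) - y i)"
      using p by (auto simp: permutes_inverses)
    finally show ?thesis .
  qed
  moreover have "sign (inv p) = sign p" if "p permutes {1..n}" for p
    using that by (intro sign_inverse permutes_imp_permutation) auto
  ultimately show ?thesis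
    unfolding signed_walk_count_def by (subst sum_permutations_inverse) simp
qed

lemma signed_walk_count_swap:
  assumes S: "a \<in> {1..n}" "b \<in> {1..n}" "a \<noteq> b"
  shows "signed_walk_count n k x (\<lambda>i. y (Transposition.transpose a b i)) = - signed_walk_count n k x y"
proof -
  let ?t = "Transposition.transpose a b"
  have t: "?t permutes {1..n}" using S by (simp add: permutes_swap_id)
  have "signed_walk_count n k x y =
      (\<Sum>p | p permutes {1..n}. of_int (sign (?t \<circ> p)) * free_walk_count n k (\<lambda>i. y ((?t \<circ> p) i) - x i))"
    unfolding signed_walk_count_def
    by (rule sum.reindex_bij_betw[OF bij_betw_compose_left_permutes[OF t], symmetric])
  also have "\<dots> = (\<Sum>p | p permutes {1..n}. - (of_int (sign p) * free_walk_count n k (\<lambda>i. y (?t (p i)) - x i)))"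
    by (intro sum.cong refl) (simp add: sign_transpose_compose(1)[OF _ _ S(3), of "{1..n}"])
  finally show ?thesis by (simp add: signed_walk_count_def sum_negf)
qed

lemma signed_walk_count_eq_0:
  assumes S: "a \<in> {1..n}" "b \<in> {1..n}" "a \<noteq> b" "y a = y b"
  shows "signed_walk_count n k x y = 0"
proof -
  have "(\<lambda>i. y (Transposition.transpose a b i)) = y"
    using S(4) by (auto simp: fun_eq_iff Transposition.transpose_def)
  with signed_walk_count_swap[OF S(1-3), of k x y] show ?thesis by simp
qed

text \<open>Moving the end point p j moves coordinate j of the displacement. The sum over j has to
  be reindexed by p, separately for each p, before the coordinatewise identity can be
  applied.\<close>

lemma sum_signed_walk_count:
  assumes "\<And>p j. p permutes {1..n} \<Longrightarrow> j \<in> {1..n} \<Longrightarrow> (\<lambda>i. y' (p j) (p i) - x' (p j) i) = w p j"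
  shows "(\<Sum>j=1..n. c j * signed_walk_count n k (x' j) (y' j)) =
     (\<Sum>p | p permutes {1..n}. of_int (sign p) * (\<Sum>j=1..n. c (p j) * free_walk_count n k (w p j)))"
proof -
  have *: "(\<Sum>j=1..n. c j * (of_int (sign p) * free_walk_count n k (\<lambda>i. y' j (p i) - x' j i))) =
      of_int (sign p) * (\<Sum>j=1..n. c (p j) * free_walk_count n k (w p j))" if p: "p permutes {1..n}" for p
  proof -
    have "(\<Sum>j=1..n. c j * (of_int (sign p) * free_walk_count n k (\<lambda>i. y' j (p i) - x' j i))) =
      (\<Sum>j=1..n. c (p j) * (of_int (sign p) * free_walk_count n k (\<lambda>i. y' (p j) (p i) - x' (p j) i)))"
      by (rule sum.reindex_bij_betw[OF permutes_imp_bij[OF p], symmetric])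
    also have "\<dots> = of_int (sign p) * (\<Sum>j=1..n. c (p j) * free_walk_count n k (w p j))"
      unfolding sum_distrib_left by (intro sum.cong refl) (simp only: assms[OF p] mult_ac)
    finally show ?thesis .
  qed
  show ?thesis
    using * unfolding signed_walk_count_def sum_distrib_left
    by (subst sum.swap) (rule sum.cong[OF refl], simp only: mem_Collect_eq)
qed


lemma unit_tuple_permute: "p permutes S \<Longrightarrow> \<e> (p j) (p i) = \<e> j i"
  by (metis permutes_inverses(2) unit_tuple_apply)

text \<open>Fix p with displacement d. Raising y at p i and lowering x at i both lead to d + e_i,
  whose i-th entry y (p i) + 1 - x i is exactly the difference of the two coefficients. The
  coordinate identity at d + e_i then produces d and d + 2 e_i.\<close>

lemma signed_walk_count_difference_1:
  "- (\<Sum>i=1..n. (y i + 1) * signed_walk_count n k x (y + \<e> i) - x i * signed_walk_count n k (x - \<e> i) y)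
   + int k * (int n * signed_walk_count n (k - 1) x y
     - (\<Sum>i=1..n. signed_walk_count n (k - 1) x (y + \<e> i + \<e> i))) = 0"
proof -
  let ?Q = "free_walk_count n" and ?\<Sigma> = "\<lambda>F. \<Sum>p | p permutes {1..n}. of_int (sign p) * F p"
  define d where "d = (\<lambda>p i. y (p i) - x i)"
  have 1: "(\<Sum>i=1..n. (y i + 1) * signed_walk_count n k x (y + \<e> i)) =
      ?\<Sigma> (\<lambda>p. \<Sum>i=1..n. (y (p i) + 1) * ?Q k (d p + \<e> i))"
    by (rule sum_signed_walk_count) (auto simp: d_def unit_tuple_permute fun_eq_iff)
  have "(\<Sum>i=1..n. x i * signed_walk_count n k (x - \<e> i) y) =
      (\<Sum>i=1..n. x i * signed_walk_count n k y (x - \<e> i))"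
    by (subst signed_walk_count_commute) simp
  have 2: "(\<Sum>i=1..n. x i * signed_walk_count n k (x - \<e> i) y) =
      ?\<Sigma> (\<lambda>p. \<Sum>i=1..n. x i * ?Q k (d p + \<e> i))"
  proof -
    have "(\<lambda>l. y (p l) - (x - \<e> i) l) = d p + \<e> i" for p i by (auto simp: d_def)
    then show ?thesis
      unfolding signed_walk_count_def sum_distrib_left
      by (subst sum.swap) (simp only: mult_ac)
  qed
  have 3: "(\<Sum>i=1..n. 1 * signed_walk_count n (k - 1) x (y + \<e> i + \<e> i)) =
      ?\<Sigma> (\<lambda>p. \<Sum>i=1..n. 1 * ?Q (k - 1) (d p + \<e> i + \<e> i))"
    by (rule sum_signed_walk_count) (auto simp: d_def unit_tuple_permute fun_eq_iff)
  have 4: "int n * signed_walk_count n (k - 1) x y = ?\<Sigma> (\<lambda>p. \<Sum>i=1..n. 1 * ?Q (k - 1) (d p))"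
    by (simp add: signed_walk_count_def d_def sum_distrib_left mult_ac)
  have key: "(\<Sum>i=1..n. (y (p i) + 1) * ?Q k (d p + \<e> i)) - (\<Sum>i=1..n. x i * ?Q k (d p + \<e> i)) =
     int k * ((\<Sum>i=1..n. 1 * ?Q (k - 1) (d p)) - (\<Sum>i=1..n. 1 * ?Q (k - 1) (d p + \<e> i + \<e> i)))" for p
  proof -
    have "(y (p i) + 1) * ?Q k (d p + \<e> i) - x i * ?Q k (d p + \<e> i) =
       int k * (1 * ?Q (k - 1) (d p) - 1 * ?Q (k - 1) (d p + \<e> i + \<e> i))" if "i \<in> {1..n}" for i
    proof -
      have "(y (p i) + 1) * ?Q k (d p + \<e> i) - x i * ?Q k (d p + \<e> i) = (d p + \<e> i) i * ?Q k (d p + \<e> i)"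
        by (simp only: d_def plus_fun_apply unit_tuple_apply if_True left_diff_distrib[symmetric]) (rule arg_cong2[of _ _ _ _ "(*)"], auto)
      also have "\<dots> = int k * (?Q (k - 1) (d p + \<e> i - \<e> i) - ?Q (k - 1) (d p + \<e> i + \<e> i))"
        by (rule free_walk_count_coordinate[OF that])
      finally show ?thesis by (simp only: add_diff_cancel_right' mult_1_left)
    qed
    then show ?thesis
      unfolding sum_subtractf[symmetric] sum_distrib_left by (intro sum.cong refl)
  qed
  have sub: "?\<Sigma> F - ?\<Sigma> G = ?\<Sigma> (\<lambda>p. F p - G p)" for F G :: "(nat \<Rightarrow> nat) \<Rightarrow> int"
    by (simp add: sum_subtractf right_diff_distrib)
  have scale: "c * ?\<Sigma> F = ?\<Sigma> (\<lambda>p. c * F p)" for c :: int and F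
    by (simp add: sum_distrib_left mult_ac)
  have "(\<Sum>i=1..n. (y i + 1) * signed_walk_count n k x (y + \<e> i)) - (\<Sum>i=1..n. x i * signed_walk_count n k (x - \<e> i) y)
     = int k * (int n * signed_walk_count n (k - 1) x y
     - (\<Sum>i=1..n. 1 * signed_walk_count n (k - 1) x (y + \<e> i + \<e> i)))"
    unfolding 1 2 3 4 sub key scale ..
  then show ?thesis unfolding sum_subtractf by simp
qed

text \<open>The sum of the entries of the displacement is the same for all p, so the factor moves
  inside the sum over p and is distributed over the coordinates.\<close>

lemma signed_walk_count_difference_2:
  "- signed_walk_count n k x y * (\<Sum>i=1..n. y i - x i)
   + int k * ((\<Sum>i=1..n. signed_walk_count n (k - 1) (x + \<e> i) y)
     - (\<Sum>i=1..n. signed_walk_count n (k - 1) x (y + \<e> i))) = 0"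
proof -
  let ?Q = "free_walk_count n" and ?\<Sigma> = "\<lambda>F. \<Sum>p | p permutes {1..n}. of_int (sign p) * F p"
  define d where "d = (\<lambda>p i. y (p i) - x i)"
  have 1: "signed_walk_count n k x y * (\<Sum>i=1..n. y i - x i) = ?\<Sigma> (\<lambda>p. \<Sum>i=1..n. d p i * ?Q k (d p))"
  proof -
    have "(\<Sum>i=1..n. y i - x i) = (\<Sum>i=1..n. d p i)" if "p permutes {1..n}" for p
      unfolding d_def sum_subtractf using sum.reindex_bij_betw[OF permutes_imp_bij[OF that], of y] by simp
    then have "of_int (sign p) * ?Q k (\<lambda>i. y (p i) - x i) * (\<Sum>i=1..n. y i - x i) =
        of_int (sign p) * (\<Sum>i=1..n. d p i * ?Q k (d p))" if "p permutes {1..n}" for p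
      using that by (simp only: d_def sum_distrib_right[symmetric] mult_ac)
    then show ?thesis
      unfolding signed_walk_count_def by (subst sum_distrib_right, intro sum.cong refl) simp
  qed
  have 2: "(\<Sum>i=1..n. signed_walk_count n (k - 1) (x + \<e> i) y) = ?\<Sigma> (\<lambda>p. \<Sum>i=1..n. 1 * ?Q (k - 1) (d p - \<e> i))"
  proof -
    have "(\<lambda>l. y (p l) - (x + \<e> i) l) = d p - \<e> i" for p i by (auto simp: d_def)
    then show ?thesis
      unfolding signed_walk_count_def sum_distrib_left
      by (subst sum.swap) (simp only: mult_ac mult_1_left)
  qed
  have 3: "(\<Sum>i=1..n. 1 * signed_walk_count n (k - 1) x (y + \<e> i)) =
      ?\<Sigma> (\<lambda>p. \<Sum>i=1..n. 1 * ?Q (k - 1) (d p + \<e> i))"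
    by (rule sum_signed_walk_count) (auto simp: d_def unit_tuple_permute fun_eq_iff)
  have key: "(\<Sum>i=1..n. d p i * ?Q k (d p)) =
     int k * ((\<Sum>i=1..n. 1 * ?Q (k - 1) (d p - \<e> i)) - (\<Sum>i=1..n. 1 * ?Q (k - 1) (d p + \<e> i)))" for p
    unfolding sum_subtractf[symmetric] sum_distrib_left mult_1_left
    by (intro sum.cong refl free_walk_count_coordinate)
  have sub: "?\<Sigma> F - ?\<Sigma> G = ?\<Sigma> (\<lambda>p. F p - G p)" for F G :: "(nat \<Rightarrow> nat) \<Rightarrow> int"
    by (simp add: sum_subtractf right_diff_distrib)
  have scale: "c * ?\<Sigma> F = ?\<Sigma> (\<lambda>p. c * F p)" for c :: int and F
    by (simp add: sum_distrib_left mult_ac)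
  have "signed_walk_count n k x y * (\<Sum>i=1..n. y i - x i) =
     int k * ((\<Sum>i=1..n. signed_walk_count n (k - 1) (x + \<e> i) y)
       - (\<Sum>i=1..n. 1 * signed_walk_count n (k - 1) x (y + \<e> i)))"
    unfolding 1 2 3 sub key scale ..
  then show ?thesis by simp
qed

section \<open>Strictly increasing configurations and the last-step recursion for walks\<close>

lemma strictly_increasing_less:
  assumes "strictly_increasing n x" "i \<in> {1..n}" "j \<in> {1..n}" "i < j"
  shows "x i < x j"
  using assms(4,3)
proof (induction j rule: less_induct)
  case (less j)
  have s: "x (j - 1) < x (j - 1 + 1)"
    using assms(1,2) less.prems unfolding strictly_increasing_def by (elim ballE[of _ _ "j - 1"]) auto
  show ?case
  proof (cases "i = j - 1")
    case True
    with s less.prems show ?thesis by simp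
  next
    case False
    then have "x i < x (j - 1)" using less.prems assms(2) by (intro less.IH) auto
    with s less.prems show ?thesis by simp
  qed
qed

lemma strictly_increasing_cong:
  "(\<And>i. i \<in> {1..n} \<Longrightarrow> x i = y i) \<Longrightarrow> strictly_increasing n x \<longleftrightarrow> strictly_increasing n y"
  unfolding strictly_increasing_def by (intro ball_cong refl) auto

text \<open>Such a matching p preserves order on {1..n}, hence p i \<ge> i by induction, and a
  permutation with this property is the identity.\<close>

lemma strictly_increasing_permuted_eq:
  assumes x: "strictly_increasing n x" and y: "strictly_increasing n y"
    and p: "p permutes {1..n}" and eq: "\<And>i. i \<in> {1..n} \<Longrightarrow> y (p i) = x i"
  shows "p = id"
proof -
  have less: "p i < p j" if "i \<in> {1..n}" "j \<in> {1..n}" "i < j" for i j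
  proof (rule ccontr)
    have pij: "p i \<in> {1..n}" "p j \<in> {1..n}" using that p by (simp_all only: permutes_in_image)
    assume "\<not> p i < p j"
    then have "y (p j) \<le> y (p i)"
      using strictly_increasing_less[OF y pij(2,1)] by (cases "p i = p j") auto
    moreover have "x i < x j" by (rule strictly_increasing_less[OF x that])
    ultimately show False using eq that by simp
  qed
  have ge: "i \<in> {1..n} \<longrightarrow> i \<le> p i" for i
  proof (induction i)
    case (Suc i)
    show ?case
    proof (cases "i = 0")
      case True
      show ?thesis
      proof
        assume "Suc i \<in> {1..n}"
        with p have "p (Suc i) \<in> {1..n}" by (simp only: permutes_in_image)
        with True show "Suc i \<le> p (Suc i)" by simp
      qed
    next
      case False
      with Suc.IH less[of i "Suc i"] show ?thesis by auto
    qed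
  qed simp
  show ?thesis using ge by (intro permutes_natset_ge[OF p]) auto
qed

lemma signed_walk_count_0:
  assumes x: "strictly_increasing n x" and y: "strictly_increasing n y"
  shows "signed_walk_count n 0 x y = (if \<forall>i\<in>{1..n}. x i = y i then 1 else 0)"
proof -
  have "signed_walk_count n 0 x y =
      (\<Sum>p | p permutes {1..n}. if p = id then free_walk_count n 0 (\<lambda>i. y i - x i) else 0)"
    unfolding signed_walk_count_def
  proof (intro sum.cong refl)
    fix p assume "p \<in> {p. p permutes {1..n}}"
    then show "of_int (sign p) * free_walk_count n 0 (\<lambda>i. y (p i) - x i) =
        (if p = id then free_walk_count n 0 (\<lambda>i. y i - x i) else 0)"
      using strictly_increasing_permuted_eq[OF x y, of p] by auto
  qed
  also have "\<dots> = free_walk_count n 0 (\<lambda>i. y i - x i)"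
    by (simp add: finite_permutations permutes_id)
  finally show ?thesis by auto
qed

lemma signed_walk_count_Suc:
  "signed_walk_count n (Suc k) x y =
     (\<Sum>i=1..n. signed_walk_count n k x (y + \<e> i) + signed_walk_count n k x (y - \<e> i))"
proof -
  define d where "d = (\<lambda>p i. y (p i) - x i)"
  have 1: "(\<Sum>i=1..n. 1 * signed_walk_count n k x (y + \<e> i)) =
      (\<Sum>p | p permutes {1..n}. of_int (sign p) * (\<Sum>i=1..n. 1 * free_walk_count n k (d p + \<e> i)))"
    by (rule sum_signed_walk_count) (auto simp: d_def unit_tuple_permute fun_eq_iff)
  have 2: "(\<Sum>i=1..n. 1 * signed_walk_count n k x (y - \<e> i)) =
      (\<Sum>p | p permutes {1..n}. of_int (sign p) * (\<Sum>i=1..n. 1 * free_walk_count n k (d p - \<e> i)))"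
    by (rule sum_signed_walk_count) (auto simp: d_def unit_tuple_permute fun_eq_iff)
  have "(\<Sum>i=1..n. signed_walk_count n k x (y + \<e> i) + signed_walk_count n k x (y - \<e> i)) =
      (\<Sum>i=1..n. 1 * signed_walk_count n k x (y + \<e> i)) + (\<Sum>i=1..n. 1 * signed_walk_count n k x (y - \<e> i))"
    by (simp add: sum.distrib)
  moreover have "signed_walk_count n (Suc k) x y =
      (\<Sum>p | p permutes {1..n}. of_int (sign p) * (\<Sum>i=1..n. 1 * free_walk_count n k (d p + \<e> i)))
      + (\<Sum>p | p permutes {1..n}. of_int (sign p) * (\<Sum>i=1..n. 1 * free_walk_count n k (d p - \<e> i)))"
    by (simp add: signed_walk_count_def d_def sum.distrib distrib_left)
  ultimately show ?thesis unfolding 1 2 by simp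
qed

text \<open>A unit step changes each gap by at most 1, so walkers cannot pass each other without
  meeting: a failure of strict order is an equality of neighbours.\<close>

lemma strictly_increasing_unit_step:
  assumes "strictly_increasing n v" "\<not> strictly_increasing n (\<lambda>i. v i + c * \<e> j i)" "c \<in> {1, -1}"
  shows "\<exists>i\<in>{1..<n}. v i + c * \<e> j i = v (i + 1) + c * \<e> j (i + 1)"
proof -
  from assms(2) obtain i where i: "i \<in> {1..<n}" "\<not> v i + c * \<e> j i < v (i + 1) + c * \<e> j (i + 1)"
    unfolding strictly_increasing_def by auto
  with assms(1) have "v i < v (i + 1)" unfolding strictly_increasing_def by auto
  with i assms(3) have "v i + c * \<e> j i = v (i + 1) + c * \<e> j (i + 1)"
    by (auto simp: unit_tuple_apply split: if_splits)
  with i show ?thesis by blast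
qed

lemma walks_eq_empty:
  assumes "\<not> strictly_increasing n x \<or> \<not> strictly_increasing n y"
  shows "walks n k x y = {}"
proof (rule ccontr)
  assume "walks n k x y \<noteq> {}"
  then obtain w where w: "w \<in> walks n k x y" by blast
  have "strictly_increasing n (w 0)" "strictly_increasing n (w k)"
    using w unfolding walks_def by auto
  moreover have "\<And>i. i \<in> {1..n} \<Longrightarrow> w 0 i = x i" "\<And>i. i \<in> {1..n} \<Longrightarrow> w k i = y i"
    using w unfolding walks_def by auto
  ultimately show False
    using assms strictly_increasing_cong[of n "w 0" x] strictly_increasing_cong[of n "w k" y] by blast
qed

lemma walk_count_eq_0:
  "\<not> strictly_increasing n x \<or> \<not> strictly_increasing n y \<Longrightarrow> walk_count n k x y = 0"
  by (simp add: walk_count_def walks_eq_empty)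

definition walk_step :: "nat \<Rightarrow> (nat \<Rightarrow> int) \<Rightarrow> (nat \<Rightarrow> int) \<Rightarrow> bool" where
  "walk_step n u v \<longleftrightarrow> (\<exists>i\<in>{1..n}. \<exists>d\<in>{1, -1}. v = u(i := u i + d))"

lemma walks_iff:
  "w \<in> walks n k x y \<longleftrightarrow>
     w \<in> {0..k} \<rightarrow>\<^sub>E ({1..n} \<rightarrow>\<^sub>E UNIV) \<and> (\<forall>i\<in>{1..n}. w 0 i = x i) \<and> (\<forall>i\<in>{1..n}. w k i = y i) \<and>
     (\<forall>t\<in>{0..k}. strictly_increasing n (w t)) \<and> (\<forall>t<k. walk_step n (w t) (w (t + 1)))"
  unfolding walks_def walk_step_def mem_Collect_eq ..

lemma walks_0:
  assumes "strictly_increasing n x"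
  shows "walks n 0 x y = (if \<forall>i\<in>{1..n}. x i = y i then {\<lambda>t\<in>{0}. restrict x {1..n}} else {})"
proof (cases "\<forall>i\<in>{1..n}. x i = y i")
  case True
  let ?c = "\<lambda>t\<in>{0::nat}. restrict x {1..n}"
  have "strictly_increasing n (restrict x {1..n})"
    using assms strictly_increasing_cong[of n "restrict x {1..n}" x] by simp
  then have "?c \<in> walks n 0 x y" using True by (simp add: walks_def)
  moreover have "w = ?c" if "w \<in> walks n 0 x y" for w
  proof -
    have PE: "w \<in> {0..0} \<rightarrow>\<^sub>E ({1..n} \<rightarrow>\<^sub>E (UNIV :: int set))" and w0: "\<And>i. i \<in> {1..n} \<Longrightarrow> w 0 i = x i"
      using that by (auto simp: walks_def)
    have "w 0 \<in> {1..n} \<rightarrow>\<^sub>E (UNIV :: int set)" using PE by (rule PiE_mem) simp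
    then have "w 0 = restrict x {1..n}" using w0 by (intro PiE_ext[of _ "{1..n}" "\<lambda>_. UNIV"]) auto
    then show ?thesis using PiE_arb[OF PE] by (auto simp: fun_eq_iff restrict_def)
  qed
  ultimately have "walks n 0 x y = {?c}" by blast
  with True show ?thesis by simp
next
  case False
  have "walks n 0 x y = {}"
  proof (rule equals0I)
    fix w assume "w \<in> walks n 0 x y"
    then have "\<forall>i\<in>{1..n}. w 0 i = x i" "\<forall>i\<in>{1..n}. w 0 i = y i"
      unfolding walks_iff by blast+
    then have "\<forall>i\<in>{1..n}. x i = y i" by metis
    with False show False by blast
  qed
  with False show ?thesis by simp
qed

text \<open>The last configuration is fixed by \<open>y\<close>, so deleting it loses nothing, and
  the one before it is \<open>y\<close> with the step undone. The inverse appends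
  \<open>restrict y {1..n}\<close>, the extensional form of \<open>y\<close>.\<close>

lemma bij_betw_walks_last_step:
  assumes y: "strictly_increasing n y" and i: "i \<in> {1..n}" and d: "d \<in> {1, -1}"
  shows "bij_betw (\<lambda>w. restrict w {0..k})
    {w \<in> walks n (Suc k) x y. w (Suc k) = (w k)(i := w k i + d)} (walks n k x (\<lambda>j. y j - d * \<e> i j))"
proof (rule bij_betw_byWitness[where f' = "\<lambda>w. w(Suc k := restrict y {1..n})"])
  let ?A = "{w \<in> walks n (Suc k) x y. w (Suc k) = (w k)(i := w k i + d)}"
  let ?B = "walks n k x (\<lambda>j. y j - d * \<e> i j)"
  show "\<forall>w\<in>?A. (restrict w {0..k})(Suc k := restrict y {1..n}) = w"
  proof
    fix w assume w: "w \<in> ?A"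
    then have PE: "w \<in> {0..Suc k} \<rightarrow>\<^sub>E ({1..n} \<rightarrow>\<^sub>E (UNIV :: int set))" and last: "\<forall>i\<in>{1..n}. w (Suc k) i = y i"
      unfolding walks_iff by blast+
    have "w (Suc k) \<in> {1..n} \<rightarrow>\<^sub>E (UNIV :: int set)" using PE by (rule PiE_mem) simp
    then have "w (Suc k) = restrict y {1..n}" using last by (intro PiE_ext) auto
    moreover have "w t = undefined" if "t > Suc k" for t
      using PiE_arb[OF PE, of t] that by auto
    ultimately show "(restrict w {0..k})(Suc k := restrict y {1..n}) = w"
      by (auto simp: fun_eq_iff restrict_def not_le)
  qed
  show "\<forall>w\<in>?B. restrict (w(Suc k := restrict y {1..n})) {0..k} = w"
  proof
    fix w assume w: "w \<in> ?B"
    then have PE: "w \<in> {0..k} \<rightarrow>\<^sub>E ({1..n} \<rightarrow>\<^sub>E (UNIV :: int set))" by (simp_all add: walks_iff)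
    show "restrict (w(Suc k := restrict y {1..n})) {0..k} = w"
      using PiE_arb[OF PE] by (auto simp: fun_eq_iff restrict_def)
  qed
  show "(\<lambda>w. restrict w {0..k}) ` ?A \<subseteq> ?B"
  proof
    fix w' assume "w' \<in> (\<lambda>w. restrict w {0..k}) ` ?A"
    then obtain w where w: "w \<in> walks n (Suc k) x y" "w (Suc k) = (w k)(i := w k i + d)"
      and w': "w' = restrict w {0..k}" by blast
    have PE: "w \<in> {0..Suc k} \<rightarrow>\<^sub>E ({1..n} \<rightarrow>\<^sub>E (UNIV :: int set))"
      and ends: "\<forall>i\<in>{1..n}. w 0 i = x i" "\<forall>i\<in>{1..n}. w (Suc k) i = y i"
      and inc: "\<forall>t\<in>{0..Suc k}. strictly_increasing n (w t)"
      and step: "\<forall>t<Suc k. walk_step n (w t) (w (t + 1))"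
      using w(1) unfolding walks_iff by simp_all
    have k: "w k j = y j - d * \<e> i j" if "j \<in> {1..n}" for j
      using fun_cong[OF w(2), of j] ends(2) that by (auto simp: unit_tuple_apply split: if_splits)
    have "restrict w {0..k} \<in> {0..k} \<rightarrow>\<^sub>E ({1..n} \<rightarrow>\<^sub>E (UNIV :: int set))"
      using PiE_mem[OF PE] by (intro restrict_PiE_iff[THEN iffD2] ballI) auto
    moreover have "walk_step n (w' t) (w' (t + 1))" if "t < k" for t
      using step[rule_format, of t] that by (simp add: w')
    ultimately show "w' \<in> ?B"
      unfolding walks_iff using ends(1) inc k by (simp add: w')
  qed
  show "(\<lambda>w. w(Suc k := restrict y {1..n})) ` ?B \<subseteq> ?A"
  proof
    fix w' assume "w' \<in> (\<lambda>w. w(Suc k := restrict y {1..n})) ` ?B"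
    then obtain w where w: "w \<in> ?B" and w': "w' = w(Suc k := restrict y {1..n})" by blast
    have PE: "w \<in> {0..k} \<rightarrow>\<^sub>E ({1..n} \<rightarrow>\<^sub>E (UNIV :: int set))"
      and ends: "\<forall>i\<in>{1..n}. w 0 i = x i" "\<forall>j\<in>{1..n}. w k j = y j - d * \<e> i j"
      and inc: "\<forall>t\<in>{0..k}. strictly_increasing n (w t)"
      and step: "\<forall>t<k. walk_step n (w t) (w (t + 1))"
      using w unfolding walks_iff by simp_all
    have wk: "w k \<in> {1..n} \<rightarrow>\<^sub>E (UNIV :: int set)" using PE by (rule PiE_mem) simp
    have last: "restrict y {1..n} = (w k)(i := w k i + d)"
      using ends(2) i PiE_arb[OF wk] by (auto simp: fun_eq_iff restrict_def unit_tuple_apply)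
    have incy: "strictly_increasing n (restrict y {1..n})"
      using y strictly_increasing_cong[of n "restrict y {1..n}" y] by simp
    have "w' \<in> {0..Suc k} \<rightarrow>\<^sub>E ({1..n} \<rightarrow>\<^sub>E (UNIV :: int set))"
    proof (rule PiE_I)
      fix t assume "t \<in> {0..Suc k}"
      then show "w' t \<in> {1..n} \<rightarrow>\<^sub>E (UNIV :: int set)"
        using PiE_mem[OF PE, of t] by (cases "t = Suc k") (auto simp: w')
    next
      fix t assume "t \<notin> {0..Suc k}"
      then show "w' t = undefined" using PiE_arb[OF PE, of t] by (auto simp: w')
    qed
    moreover have "\<forall>i\<in>{1..n}. w' 0 i = x i" "\<forall>i\<in>{1..n}. w' (Suc k) i = y i"
      using ends(1) by (auto simp: w')
    moreover have "\<forall>t\<in>{0..Suc k}. strictly_increasing n (w' t)"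
      using inc incy by (auto simp: w' le_Suc_eq)
    moreover have "walk_step n (w' t) (w' (t + 1))" if "t < Suc k" for t
    proof (cases "t = k")
      case True
      have "walk_step n (w k) (restrict y {1..n})" using last i d unfolding walk_step_def by blast
      with True show ?thesis by (simp add: w')
    next
      case False
      with that have "t < k" by simp
      with step have "walk_step n (w t) (w (t + 1))" by blast
      with \<open>t < k\<close> show ?thesis by (simp add: w')
    qed
    ultimately have "w' \<in> walks n (Suc k) x y" unfolding walks_iff by blast
    moreover have "w' (Suc k) = (w' k)(i := w' k i + d)" using last by (simp add: w')
    ultimately show "w' \<in> ?A" by blast
  qed
qed

lemma walks_Suc_partition:
  "walks n (Suc k) x y =
     (\<Union>(i, d)\<in>{1..n} \<times> {1, -1}. {w \<in> walks n (Suc k) x y. w (Suc k) = (w k)(i := w k i + d)})"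
proof -
  have "\<exists>i\<in>{1..n}. \<exists>d\<in>{1, -1}. w (Suc k) = (w k)(i := w k i + d)" if "w \<in> walks n (Suc k) x y" for w
  proof -
    have "walk_step n (w k) (w (k + 1))" using that unfolding walks_iff by blast
    then show ?thesis unfolding walk_step_def by simp
  qed
  then show ?thesis by blast
qed

lemma finite_walks: "finite (walks n k x y)"
proof (cases "strictly_increasing n x")
  case x: True
  show ?thesis
  proof (induction k arbitrary: y)
    case 0
    then show ?case by (simp add: walks_0[OF x])
  next
    case (Suc k)
    show ?case
    proof (cases "strictly_increasing n y")
      case True
      have "finite {w \<in> walks n (Suc k) x y. w (Suc k) = (w k)(i := w k i + d)}"
        if "i \<in> {1..n}" "d \<in> {1, -1}" for i d
        using bij_betw_finite[OF bij_betw_walks_last_step[OF True that]] Suc.IH by blast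
      then have fin: "finite (case a of (i, d) \<Rightarrow> {w \<in> walks n (Suc k) x y. w (Suc k) = (w k)(i := w k i + d)})"
        if "a \<in> {1..n} \<times> {1, -1}" for a
        using that by (cases a) (simp only: mem_Sigma_iff prod.case)
      show ?thesis by (subst walks_Suc_partition) (rule finite_UN_I[OF _ fin]; simp)
    next
      case False
      then show ?thesis by (simp add: walks_eq_empty)
    qed
  qed
next
  case False
  then show ?thesis by (simp add: walks_eq_empty)
qed

text \<open>Written with the factors 1 and -1 so that steps in both directions are instances of one
  statement with a parameter c. Undoing a step d leads to y - d e_i, hence the reversed order of the
  two summands.\<close>

lemma walk_count_Suc:
  assumes y: "strictly_increasing n y"
  shows "walk_count n (Suc k) x y =
    (\<Sum>i=1..n. walk_count n k x (\<lambda>j. y j + 1 * \<e> i j) + walk_count n k x (\<lambda>j. y j + (-1) * \<e> i j))"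
proof -
  let ?I = "{1..n} \<times> {1, -1 :: int}"
  let ?A = "\<lambda>(i, d). {w \<in> walks n (Suc k) x y. w (Suc k) = (w k)(i := w k i + d)}"
  have disj: "?A a \<inter> ?A b = {}" if "a \<in> ?I" "b \<in> ?I" "a \<noteq> b" for a b
  proof -
    obtain i d j e where ab: "a = (i, d)" "b = (j, e)" by fastforce
    have "d \<noteq> 0" "e \<noteq> 0" using that by (auto simp: ab)
    \<comment> \<open>The last step reveals which walker moved and in which direction, so the
      classes are disjoint.\<close>
    have ne: "u(i := u i + d) \<noteq> u(j := u j + e)" for u :: "nat \<Rightarrow> int"
    proof
      assume eq: "u(i := u i + d) = u(j := u j + e)"
      show False
      proof (cases "i = j")
        case True
        with fun_cong[OF eq, of i] that(3) show False by (simp add: ab)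
      next
        case False
        with fun_cong[OF eq, of i] \<open>d \<noteq> 0\<close> show False by simp
      qed
    qed
    have False if "w \<in> ?A a" "w \<in> ?A b" for w
      using that ne[of "w k"] by (simp add: ab)
    then show ?thesis by blast
  qed
  have fin: "finite (?A a)" for a using finite_walks[of n "Suc k" x y] by (auto split: prod.split)
  have card_A: "card (?A (i, d)) = card (walks n k x (\<lambda>j. y j - d * \<e> i j))"
    if "i \<in> {1..n}" "d \<in> {1, -1}" for i d
    using bij_betw_same_card[OF bij_betw_walks_last_step[OF y that]] by simp
  have "card (walks n (Suc k) x y) = card (\<Union>a\<in>?I. ?A a)"
    by (subst walks_Suc_partition) (simp add: case_prod_unfold)
  also have "\<dots> = (\<Sum>a\<in>?I. card (?A a))"
    using disj fin by (intro card_UN_disjoint ballI) auto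
  also have "\<dots> = (\<Sum>i=1..n. \<Sum>d\<in>{1,-1}. card (walks n k x (\<lambda>j. y j - d * \<e> i j)))"
    unfolding sum.cartesian_product by (intro sum.cong refl) (use card_A in force)
  finally show ?thesis by (simp add: walk_count_def add.commute)
qed

text \<open>One step out of strict order makes two neighbours equal, and there antisymmetry forces
  the signed count to vanish.\<close>

lemma signed_walk_count_unit_step_eq_0:
  assumes "strictly_increasing n y" "\<not> strictly_increasing n (\<lambda>i. y i + c * \<e> j i)" "c \<in> {1, -1}"
  shows "signed_walk_count n k x (\<lambda>i. y i + c * \<e> j i) = 0"
proof -
  obtain i where "i \<in> {1..<n}" "y i + c * \<e> j i = y (i + 1) + c * \<e> j (i + 1)"
    using strictly_increasing_unit_step[OF assms] by blast
  then show ?thesis by (intro signed_walk_count_eq_0[of i n "i + 1"]) auto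
qed

text \<open>Both sides satisfy the same recursion in the last step, since the alternating count vanishes as
  soon as two walkers meet.\<close>

lemma walk_count_eq_signed_walk_count:
  assumes x: "strictly_increasing n x" and y: "strictly_increasing n y"
  shows "walk_count n k x y = signed_walk_count n k x y"
  using y
proof (induction k arbitrary: y)
  case 0
  then show ?case using signed_walk_count_0[OF x 0] by (simp add: walk_count_def walks_0[OF x])
next
  case (Suc k)
  have *: "walk_count n k x (\<lambda>j. y j + c * \<e> i j) = signed_walk_count n k x (\<lambda>j. y j + c * \<e> i j)"
    if "c \<in> {1, -1}" for c i
  proof (cases "strictly_increasing n (\<lambda>j. y j + c * \<e> i j)")
    case False
    with signed_walk_count_unit_step_eq_0[OF Suc.prems False that] show ?thesis
      by (simp add: walk_count_eq_0)
  qed (rule Suc.IH)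
  have "y + \<e> i = (\<lambda>j. y j + 1 * \<e> i j)" "y - \<e> i = (\<lambda>j. y j + (-1) * \<e> i j)" for i by auto
  then show ?case
    unfolding walk_count_Suc[OF Suc.prems] signed_walk_count_Suc by (simp only: * insertI1 insertI2)
qed

lemma walk_count_commute: "walk_count n k x y = walk_count n k y x"
  using walk_count_eq_signed_walk_count[of n x y k] walk_count_eq_signed_walk_count[of n y x k]
    signed_walk_count_commute[of n k x y] walk_count_eq_0[of n x y k] walk_count_eq_0[of n y x k]
  by (cases "strictly_increasing n x"; cases "strictly_increasing n y") auto

lemma walk_count_unit_step:
  assumes x: "strictly_increasing n x" and y: "strictly_increasing n y"
  shows "walk_count n k x (y + \<e> i) = signed_walk_count n k x (y + \<e> i)"
    and "walk_count n k x (y - \<e> i) = signed_walk_count n k x (y - \<e> i)"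
proof -
  have *: "walk_count n k x (\<lambda>j. y j + c * \<e> i j) = signed_walk_count n k x (\<lambda>j. y j + c * \<e> i j)"
    if "c \<in> {1, -1}" for c i
    using walk_count_eq_signed_walk_count[OF x, of "\<lambda>j. y j + c * \<e> i j"]
      signed_walk_count_unit_step_eq_0[OF y _ that] walk_count_eq_0[of n x "\<lambda>j. y j + c * \<e> i j"]
    by (cases "strictly_increasing n (\<lambda>j. y j + c * \<e> i j)") simp_all
  have "y + \<e> i = (\<lambda>j. y j + 1 * \<e> i j)" "y - \<e> i = (\<lambda>j. y j + (-1) * \<e> i j)" by auto
  then show "walk_count n k x (y + \<e> i) = signed_walk_count n k x (y + \<e> i)"
    and "walk_count n k x (y - \<e> i) = signed_walk_count n k x (y - \<e> i)"
    by (simp_all only: * insertI1 insertI2)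
qed

text \<open>A double step can overtake. If y (i + 1) = y i + 1, then y + 2 e_i is y + e_i + e_(i+1)
  with the entries i and i + 1 exchanged: the walk count is 0, while the signed count is minus that
  of the adjacent pair. In all other cases walker i at worst meets its neighbour, and both counts
  agree.\<close>

lemma walk_count_double_steps:
  assumes x: "strictly_increasing n x" and y: "strictly_increasing n y"
  shows "(\<Sum>i=1..n. walk_count n k x (y + \<e> i + \<e> i))
      - (\<Sum>i\<in>{i. 1 \<le> i \<and> i \<le> n - 1 \<and> y (i + 1) - y i = 1}. walk_count n k x (y + \<e> i + \<e> (i + 1)))
    = (\<Sum>i=1..n. signed_walk_count n k x (y + \<e> i + \<e> i))"
proof -
  let ?adj = "\<lambda>i. i \<le> n - 1 \<and> y (i + 1) - y i = 1"
  have y': "y i < y (i + 1)" if "i \<in> {1..<n}" for i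
    using y that unfolding strictly_increasing_def by blast
  have adj: "{i. 1 \<le> i \<and> i \<le> n - 1 \<and> y (i + 1) - y i = 1} = {i \<in> {1..n}. ?adj i}" by auto
  have *: "walk_count n k x (y + \<e> i + \<e> i) - (if ?adj i then walk_count n k x (y + \<e> i + \<e> (i + 1)) else 0)
      = signed_walk_count n k x (y + \<e> i + \<e> i)" if i: "i \<in> {1..n}" for i
  proof (cases "?adj i \<and> i < n")
    case True
    then have i': "i \<in> {1..<n}" "i + 1 \<in> {1..n}" using i by auto
    have "\<not> strictly_increasing n (y + \<e> i + \<e> i)"
    proof
      assume "strictly_increasing n (y + \<e> i + \<e> i)"
      then have "(y + \<e> i + \<e> i) i < (y + \<e> i + \<e> i) (i + 1)"
        using i'(1) unfolding strictly_increasing_def by blast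
      with True show False by (simp add: unit_tuple_apply)
    qed
    then have "walk_count n k x (y + \<e> i + \<e> i) = 0" by (simp add: walk_count_eq_0)
    moreover have "(y + \<e> i + \<e> i) = (\<lambda>l. (y + \<e> i + \<e> (i + 1)) (Transposition.transpose i (i + 1) l))"
      using True by (auto simp: fun_eq_iff unit_tuple_apply Transposition.transpose_def)
    then have "signed_walk_count n k x (y + \<e> i + \<e> i) = - signed_walk_count n k x (y + \<e> i + \<e> (i + 1))"
      using signed_walk_count_swap[of i n "i + 1" k x "y + \<e> i + \<e> (i + 1)"] i i'(2) by (simp only: simp_thms)
    \<comment> \<open>Walker i + 1 may run into walker i + 2 here; then both counts are 0.\<close>
    moreover have "walk_count n k x (y + \<e> i + \<e> (i + 1)) = signed_walk_count n k x (y + \<e> i + \<e> (i + 1))"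
    proof (cases "strictly_increasing n (y + \<e> i + \<e> (i + 1))")
      case True
      then show ?thesis by (rule walk_count_eq_signed_walk_count[OF x])
    next
      case False
      then obtain j where j: "j \<in> {1..<n}"
        "(y + \<e> i + \<e> (i + 1)) (j + 1) \<le> (y + \<e> i + \<e> (i + 1)) j"
        unfolding strictly_increasing_def by fastforce
      with y'[OF j(1)] have "(y + \<e> i + \<e> (i + 1)) j = (y + \<e> i + \<e> (i + 1)) (j + 1)"
        by (auto simp: unit_tuple_apply split: if_splits)
      with j(1) have "signed_walk_count n k x (y + \<e> i + \<e> (i + 1)) = 0"
        by (intro signed_walk_count_eq_0[of j n "j + 1"]) auto
      with False show ?thesis by (simp add: walk_count_eq_0)
    qed
    ultimately show ?thesis using True by simp
  next
    case False
    have nadj: "\<not> ?adj i" using False i by auto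
    have "walk_count n k x (y + \<e> i + \<e> i) = signed_walk_count n k x (y + \<e> i + \<e> i)"
    proof (cases "strictly_increasing n (y + \<e> i + \<e> i)")
      case True
      then show ?thesis by (rule walk_count_eq_signed_walk_count[OF x])
    next
      case nsi: False
      then obtain j where j: "j \<in> {1..<n}" "(y + \<e> i + \<e> i) (j + 1) \<le> (y + \<e> i + \<e> i) j"
        unfolding strictly_increasing_def by fastforce
      with y'[OF j(1)] nadj have "(y + \<e> i + \<e> i) j = (y + \<e> i + \<e> i) (j + 1)"
        by (auto simp: unit_tuple_apply split: if_splits)
      with j(1) have "signed_walk_count n k x (y + \<e> i + \<e> i) = 0"
        by (intro signed_walk_count_eq_0[of j n "j + 1"]) auto
      with nsi show ?thesis by (simp add: walk_count_eq_0)
    qed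
    then show ?thesis by (simp only: nadj if_False diff_0_right)
  qed
  have "(\<Sum>i\<in>{i. 1 \<le> i \<and> i \<le> n - 1 \<and> y (i + 1) - y i = 1}. walk_count n k x (y + \<e> i + \<e> (i + 1)))
      = (\<Sum>i=1..n. if ?adj i then walk_count n k x (y + \<e> i + \<e> (i + 1)) else 0)"
    unfolding adj by (rule sum.inter_filter) simp
  then show ?thesis by (simp only: sum_subtractf[symmetric] * cong: sum.cong)
qed

text \<open>At k = 0 the truncated k - 1 is again 0, and the factor \<open>int k\<close> removes
  those terms.\<close>

lemma walk_count_difference_1:
  assumes x: "strictly_increasing n x" and y: "strictly_increasing n y"
  shows "- (\<Sum>i=1..n. (y i + 1) * walk_count n k x (y + \<e> i) - x i * walk_count n k (x - \<e> i) y)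
    + int k * (int n * walk_count n (k - 1) x y
               - (\<Sum>i=1..n. walk_count n (k - 1) x (y + \<e> i + \<e> i))
               + (\<Sum>i\<in>{i. 1 \<le> i \<and> i \<le> n - 1 \<and> y (i + 1) - y i = 1}.
                    walk_count n (k - 1) x (y + \<e> i + \<e> (i + 1)))) = 0"
proof -
  \<comment> \<open>The shift is in the first argument; reversing the walks moves it to the
    second.\<close>
  have "walk_count n k (x - \<e> i) y = signed_walk_count n k (x - \<e> i) y" for i
    by (subst walk_count_commute, subst signed_walk_count_commute) (rule walk_count_unit_step(2)[OF y x])
  then have "- (\<Sum>i=1..n. (y i + 1) * walk_count n k x (y + \<e> i) - x i * walk_count n k (x - \<e> i) y)
    + int k * (int n * walk_count n (k - 1) x y
      - ((\<Sum>i=1..n. walk_count n (k - 1) x (y + \<e> i + \<e> i))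
        - (\<Sum>i\<in>{i. 1 \<le> i \<and> i \<le> n - 1 \<and> y (i + 1) - y i = 1}.
                    walk_count n (k - 1) x (y + \<e> i + \<e> (i + 1))))) = 0"
    unfolding walk_count_double_steps[OF x y]
    using signed_walk_count_difference_1[where n = n and x = x and y = y and k = k]
    by (simp only: walk_count_unit_step[OF x y] walk_count_eq_signed_walk_count[OF x y])
  then show ?thesis by (simp only: diff_diff_eq2 add_diff_eq diff_add_eq)
qed

lemma walk_count_difference_2:
  assumes x: "strictly_increasing n x" and y: "strictly_increasing n y"
  shows "- walk_count n k x y * (\<Sum>i=1..n. y i - x i)
    + int k * ((\<Sum>i=1..n. walk_count n (k - 1) (x + \<e> i) y)
      - (\<Sum>i=1..n. walk_count n (k - 1) x (y + \<e> i))) = 0"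
proof -
  have "walk_count n l (x + \<e> i) y = signed_walk_count n l (x + \<e> i) y" for i l
    by (subst walk_count_commute, subst signed_walk_count_commute) (rule walk_count_unit_step(1)[OF y x])
  then show ?thesis
    using signed_walk_count_difference_2[where n = n and x = x and y = y and k = k]
    by (simp only: walk_count_unit_step[OF x y] walk_count_eq_signed_walk_count[OF x y])
qed

lemma walk_count_difference_3:
  assumes x: "strictly_increasing n x" and y: "strictly_increasing n y"
  shows "- (\<Sum>i=1..n. (x i + 1) * walk_count n k (x + \<e> i) y - y i * walk_count n k x (y - \<e> i))
    + int k * (int n * walk_count n (k - 1) x y
               - (\<Sum>i=1..n. walk_count n (k - 1) (x + \<e> i + \<e> i) y)
               + (\<Sum>i\<in>{i. 1 \<le> i \<and> i \<le> n - 1 \<and> x (i + 1) - x i = 1}.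
                    walk_count n (k - 1) (x + \<e> i + \<e> (i + 1)) y)) = 0"
proof -
  have 1: "walk_count n l y z = walk_count n l z y" for l z by (rule walk_count_commute)
  have 2: "walk_count n l (y - \<e> i) x = walk_count n l x (y - \<e> i)" for l i by (rule walk_count_commute)
  show ?thesis using walk_count_difference_1[OF y x, of k] unfolding 1 2 .
qed

section \<open>Schur functions in terms of power sums\<close>

text \<open>The complete homogeneous functions \<open>h\<^sub>r\<close> as polynomials in the power sums \<open>p\<^sub>k\<close>, by
  \<open>r h\<^sub>r = p\<^sub>1 h\<^bsub>r-1\<^esub> + \<dots> + p\<^sub>r h\<^sub>0\<close>.\<close>

fun newton_homogeneous :: "(nat \<Rightarrow> complex) \<Rightarrow> nat \<Rightarrow> complex" where
  "newton_homogeneous p 0 = 1"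
| "newton_homogeneous p (Suc r) = (\<Sum>k\<le>r. p (Suc k) * newton_homogeneous p (r - k)) / of_nat (Suc r)"

definition homogeneous :: "(nat \<Rightarrow> complex) \<Rightarrow> int \<Rightarrow> complex" where
  "homogeneous p r = (if r < 0 then 0 else newton_homogeneous p (nat r))"

text \<open>The Jacobi-Trudi determinant for arbitrary integer tuples, negative or unordered entries
  included, over formal power sums: p is later instantiated by the power traces of M and of its
  adjoint.\<close>

definition schur_det :: "nat \<Rightarrow> (nat \<Rightarrow> complex) \<Rightarrow> (nat \<Rightarrow> int) \<Rightarrow> complex" where
  "schur_det n p lam = leibniz_det {1..n} (\<lambda>i j. homogeneous p (lam i - int i + int j))"

text \<open>The generating function of the h_r in n variables is 1 over the product of the 1 - x_j
  t, a polynomial of degree at most n; c k is the k-th elementary symmetric function up to sign.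
  Setting c k = 0 beyond n keeps c 2 meaningful for n = 1.\<close>

definition satisfies_recurrence :: "nat \<Rightarrow> (nat \<Rightarrow> complex) \<Rightarrow> (int \<Rightarrow> complex) \<Rightarrow> bool" where
  "satisfies_recurrence n c h \<longleftrightarrow>
     (\<forall>k>n. c k = 0) \<and> (\<forall>m\<ge>1. h m = (\<Sum>k=1..n. c k * h (m - int k)))"

text \<open>A derivation with D p_(k+1) = (k+1) q_k sends h_r to the sum of the q_k h_(r-k-1). This
  and the next two lemmas evaluate that sum for q_k = p_(k+1), p_k and p_(k+2), which are the
  operators sum of x_j^a d/dx_j with a = 1, 0, 2.\<close>

lemma newton_identity:
  "(\<Sum>k<r. p (Suc k) * newton_homogeneous p (r - Suc k)) = of_nat r * newton_homogeneous p r"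
proof (cases r)
  case (Suc s)
  then have "(\<Sum>k<r. p (Suc k) * newton_homogeneous p (r - Suc k)) =
      (\<Sum>k\<le>s. p (Suc k) * newton_homogeneous p (s - k))"
    by (simp add: lessThan_Suc_atMost)
  also have "\<dots> = of_nat r * newton_homogeneous p r"
    using of_nat_neq_0[of s, where 'a = complex] by (simp add: Suc del: of_nat_Suc)
  finally show ?thesis .
qed simp

text \<open>\<open>p 0\<close> is going to be Tr 1 = n, so that the sum of the partial derivatives
  of h_r is (n + r - 1) h_(r-1).\<close>

lemma newton_identity_lowered:
  "(\<Sum>k<r. p k * newton_homogeneous p (r - Suc k)) = (p 0 + of_nat r - 1) * homogeneous p (int r - 1)"
proof (cases r)
  case (Suc s)
  have "(\<Sum>k<Suc s. p k * newton_homogeneous p (Suc s - Suc k)) =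
      p 0 * newton_homogeneous p s + of_nat s * newton_homogeneous p s"
    by (subst sum.lessThan_Suc_shift) (simp add: newton_identity)
  with Suc show ?thesis by (simp add: homogeneous_def algebra_simps)
qed (simp add: homogeneous_def)

lemma newton_identity_raised:
  "(\<Sum>k<r. p (Suc (Suc k)) * newton_homogeneous p (r - Suc k)) =
     of_nat (r + 1) * newton_homogeneous p (r + 1) - p 1 * newton_homogeneous p r"
proof -
  have "(\<Sum>k<Suc r. p (Suc k) * newton_homogeneous p (Suc r - Suc k)) =
      p 1 * newton_homogeneous p r + (\<Sum>k<r. p (Suc (Suc k)) * newton_homogeneous p (r - Suc k))"
    by (subst sum.lessThan_Suc_shift) simp
  with newton_identity[of p "Suc r"] show ?thesis
    by (simp only: Suc_eq_plus1) (simp add: algebra_simps)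
qed

section \<open>Derivations applied to Jacobi-Trudi determinants\<close>

lemma leibniz_det_scale_row:
  assumes "finite S" "a \<in> S"
  shows "leibniz_det S (f(a := \<lambda>j. c * v j)) = c * leibniz_det S (f(a := v))"
proof -
  have "(\<Prod>i\<in>S. (f(a := w)) i (q i)) = w (q a) * (\<Prod>i\<in>S-{a}. f i (q i))" for w q
    using assms by (subst prod.remove[OF assms]) (auto intro!: arg_cong2[of _ _ _ _ "(*)"] prod.cong)
  then show ?thesis
    by (simp add: leibniz_det_def sum_distrib_left mult_ac del: fun_upd_apply)
qed

text \<open>Row a with its indices shifted by s is row a for the tuple lam + s e_a.\<close>

lemma leibniz_det_deriv_shift:
  "leibniz_det_deriv {1..n} (\<lambda>i j. homogeneous p (lam i - int i + int j))
     (\<lambda>i j. c i * homogeneous p (lam i + s - int i + int j)) =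
   (\<Sum>a=1..n. c a * schur_det n p (\<lambda>i. lam i + s * \<e> a i))"
proof -
  have "leibniz_det {1..n} ((\<lambda>i j. homogeneous p (lam i - int i + int j))
      (a := \<lambda>j. c a * homogeneous p (lam a + s - int a + int j))) =
    c a * schur_det n p (\<lambda>i. lam i + s * \<e> a i)" if "a \<in> {1..n}" for a
    unfolding schur_det_def leibniz_det_scale_row[OF finite_atLeastAtMost that]
    by (intro arg_cong2[of _ _ _ _ "(*)"] leibniz_det_cong) (auto simp: unit_tuple_apply)
  then show ?thesis
    unfolding leibniz_det_deriv_rows[OF finite_atLeastAtMost] by (rule sum.cong[OF refl])
qed

text \<open>The factor splits as (lam i - i + n) + (j - 1). The first part depends on the row alone
  and gives the sum; the second is a matrix product f B with B of trace 0, so Jacobi's formula makes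
  it vanish.\<close>

lemma leibniz_det_deriv_lowered:
  "leibniz_det_deriv {1..n} (\<lambda>i j. homogeneous p (lam i - int i + int j))
     (\<lambda>i j. of_int (int n + (lam i - int i + int j) - 1) * homogeneous p (lam i - int i + int j - 1)) =
   (\<Sum>a=1..n. of_int (lam a - int a + int n) * schur_det n p (lam - \<e> a))"
proof -
  let ?f = "\<lambda>i j. homogeneous p (lam i - int i + int j)"
  let ?S = "{1..n}"
  \<comment> \<open>Column j becomes j - 1 times column j - 1; for j = 1 the missing column carries
    the factor 0.\<close>
  let ?B = "\<lambda>m j. if m + 1 = j then of_nat (j - 1) else (0 :: complex)"
  have "leibniz_det_deriv ?S ?f (\<lambda>i j. of_int (int n + (lam i - int i + int j) - 1) * homogeneous p (lam i - int i + int j - 1))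
     = leibniz_det_deriv ?S ?f (\<lambda>i j. of_int (lam i - int i + int n) * homogeneous p (lam i + (-1) - int i + int j)
        + of_nat (j - 1) * homogeneous p (lam i - int i + int j - 1))"
    by (intro leibniz_det_deriv_cong) (auto simp: algebra_simps of_nat_diff)
  also have "\<dots> = (\<Sum>a=1..n. of_int (lam a - int a + int n) * schur_det n p (\<lambda>i. lam i + (-1) * \<e> a i))
      + leibniz_det_deriv ?S ?f (\<lambda>i j. of_nat (j - 1) * homogeneous p (lam i - int i + int j - 1))"
    unfolding leibniz_det_deriv_add leibniz_det_deriv_shift ..
  also have "leibniz_det_deriv ?S ?f (\<lambda>i j. of_nat (j - 1) * homogeneous p (lam i - int i + int j - 1))
      = (\<Sum>j\<in>?S. ?B j j) * leibniz_det ?S ?f"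
  proof (rule leibniz_det_deriv_mult[where B = "?B"])
    fix i j assume "i \<in> ?S" and j: "j \<in> ?S"
    have "(\<Sum>m\<in>?S. ?f i m * ?B m j) = (\<Sum>m\<in>?S. if m = j - 1 then ?f i (j - 1) * of_nat (j - 1) else 0)"
      using j by (intro sum.cong) auto
    also have "\<dots> = of_nat (j - 1) * homogeneous p (lam i - int i + int j - 1)"
      using j by (auto simp: of_nat_diff algebra_simps)
    finally show "of_nat (j - 1) * homogeneous p (lam i - int i + int j - 1) = (\<Sum>m\<in>?S. ?f i m * ?B m j)" ..
  qed simp
  finally show ?thesis by (simp add: fun_diff_def)
qed

text \<open>Row part lam i - i and column part j are separated; the column part is a diagonal matrix
  of trace 1 + ... + n, which cancels the sum of the - i.\<close>

lemma leibniz_det_deriv_degree: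
  "leibniz_det_deriv {1..n} (\<lambda>i j. homogeneous p (lam i - int i + int j))
     (\<lambda>i j. of_int (lam i - int i + int j) * homogeneous p (lam i - int i + int j)) =
   of_int (\<Sum>i=1..n. lam i) * schur_det n p lam"
proof -
  let ?f = "\<lambda>i j. homogeneous p (lam i - int i + int j)"
  let ?S = "{1..n}"
  have "leibniz_det_deriv ?S ?f (\<lambda>i j. of_int (lam i - int i + int j) * ?f i j)
     = leibniz_det_deriv ?S ?f (\<lambda>i j. of_int (lam i - int i) * homogeneous p (lam i + 0 - int i + int j)
        + of_nat j * ?f i j)"
    by (intro leibniz_det_deriv_cong) (auto simp: algebra_simps)
  also have "\<dots> = (\<Sum>a=1..n. of_int (lam a - int a) * schur_det n p (\<lambda>i. lam i + 0 * \<e> a i))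
      + leibniz_det_deriv ?S ?f (\<lambda>i j. of_nat j * ?f i j)"
    unfolding leibniz_det_deriv_add leibniz_det_deriv_shift ..
  also have "leibniz_det_deriv ?S ?f (\<lambda>i j. of_nat j * ?f i j) =
      (\<Sum>j\<in>?S. if j = j then of_nat j else 0) * leibniz_det ?S ?f"
  proof (rule leibniz_det_deriv_mult[where B = "\<lambda>m j. if m = j then of_nat j else 0"])
    fix i j assume "i \<in> ?S" and j: "j \<in> ?S"
    have "(\<Sum>m\<in>?S. ?f i m * (if m = j then of_nat j else 0)) = (\<Sum>m\<in>?S. if m = j then of_nat j * ?f i j else 0)"
      by (intro sum.cong) auto
    with j show "of_nat j * ?f i j = (\<Sum>m\<in>?S. ?f i m * (if m = j then of_nat j else 0))" by simp
  qed simp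
  finally show ?thesis
    by (simp add: schur_det_def sum_distrib_right[symmetric] distrib_right[symmetric] sum_subtractf left_diff_distrib[symmetric])
qed

lemma partition_entry_nonneg:
  assumes "is_partition n lam" "i \<in> {1..n}" shows "lam i \<ge> 0"
  using assms by (auto simp: is_partition_def)

text \<open>Raising all indices by one multiplies the Jacobi-Trudi matrix by the companion matrix of the
  recurrence. Its trace is \<open>p\<^sub>1\<close> and that of its square is \<open>p\<^sub>2\<close>.\<close>

lemma homogeneous_shift:
  assumes "satisfies_recurrence n c (homogeneous p)" "n \<ge> 1" "lam \<ge> 0" "i \<in> {1..n}" "j \<in> {1..n}"
  shows "homogeneous p (lam - int i + int j + 1) =
    (\<Sum>m\<in>{1..n}. homogeneous p (lam - int i + int m) *
       (if j < n then (if m = j + 1 then 1 else 0) else c (n + 1 - m)))"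
proof (cases "j < n")
  case True
  have "(\<Sum>m\<in>{1..n}. homogeneous p (lam - int i + int m) *
       (if j < n then (if m = j + 1 then 1 else 0) else c (n + 1 - m))) =
     (\<Sum>m\<in>{1..n}. if m = j + 1 then homogeneous p (lam - int i + int (j + 1)) else 0)"
    using True by (intro sum.cong) auto
  with True show ?thesis by (simp add: algebra_simps)
next
  case False
  then have j: "j = n" using assms(5) by simp
  have "homogeneous p (lam - int i + int n + 1) = (\<Sum>k=1..n. c k * homogeneous p (lam - int i + int n + 1 - int k))"
    using assms unfolding satisfies_recurrence_def by auto
  also have "\<dots> = (\<Sum>m=1..n. c (n + 1 - m) * homogeneous p (lam - int i + int n + 1 - int (n + 1 - m)))"
    by (rule sum.reindex_bij_witness[of _ "\<lambda>m. n + 1 - m" "\<lambda>m. n + 1 - m"]) auto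
  also have "\<dots> = (\<Sum>m=1..n. homogeneous p (lam - int i + int m) * c (n + 1 - m))"
    by (intro sum.cong refl) (auto simp: of_nat_diff algebra_simps)
  finally show ?thesis using j by simp
qed

text \<open>The only nonzero diagonal entry of the companion matrix is c 1, in column n, so a weight
  d j on column j yields c 1 times d n. Weight 1 gives Pieri's rule for a single box, weight j
  serves \<open>leibniz_det_deriv_raised\<close>. The entries lam i \<ge> 0 keep lam i - i + n + 1
  \<ge> 1, where the recurrence holds.\<close>

lemma sum_schur_det_unit_step:
  assumes rec: "satisfies_recurrence n c (homogeneous p)" and n: "n \<ge> 1" and lam: "is_partition n lam"
  shows "(\<Sum>a=1..n. schur_det n p (lam + \<e> a)) = c 1 * schur_det n p lam"
    and "leibniz_det_deriv {1..n} (\<lambda>i j. homogeneous p (lam i - int i + int j))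
           (\<lambda>i j. of_nat j * homogeneous p (lam i - int i + int j + 1)) = of_nat n * c 1 * schur_det n p lam"
proof -
  let ?f = "\<lambda>i j. homogeneous p (lam i - int i + int j)"
  let ?S = "{1..n}"
  let ?C = "\<lambda>m j. (if j < n then (if m = j + 1 then 1 else 0) else c (n + 1 - m))"
  have tr: "(\<Sum>j\<in>?S. ?C j j * of_nat (d j)) = c 1 * of_nat (d n)" for d
  proof -
    have "(\<Sum>j\<in>?S. ?C j j * of_nat (d j)) = (\<Sum>j\<in>?S. if j = n then c 1 * of_nat (d n) else 0)"
      by (intro sum.cong) auto
    with n show ?thesis by simp
  qed
  have shift: "leibniz_det_deriv ?S ?f (\<lambda>i j. of_nat (d j) * homogeneous p (lam i - int i + int j + 1)) =
      c 1 * of_nat (d n) * leibniz_det ?S ?f" for d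
  proof -
    have "leibniz_det_deriv ?S ?f (\<lambda>i j. of_nat (d j) * homogeneous p (lam i - int i + int j + 1)) =
      (\<Sum>j\<in>?S. ?C j j * of_nat (d j)) * leibniz_det ?S ?f"
    proof (rule leibniz_det_deriv_mult[where B = "\<lambda>m j. ?C m j * of_nat (d j)"])
      fix i j assume i: "i \<in> ?S" and j: "j \<in> ?S"
      show "of_nat (d j) * homogeneous p (lam i - int i + int j + 1) = (\<Sum>m\<in>?S. ?f i m * (?C m j * of_nat (d j)))"
        unfolding homogeneous_shift[OF rec n partition_entry_nonneg[OF lam i] i j] sum_distrib_left
        by (intro sum.cong refl) (simp add: mult_ac)
    qed simp
    then show ?thesis unfolding tr .
  qed
  have "(\<Sum>a=1..n. schur_det n p (lam + \<e> a)) = (\<Sum>a=1..n. 1 * schur_det n p (\<lambda>i. lam i + 1 * \<e> a i))"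
    by (intro sum.cong refl) (simp add: plus_fun_def)
  also have "\<dots> = leibniz_det_deriv ?S ?f (\<lambda>i j. 1 * homogeneous p (lam i + 1 - int i + int j))"
    by (rule leibniz_det_deriv_shift[symmetric])
  also have "\<dots> = c 1 * schur_det n p lam"
    using shift[of "\<lambda>_. 1"] by (simp add: schur_det_def algebra_simps)
  finally show "(\<Sum>a=1..n. schur_det n p (lam + \<e> a)) = c 1 * schur_det n p lam" .
  show "leibniz_det_deriv ?S ?f (\<lambda>i j. of_nat j * homogeneous p (lam i - int i + int j + 1)) =
      of_nat n * c 1 * schur_det n p lam"
    using shift[of "\<lambda>j. j"] by (simp add: schur_det_def mult_ac)
qed

lemma sum_schur_det_double_step:
  assumes rec: "satisfies_recurrence n c (homogeneous p)" and n: "n \<ge> 1" and lam: "is_partition n lam"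
  shows "(\<Sum>a=1..n. schur_det n p (lam + \<e> a + \<e> a)) = (c 1 ^ 2 + 2 * c 2) * schur_det n p lam"
proof -
  let ?f = "\<lambda>i j. homogeneous p (lam i - int i + int j)"
  let ?S = "{1..n}"
  let ?C = "\<lambda>m j. (if j < n then (if m = j + 1 then 1 else 0) else c (n + 1 - m))"
  let ?C2 = "\<lambda>m j. (\<Sum>l\<in>?S. ?C m l * ?C l j)"
  have c0: "c k = 0" if "k > n" for k using rec that by (simp add: satisfies_recurrence_def)
  \<comment> \<open>Columns below n only shift, so a return from j to j in two steps must use column
    n. For n = 1 the index n - 1 is missing, and c 2 = 0 makes up for it.\<close>
  have "(\<Sum>l\<in>?S. ?C j l * ?C l j) = (if j = n then c 1 ^ 2 + c 2 else if j + 1 = n then c 2 else 0)"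
    if j: "j \<in> ?S" for j
  proof (cases "j = n")
    case True
    have "(\<Sum>l\<in>?S. ?C j l * ?C l j) = (\<Sum>l\<in>?S. (if l = n then c 1 ^ 2 else 0) + (if l = n - 1 then c 2 else 0))"
      using True n by (intro sum.cong) (auto simp: power2_eq_square numeral_2_eq_2)
    also have "\<dots> = c 1 ^ 2 + c 2"
      using n c0[of 2] by (cases "n = 1") (auto simp: sum.distrib)
    finally show ?thesis using True by simp
  next
    case False
    have "(\<Sum>l\<in>?S. ?C j l * ?C l j) = (\<Sum>l\<in>?S. if l = n then (if j + 1 = n then c 2 else 0) else 0)"
      using False j by (intro sum.cong) (auto simp: numeral_2_eq_2)
    with False n show ?thesis by simp
  qed
  then have "(\<Sum>j\<in>?S. ?C2 j j) = (\<Sum>j\<in>?S. (if j = n then c 1 ^ 2 + c 2 else 0) + (if j = n - 1 then c 2 else 0))"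
    using n by (intro sum.cong refl) auto
  also have "\<dots> = c 1 ^ 2 + 2 * c 2"
    using n c0[of 2] by (cases "n = 1") (auto simp: sum.distrib)
  finally have tr: "(\<Sum>j\<in>?S. ?C2 j j) = c 1 ^ 2 + 2 * c 2" .
  have "(\<Sum>a=1..n. schur_det n p (lam + \<e> a + \<e> a)) = (\<Sum>a=1..n. 1 * schur_det n p (\<lambda>i. lam i + 2 * \<e> a i))"
    by (intro sum.cong refl) (simp add: plus_fun_def add.assoc)
  also have "\<dots> = leibniz_det_deriv ?S ?f (\<lambda>i j. 1 * homogeneous p (lam i + 2 - int i + int j))"
    by (rule leibniz_det_deriv_shift[symmetric])
  also have "\<dots> = (\<Sum>j\<in>?S. ?C2 j j) * leibniz_det ?S ?f"
  proof (rule leibniz_det_deriv_mult[where B = "?C2"])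
    fix i j assume i: "i \<in> ?S" and j: "j \<in> ?S"
    have l: "lam i \<ge> 0" by (rule partition_entry_nonneg[OF lam i])
    have "homogeneous p (lam i + 2 - int i + int j) = homogeneous p ((lam i + 1) - int i + int j + 1)"
      by (simp add: algebra_simps)
    also have "\<dots> = (\<Sum>l\<in>?S. homogeneous p (lam i + 1 - int i + int l) * ?C l j)"
      using l by (intro homogeneous_shift[OF rec n _ i j]) simp
    also have "\<dots> = (\<Sum>l\<in>?S. (\<Sum>m\<in>?S. ?f i m * ?C m l) * ?C l j)"
    proof (intro sum.cong refl arg_cong2[of _ _ _ _ "(*)"])
      fix l assume l': "l \<in> ?S"
      show "homogeneous p (lam i + 1 - int i + int l) = (\<Sum>m\<in>?S. ?f i m * ?C m l)"
        using homogeneous_shift[OF rec n l i l'] by (simp add: algebra_simps)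
    qed
    also have "\<dots> = (\<Sum>m\<in>?S. ?f i m * ?C2 m j)"
      unfolding sum_distrib_left sum_distrib_right by (subst sum.swap) (simp only: mult_ac)
    finally show "1 * homogeneous p (lam i + 2 - int i + int j) = (\<Sum>m\<in>?S. ?f i m * ?C2 m j)" by simp
  qed simp
  finally show ?thesis unfolding tr schur_det_def .
qed

text \<open>The column weight j contributes n c 1 times the Schur determinant, and the term - c 1,
  taken once for each of the n rows, cancels exactly this; the row part lam i - i + 1
  remains.\<close>

lemma leibniz_det_deriv_raised:
  assumes rec: "satisfies_recurrence n c (homogeneous p)" and n: "n \<ge> 1" and lam: "is_partition n lam"
  shows "leibniz_det_deriv {1..n} (\<lambda>i j. homogeneous p (lam i - int i + int j))
     (\<lambda>i j. of_int (lam i - int i + int j + 1) * homogeneous p (lam i - int i + int j + 1)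
        - c 1 * homogeneous p (lam i - int i + int j)) =
   (\<Sum>a=1..n. of_int (lam a - int a + 1) * schur_det n p (lam + \<e> a))"
proof -
  let ?f = "\<lambda>i j. homogeneous p (lam i - int i + int j)"
  let ?S = "{1..n}"
  have "leibniz_det_deriv ?S ?f (\<lambda>i j. of_int (lam i - int i + int j + 1) * homogeneous p (lam i - int i + int j + 1)
        - c 1 * homogeneous p (lam i - int i + int j))
     = leibniz_det_deriv ?S ?f (\<lambda>i j. of_int (lam i - int i + 1) * homogeneous p (lam i + 1 - int i + int j)
        + (of_nat j * homogeneous p (lam i - int i + int j + 1) + (- c 1) * homogeneous p (lam i + 0 - int i + int j)))"
    by (intro leibniz_det_deriv_cong) (auto simp: algebra_simps)
  also have "\<dots> = (\<Sum>a=1..n. of_int (lam a - int a + 1) * schur_det n p (\<lambda>i. lam i + 1 * \<e> a i))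
      + (of_nat n * c 1 * schur_det n p lam + (\<Sum>a=1..n. (- c 1) * schur_det n p (\<lambda>i. lam i + 0 * \<e> a i)))"
    unfolding leibniz_det_deriv_add leibniz_det_deriv_shift sum_schur_det_unit_step(2)[OF rec n lam] ..
  finally show ?thesis by (simp add: plus_fun_def)
qed

text \<open>Compare the recurrence at m = 1 and m = 2 with h_1 = p_1 and 2 h_2 = p_1^2 +
  p_2.\<close>

lemma recurrence_power_sums:
  assumes rec: "satisfies_recurrence n c (homogeneous p)" and n: "n \<ge> 1"
  shows "c 1 = p 1" "c 1 ^ 2 + 2 * c 2 = p 2"
proof -
  have h: "homogeneous p m = (\<Sum>k=1..n. c k * homogeneous p (m - int k))" if "m \<ge> 1" for m
    using rec that by (simp add: satisfies_recurrence_def)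
  have c0: "c k = 0" if "k > n" for k using rec that by (simp add: satisfies_recurrence_def)
  have h0: "homogeneous p 0 = 1" and h1: "homogeneous p 1 = p 1"
    and h2: "2 * homogeneous p 2 = p 1 ^ 2 + p 2"
    by (simp_all add: homogeneous_def numeral_2_eq_2 power2_eq_square)
  have neg: "homogeneous p r = 0" if "r < 0" for r using that by (simp add: homogeneous_def)
  have "homogeneous p 1 = (\<Sum>k=1..n. if k = 1 then c 1 else 0)"
    unfolding h[of 1, simplified] by (intro sum.cong refl) (auto simp: h0 neg)
  then show c1: "c 1 = p 1" using n h1 by simp
  have "homogeneous p 2 = (\<Sum>k=1..n. (if k = 1 then c 1 * p 1 else 0) + (if k = 2 then c 2 else 0))"
    unfolding h[of 2, simplified] by (intro sum.cong refl) (auto simp: h0 h1 neg)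
  also have "\<dots> = c 1 * p 1 + c 2"
    using n c0[of 2] by (cases "n = 1") (auto simp: sum.distrib)
  finally show "c 1 ^ 2 + 2 * c 2 = p 2"
    using h2 c1 by (simp add: power2_eq_square algebra_simps)
qed

section \<open>Power sums of the eigenvalues\<close>

primrec mat_power :: "'a::semiring_1^'n^'n \<Rightarrow> nat \<Rightarrow> 'a^'n^'n" where
  "mat_power A 0 = mat 1"
| "mat_power A (Suc k) = A ** mat_power A k"

definition power_traces :: "complex^'n^'n \<Rightarrow> nat \<Rightarrow> complex" where
  "power_traces M k = trace (mat_power M k)"

lemma finite_exponent_lists: "finite {as :: nat list. length as = l \<and> int (sum_list as) = r}"
proof (rule finite_subset)
  show "{as :: nat list. length as = l \<and> int (sum_list as) = r} \<subseteq> {as. set as \<subseteq> {0..nat r} \<and> length as = l}"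
    using member_le_sum_list by fastforce
qed (simp add: finite_lists_length_eq)

text \<open>Split by the exponent of x: either it is 0, or lowering it by 1 leaves a monomial of
  degree r - 1. The map \<open>?inc\<close> undoes the lowering.\<close>

lemma complete_homogeneous_Cons:
  "complete_homogeneous (x # xs) r = complete_homogeneous xs r + x * complete_homogeneous (x # xs) (r - 1)"
proof -
  let ?S = "\<lambda>l r. {as :: nat list. length as = l \<and> int (sum_list as) = r}"
  let ?t = "\<lambda>xs as. \<Prod>i<length xs. (xs ! i) ^ (as ! i) :: complex"
  let ?inc = "\<lambda>as. Suc (hd as) # tl as"
  let ?l = "length xs"
  have t: "?t (x # xs) (a # bs) = x ^ a * ?t xs bs" for a bs
    by (simp only: list.size(4) add_Suc_right add_0_right prod.lessThan_Suc_shift nth_Cons_0 nth_Cons_Suc)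
  have S: "?S (Suc ?l) r = (#) 0 ` ?S ?l r \<union> ?inc ` ?S (Suc ?l) (r - 1)"
  proof (intro equalityI subsetI)
    fix as assume as: "as \<in> ?S (Suc ?l) r"
    then obtain a bs where ab: "as = a # bs" by (cases as) auto
    show "as \<in> (#) 0 ` ?S ?l r \<union> ?inc ` ?S (Suc ?l) (r - 1)"
    proof (cases a)
      case 0
      with as ab show ?thesis by auto
    next
      case (Suc a')
      with as ab have "as = ?inc (a' # bs)" "a' # bs \<in> ?S (Suc ?l) (r - 1)" by auto
      then show ?thesis by blast
    qed
  next
    fix as assume "as \<in> (#) 0 ` ?S ?l r \<union> ?inc ` ?S (Suc ?l) (r - 1)"
    then show "as \<in> ?S (Suc ?l) r"
    proof
      assume "as \<in> ?inc ` ?S (Suc ?l) (r - 1)"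
      then obtain bs where bs: "as = ?inc bs" "bs \<in> ?S (Suc ?l) (r - 1)" by blast
      then show ?thesis by (cases bs) auto
    qed auto
  qed
  have "complete_homogeneous (x # xs) r = sum (?t (x # xs)) (?S (Suc ?l) r)"
    by (simp add: complete_homogeneous_def)
  also have "\<dots> = sum (?t (x # xs)) ((#) 0 ` ?S ?l r) + sum (?t (x # xs)) (?inc ` ?S (Suc ?l) (r - 1))"
    unfolding S by (intro sum.union_disjoint finite_imageI finite_exponent_lists) auto
  also have "sum (?t (x # xs)) ((#) 0 ` ?S ?l r) = complete_homogeneous xs r"
  proof -
    have "sum (?t (x # xs)) ((#) 0 ` ?S ?l r) = sum (?t (x # xs) \<circ> (#) 0) (?S ?l r)"
      by (rule sum.reindex) simp
    also have "\<dots> = complete_homogeneous xs r"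
      unfolding complete_homogeneous_def o_def t by simp
    finally show ?thesis .
  qed
  also have "sum (?t (x # xs)) (?inc ` ?S (Suc ?l) (r - 1)) = x * complete_homogeneous (x # xs) (r - 1)"
  proof -
    have inj: "inj_on ?inc (?S (Suc ?l) (r - 1))"
    proof (rule inj_onI)
      fix as bs assume "as \<in> ?S (Suc ?l) (r - 1)" "bs \<in> ?S (Suc ?l) (r - 1)" "?inc as = ?inc bs"
      then show "as = bs" by (cases as; cases bs) auto
    qed
    have inc: "?t (x # xs) (?inc as) = x * ?t (x # xs) as" if "as \<in> ?S (Suc ?l) (r - 1)" for as
    proof -
      obtain a bs where "as = a # bs" using \<open>as \<in> ?S (Suc ?l) (r - 1)\<close> by (cases as) auto
      then show ?thesis by (simp only: t list.sel power_Suc mult.assoc)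
    qed
    have "sum (?t (x # xs)) (?inc ` ?S (Suc ?l) (r - 1)) = (\<Sum>as\<in>?S (Suc ?l) (r - 1). x * ?t (x # xs) as)"
      unfolding sum.reindex[OF inj] o_def by (intro sum.cong refl inc)
    also have "\<dots> = x * complete_homogeneous (x # xs) (r - 1)"
      unfolding complete_homogeneous_def sum_distrib_left list.size add_Suc_right add_0_right ..
    finally show ?thesis .
  qed
  finally show ?thesis .
qed

lemma complete_homogeneous_neg: "r < 0 \<Longrightarrow> complete_homogeneous xs r = 0"
proof -
  assume "r < 0"
  then have "{as :: nat list. length as = length xs \<and> int (sum_list as) = r} = {}" by auto
  then show ?thesis by (simp only: complete_homogeneous_def sum.empty)
qed

text \<open>By the splitting rule, multiplication by 1 - x t removes the variable x from the
  generating function.\<close>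

lemma complete_homogeneous_fps:
  "fps_of_poly (\<Prod>x\<leftarrow>xs. [:1, - x:]) * Abs_fps (\<lambda>r. complete_homogeneous xs (int r)) = 1"
proof (induction xs)
  case Nil
  have "{as :: nat list. as = [] \<and> int (sum_list as) = int r} = (if r = 0 then {[]} else {})" for r by auto
  then have "complete_homogeneous [] (int r) = (if r = 0 then 1 else 0)" for r
    by (simp add: complete_homogeneous_def)
  then show ?case by (simp add: fps_eq_iff)
next
  case (Cons x xs)
  let ?H = "\<lambda>xs. Abs_fps (\<lambda>r. complete_homogeneous xs (int r))"
  have "fps_of_poly [:1, - x:] * ?H (x # xs) = ?H xs"
  proof (rule fps_ext)
    fix r
    have eq: "fps_of_poly [:1, - x:] = 1 - fps_const x * fps_X"
      by (simp add: fps_of_poly_pCons)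
    show "(fps_of_poly [:1, - x:] * ?H (x # xs)) $ r = ?H xs $ r"
      unfolding eq using complete_homogeneous_Cons[of x xs "int r"]
      by (cases r) (simp_all add: left_diff_distrib mult.assoc complete_homogeneous_neg)
  qed
  moreover have "fps_of_poly (\<Prod>x\<leftarrow>x # xs. [:1, - x:]) * ?H (x # xs) =
      fps_of_poly (\<Prod>x\<leftarrow>xs. [:1, - x:]) * (fps_of_poly [:1, - x:] * ?H (x # xs))"
    unfolding list.map prod_list.Cons fps_of_poly_mult by (simp only: mult_ac)
  ultimately show ?case using Cons.IH by simp
qed

section \<open>The reverse characteristic polynomial and its logarithmic derivative\<close>

lemma fps_deriv_prod:
  fixes f :: "'i \<Rightarrow> 'a::comm_ring_1 fps"
  assumes "finite S"
  shows "fps_deriv (\<Prod>i\<in>S. f i) = (\<Sum>i\<in>S. fps_deriv (f i) * (\<Prod>j\<in>S - {i}. f j))"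
  using assms
proof (induction S)
  case (insert a S)
  have "(\<Prod>j\<in>insert a S - {i}. f j) = f a * (\<Prod>j\<in>S - {i}. f j)" if "i \<in> S" for i
  proof -
    have "insert a S - {i} = insert a (S - {i})" using that insert.hyps by auto
    then show ?thesis using insert.hyps by simp
  qed
  moreover have "insert a S - {a} = S" using insert.hyps by auto
  ultimately show ?case
    using insert by (simp add: sum_distrib_left algebra_simps cong: sum.cong)
qed simp

lemma fps_deriv_leibniz_det:
  fixes f :: "'i \<Rightarrow> 'i \<Rightarrow> 'a::comm_ring_1 fps"
  assumes "finite S"
  shows "fps_deriv (leibniz_det S f) = leibniz_det_deriv S f (\<lambda>i j. fps_deriv (f i j))"
proof -
  have "fps_deriv (of_int k * g) = of_int k * fps_deriv g" for k and g :: "'a fps"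
    by (simp add: fps_of_int[symmetric])
  then show ?thesis
    by (simp add: leibniz_det_def leibniz_det_deriv_def fps_deriv_sum fps_deriv_prod[OF assms])
qed

text \<open>This is det (1 - t M) as a polynomial in t. Its constant coefficient is 1, so it is
  invertible as a power series, with the generating function of the h_r as inverse.\<close>

definition reverse_charpoly :: "complex^'n^'n \<Rightarrow> complex poly" where
  "reverse_charpoly M = leibniz_det UNIV (\<lambda>i j. [:if i = j then 1 else 0, - M $ i $ j:])"

text \<open>The logarithmic derivative of det (1 - t M) is - Tr (M (1 - t M)^-1). The geometric
  series B = - (M + M^2 t + ...) satisfies (1 - t M) B = - M, the form that the inverse-free Jacobi
  formula asks for.\<close>

lemma fps_deriv_reverse_charpoly:
  fixes M :: "complex^'n^'n"
  shows "fps_deriv (fps_of_poly (reverse_charpoly M)) =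
     - Abs_fps (\<lambda>k. power_traces M (Suc k)) * fps_of_poly (reverse_charpoly M)"
proof -
  let ?f = "\<lambda>i j. fps_of_poly [:if i = j then 1 else 0, - M $ i $ j:]"
  let ?B = "\<lambda>m j. - Abs_fps (\<lambda>k. mat_power M (Suc k) $ m $ j)"
  have of_int: "fps_of_poly (of_int k :: complex poly) = of_int k" for k
    by (simp add: of_int_poly flip: fps_of_int)
  have E: "fps_of_poly (reverse_charpoly M) = leibniz_det UNIV ?f"
    by (simp add: reverse_charpoly_def leibniz_det_def fps_of_poly_sum fps_of_poly_mult fps_of_poly_prod
        of_int del: fps_of_poly_pCons)
  have f: "?f i j = (if i = j then 1 else 0) - fps_const (M $ i $ j) * fps_X" for i j
    by (simp add: fps_of_poly_pCons)
  have "fps_deriv (fps_of_poly (reverse_charpoly M)) = leibniz_det_deriv UNIV ?f (\<lambda>i j. fps_deriv (?f i j))"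
    unfolding E by (rule fps_deriv_leibniz_det) simp
  also have "\<dots> = (\<Sum>j\<in>UNIV. ?B j j) * leibniz_det UNIV ?f"
  proof (rule leibniz_det_deriv_mult[where B = ?B])
    fix i j :: 'n
    have "fps_deriv (?f i j) = - fps_const (M $ i $ j)" by (simp add: f)
    also have "\<dots> = ?B i j - (\<Sum>m\<in>UNIV. fps_const (M $ i $ m) * fps_X * ?B m j)"
    proof (rule fps_ext)
      fix k
      show "(- fps_const (M $ i $ j)) $ k = (?B i j - (\<Sum>m\<in>UNIV. fps_const (M $ i $ m) * fps_X * ?B m j)) $ k"
        by (cases k) (simp_all add: fps_sum_nth mult.assoc sum_negf matrix_matrix_mult_def mat_def if_distrib cong: if_cong)
    qed
    also have "\<dots> = (\<Sum>m\<in>UNIV. ?f i m * ?B m j)"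
    proof -
      have "(\<Sum>m\<in>UNIV. ?f i m * ?B m j) = (\<Sum>m\<in>UNIV. (if i = m then ?B m j else 0)) - (\<Sum>m\<in>UNIV. fps_const (M $ i $ m) * fps_X * ?B m j)"
        unfolding f sum_subtractf[symmetric] by (intro sum.cong refl) (simp add: left_diff_distrib)
      then show ?thesis by simp
    qed
    finally show "fps_deriv (?f i j) = (\<Sum>m\<in>UNIV. ?f i m * ?B m j)" .
  qed simp
  also have "(\<Sum>j\<in>UNIV. ?B j j) = - Abs_fps (\<lambda>k. power_traces M (Suc k))"
    by (simp add: fps_eq_iff fps_sum_nth sum_negf power_traces_def trace_def del: mat_power.simps)
  finally show ?thesis unfolding E .
qed

lemma poly_leibniz_det: "poly (leibniz_det S f) t = leibniz_det S (\<lambda>i j. poly (f i j) t)"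
  by (simp add: leibniz_det_def poly_sum poly_prod)

lemma leibniz_det_scale: "finite S \<Longrightarrow> leibniz_det S (\<lambda>i j. c * f i j) = c ^ card S * leibniz_det S f"
  by (simp add: leibniz_det_def prod.distrib sum_distrib_left mult_ac)

lemma charpoly_eq_leibniz_det:
  "charpoly M = leibniz_det UNIV (\<lambda>i j. [:- M $ i $ j, if i = j then 1 else 0:])"
  unfolding charpoly_def det_def leibniz_det_def
  by (intro sum.cong refl arg_cong2[of _ _ _ _ "(*)"] prod.cong) (auto simp: mat_def)

lemma poly_reverse_charpoly:
  fixes M :: "complex^'n^'n"
  assumes "t \<noteq> 0"
  shows "poly (reverse_charpoly M) t = t ^ CARD('n) * poly (charpoly M) (1 / t)"
  unfolding reverse_charpoly_def charpoly_eq_leibniz_det poly_leibniz_det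
    leibniz_det_scale[OF finite, symmetric]
  using assms by (intro leibniz_det_cong) (auto simp: field_simps)

lemma degree_charpoly_le:
  fixes M :: "complex^'n^'n"
  shows "degree (charpoly M) \<le> CARD('n)"
  unfolding charpoly_eq_leibniz_det leibniz_det_def
proof (intro degree_sum_le)
  fix p :: "'n \<Rightarrow> 'n"
  let ?g = "\<lambda>i. [:- M $ i $ p i, if i = p i then 1 else 0:]"
  have "degree (of_int (sign p) * (\<Prod>i\<in>UNIV. ?g i)) \<le> degree (of_int (sign p) :: complex poly) + degree (\<Prod>i\<in>UNIV. ?g i)"
    by (rule degree_mult_le)
  also have "degree (\<Prod>i\<in>UNIV. ?g i) \<le> (\<Sum>i\<in>UNIV. degree (?g i))"
    using degree_prod_sum_le[of UNIV ?g] by (simp add: o_def)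
  also have "\<dots> \<le> (\<Sum>i\<in>(UNIV :: 'n set). 1)" by (intro sum_mono) auto
  finally show "degree (of_int (sign p) * (\<Prod>i\<in>UNIV. ?g i)) \<le> CARD('n)" by simp
qed simp

text \<open>Only an upper bound for the degree of the characteristic polynomial is at hand. The
  exact degree n and the leading coefficient 1 both follow from the value 1 of det (1 - t M) at t =
  0.\<close>

lemma reverse_charpoly_eq_prod:
  fixes M :: "complex^'n^'n"
  shows "reverse_charpoly M = (\<Prod>x\<leftarrow>eigenvalue_list M. [:1, - x:])" "length (eigenvalue_list M) = CARD('n)"
proof -
  let ?xs = "eigenvalue_list M" and ?P = "charpoly M" and ?n = "CARD('n)"
  have xs: "mset ?xs = proots ?P"
    unfolding eigenvalue_list_def by (rule someI_ex) (rule ex_mset)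
  have R0: "poly (reverse_charpoly M) 0 = 1"
  proof -
    have "poly (reverse_charpoly M) 0 = det (mat 1 :: complex^'n^'n)"
      unfolding reverse_charpoly_def poly_leibniz_det unfolding det_def leibniz_det_def
      by (intro sum.cong refl arg_cong2[of _ _ _ _ "(*)"] prod.cong) (auto simp: mat_def)
    then show ?thesis by simp
  qed
  have P: "?P = smult (lead_coeff ?P) (\<Prod>x\<leftarrow>?xs. [:- x, 1:])"
    using complex_poly_decompose_multiset[of ?P] xs
    by (metis mset_map prod_mset_prod_list)
  have len: "length ?xs = degree ?P" using size_proots_complex[of ?P] xs by (metis size_mset)
  with degree_charpoly_le[of M] have le: "length ?xs \<le> ?n" by simp
  \<comment> \<open>The reversed factorization, with a possible drop of the degree kept as a power
    of t.\<close>
  define Q where "Q = smult (lead_coeff ?P) (monom 1 (?n - length ?xs) * (\<Prod>x\<leftarrow>?xs. [:1, - x:]))"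
  have prod: "t ^ length ys * poly (\<Prod>x\<leftarrow>ys. [:- x, 1:]) (1 / t) = poly (\<Prod>x\<leftarrow>ys. [:1, - x:]) t"
    if "t \<noteq> 0" for t :: complex and ys
    using that by (induction ys) (simp_all add: field_simps)
  have "poly (reverse_charpoly M) t = poly Q t" if "t \<noteq> 0" for t
  proof -
    have "poly (reverse_charpoly M) t =
        t ^ (?n - length ?xs) * (t ^ length ?xs * poly ?P (1 / t))"
      using poly_reverse_charpoly[OF that, of M] le by (simp flip: power_add mult.assoc)
    also have "poly ?P (1 / t) = lead_coeff ?P * poly (\<Prod>x\<leftarrow>?xs. [:- x, 1:]) (1 / t)"
      by (subst P) simp
    also have "t ^ (?n - length ?xs) * (t ^ length ?xs * (lead_coeff ?P * poly (\<Prod>x\<leftarrow>?xs. [:- x, 1:]) (1 / t)))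
       = t ^ (?n - length ?xs) * (lead_coeff ?P * (t ^ length ?xs * poly (\<Prod>x\<leftarrow>?xs. [:- x, 1:]) (1 / t)))"
      by (simp only: mult_ac)
    also have "\<dots> = poly Q t" unfolding prod[OF that] Q_def by (simp add: poly_monom)
    finally show ?thesis .
  qed
  then have "UNIV - {0} \<subseteq> {t. poly (reverse_charpoly M - Q) t = 0}" by auto
  moreover have "infinite (UNIV - {0 :: complex})" by (simp add: infinite_UNIV_char_0)
  ultimately have RQ: "reverse_charpoly M = Q"
    using poly_roots_finite[of "reverse_charpoly M - Q"] finite_subset by fastforce
  have one: "poly (\<Prod>x\<leftarrow>ys. [:1, - x:]) 0 = 1" for ys :: "complex list" by (induction ys) auto
  \<comment> \<open>0 ^ m is nonzero only for m = 0, which gives the exact degree and then the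
    leading coefficient 1.\<close>
  have Q0: "lead_coeff ?P * 0 ^ (?n - length ?xs) = 1"
    using R0 unfolding RQ Q_def by (simp add: poly_monom one)
  then show "length ?xs = ?n" using le by (cases "?n - length ?xs") auto
  with Q0 show "reverse_charpoly M = (\<Prod>x\<leftarrow>?xs. [:1, - x:])" unfolding RQ Q_def by simp
qed

text \<open>H = 1 / det (1 - t M) satisfies H' = T H with T the generating function of the traces;
  comparing coefficients is Newton's recursion. This removes the arbitrarily ordered eigenvalue list
  from the Schur functions.\<close>

lemma complete_homogeneous_eigenvalues:
  "complete_homogeneous (eigenvalue_list M) r = homogeneous (power_traces M) r"
proof -
  let ?xs = "eigenvalue_list M"
  let ?E = "fps_of_poly (reverse_charpoly M)" and ?T = "Abs_fps (\<lambda>k. power_traces M (Suc k))"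
  define H where "H = Abs_fps (\<lambda>r. complete_homogeneous ?xs (int r))"
  have EH: "?E * H = 1" unfolding reverse_charpoly_eq_prod H_def by (rule complete_homogeneous_fps)
  then have E0: "?E \<noteq> 0" by auto
  have "fps_deriv (?E * H) = 0" by (simp add: EH)
  then have "?E * (fps_deriv H - ?T * H) = 0"
    by (simp add: fps_deriv_reverse_charpoly algebra_simps)
  then have H': "fps_deriv H = ?T * H" using E0 by simp
  have coeff: "H $ r = newton_homogeneous (power_traces M) r" for r
  proof (induction r rule: less_induct)
    case (less r)
    show ?case
    proof (cases r)
      case 0
      have "(?E * H) $ 0 = 1" using EH by simp
      moreover have "?E $ 0 = 1"
        unfolding reverse_charpoly_eq_prod
      proof -
        have "fps_of_poly (\<Prod>x\<leftarrow>ys. [:1, - x:]) $ 0 = 1" for ys :: "complex list"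
          by (induction ys) (auto simp: fps_of_poly_mult coeff_mult)
        then show "fps_of_poly (\<Prod>x\<leftarrow>?xs. [:1, - x:]) $ 0 = 1" .
      qed
      ultimately show ?thesis using 0 by simp
    next
      case (Suc s)
      have "of_nat (Suc s) * H $ Suc s = fps_deriv H $ s" by simp
      also have "\<dots> = (\<Sum>k\<le>s. power_traces M (Suc k) * H $ (s - k))"
        unfolding H' by (simp add: fps_mult_nth atLeast0AtMost)
      also have "\<dots> = (\<Sum>k\<le>s. power_traces M (Suc k) * newton_homogeneous (power_traces M) (s - k))"
        by (intro sum.cong refl arg_cong2[of _ _ _ _ "(*)"] less.IH) (auto simp: Suc)
      finally show ?thesis
        using of_nat_neq_0[of s, where 'a = complex] by (simp add: Suc field_simps del: of_nat_Suc)
    qed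
  qed
  show ?thesis
  proof (cases "r < 0")
    case False
    then show ?thesis using coeff[of "nat r"] by (simp add: H_def homogeneous_def)
  qed (simp add: homogeneous_def complete_homogeneous_neg)
qed

text \<open>The product of det (1 - t M) and the generating function of the h_r is 1, so c consists
  of the negated coefficients of det (1 - t M), which stop at n.\<close>

lemma eigenvalues_satisfy_recurrence:
  fixes M :: "complex^'n^'n"
  shows "\<exists>c. satisfies_recurrence CARD('n) c (homogeneous (power_traces M))"
proof -
  let ?xs = "eigenvalue_list M" and ?h = "homogeneous (power_traces M)"
  let ?R = "reverse_charpoly M"
  define c where "c k = - coeff ?R k" for k
  have deg: "degree (\<Prod>x\<leftarrow>ys. [:1, - x:]) \<le> length ys" for ys :: "complex list"
  proof (induction ys)
    case (Cons y ys)
    have "degree (\<Prod>x\<leftarrow>y # ys. [:1, - x:]) \<le> degree [:1, - y:] + degree (\<Prod>x\<leftarrow>ys. [:1, - x:])"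
      by (simp only: list.map prod_list.Cons degree_mult_le)
    also have "\<dots> \<le> 1 + length ys" using Cons by (intro add_mono) auto
    finally show ?case by simp
  qed simp
  have c0: "c k = 0" if "k > CARD('n)" for k
    using deg[of ?xs] that unfolding c_def reverse_charpoly_eq_prod by (simp add: coeff_eq_0)
  have "fps_of_poly ?R * Abs_fps (\<lambda>r. ?h (int r)) = 1"
    using complete_homogeneous_fps[of ?xs] unfolding reverse_charpoly_eq_prod complete_homogeneous_eigenvalues .
  then have conv: "(\<Sum>k\<le>m. coeff ?R k * ?h (int (m - k))) = (if m = 0 then 1 else 0)" for m
    by (simp add: fps_eq_iff fps_mult_nth atLeast0AtMost)
  have R0: "coeff ?R 0 = 1" using conv[of 0] by (simp add: homogeneous_def)
  have "?h m = (\<Sum>k=1..CARD('n). c k * ?h (m - int k))" if "m \<ge> 1" for m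
  proof -
    define l where "l = nat m"
    have l: "m = int l" "l \<ge> 1" using that by (auto simp: l_def)
    have "(\<Sum>k\<le>l. coeff ?R k * ?h (int (l - k))) = coeff ?R 0 * ?h m + (\<Sum>k=1..l. coeff ?R k * ?h (int (l - k)))"
      unfolding l(1) by (simp add: sum.atLeast_Suc_atMost flip: atLeast0AtMost)
    with conv[of l] l R0 have "?h m = (\<Sum>k=1..l. c k * ?h (int (l - k)))"
      by (simp add: c_def sum_negf eq_neg_iff_add_eq_0)
    also have "\<dots> = (\<Sum>k=1..l. c k * ?h (m - int k))"
      by (intro sum.cong refl) (auto simp: l of_nat_diff)
    \<comment> \<open>Beyond l the h have negative index and vanish, beyond n the coefficients do;
      the maximum covers both orders of l and n.\<close>
    also have "\<dots> = (\<Sum>k=1..max l CARD('n). c k * ?h (m - int k))"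
      by (intro sum.mono_neutral_left) (auto simp: l homogeneous_def)
    also have "\<dots> = (\<Sum>k=1..CARD('n). c k * ?h (m - int k))"
      by (intro sum.mono_neutral_right) (auto simp: c0)
    finally show ?thesis .
  qed
  with c0 show ?thesis unfolding satisfies_recurrence_def by blast
qed

lemma schur_matrix_eq_schur_det:
  fixes M :: "complex^'n^'n"
  shows "schur_matrix lam M = schur_det CARD('n) (power_traces M) lam"
  by (simp add: schur_matrix_def schur_def schur_det_def leibniz_det_def complete_homogeneous_eigenvalues)

section \<open>Integration by parts on the unitary group\<close>

unbundle no fps_syntax

section \<open>Complex matrices, their adjoints, and traces of powers along curves\<close>

definition adjoint_matrix :: "complex^'n^'n \<Rightarrow> complex^'n^'n" where
  "adjoint_matrix M = transpose (cnj_matrix M)"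

definition cscale :: "complex \<Rightarrow> complex^'n^'n \<Rightarrow> complex^'n^'n" where
  "cscale c A = (\<chi> i j. c * A $ i $ j)"

definition outer :: "complex^'n \<Rightarrow> complex^'n \<Rightarrow> complex^'n^'n" where
  "outer v w = (\<chi> i j. v $ i * cnj (w $ j))"

lemma adjoint_matrix_nth: "adjoint_matrix M $ i $ j = cnj (M $ j $ i)"
  by (simp add: adjoint_matrix_def transpose_def cnj_matrix_def)

lemma adjoint_matrix_mult: "adjoint_matrix (A ** B) = adjoint_matrix B ** adjoint_matrix A"
  by (simp add: vec_eq_iff adjoint_matrix_nth matrix_matrix_mult_def mult.commute)

lemma cscale_add_left: "cscale (a + b) A = cscale a A + cscale b A"
  by (simp add: cscale_def vec_eq_iff algebra_simps)

lemma cscale_add_right: "cscale a (A + B) = cscale a A + cscale a B"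
  by (simp add: cscale_def vec_eq_iff algebra_simps)

lemma cscale_cscale: "cscale a (cscale b A) = cscale (a * b) A"
  by (simp add: cscale_def vec_eq_iff)

lemma cscale_mult_left: "cscale a A ** B = cscale a (A ** B)"
  by (simp add: cscale_def vec_eq_iff matrix_matrix_mult_def sum_distrib_left mult_ac)

lemma cscale_mult_right: "A ** cscale a B = cscale a (A ** B)"
  by (simp add: cscale_def vec_eq_iff matrix_matrix_mult_def sum_distrib_left mult_ac)

lemma trace_cscale: "trace (cscale c A) = c * trace A"
  by (simp add: trace_def cscale_def sum_distrib_left)

lemma trace_uminus: "trace (- A) = - trace (A :: complex^'n^'n)"
  by (simp add: trace_def sum_negf)

lemma matrix_mult_uminus_left: "(- A) ** B = - (A ** (B :: complex^'n^'n))"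
  by (simp add: vec_eq_iff matrix_matrix_mult_def sum_negf)

lemma matrix_mult_add_left: "(A + B) ** C = A ** C + B ** (C :: complex^'n^'n)"
  by (simp add: vec_eq_iff matrix_matrix_mult_def algebra_simps sum.distrib)

lemma bounded_bilinear_matrix_mult:
  "bounded_bilinear ((**) :: complex^'n^'n \<Rightarrow> complex^'n^'n \<Rightarrow> complex^'n^'n)"
  unfolding bilinear_conv_bounded_bilinear[symmetric] bilinear_def
  by (auto intro!: linearI simp: matrix_add_ldistrib vec_eq_iff matrix_matrix_mult_def
      algebra_simps sum.distrib scaleR_sum_right)

lemma bounded_linear_trace: "bounded_linear (trace :: complex^'n^'n \<Rightarrow> complex)"
  unfolding linear_conv_bounded_linear[symmetric]
  by (auto intro!: linearI simp: trace_def sum.distrib scaleR_sum_right)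

lemma bounded_linear_adjoint_matrix: "bounded_linear (adjoint_matrix :: complex^'n^'n \<Rightarrow> complex^'n^'n)"
  unfolding linear_conv_bounded_linear[symmetric]
  by (auto intro!: linearI simp: vec_eq_iff adjoint_matrix_nth)

lemma bounded_linear_cscale_left: "bounded_linear (\<lambda>c. cscale c A)"
  unfolding linear_conv_bounded_linear[symmetric]
  by (auto intro!: linearI simp: cscale_def vec_eq_iff algebra_simps)

lemma bounded_linear_entry: "bounded_linear (\<lambda>M :: complex^'n^'n. M $ i $ j)"
  unfolding linear_conv_bounded_linear[symmetric] by (auto intro!: linearI)

lemmas continuous_on_matrix_mult [continuous_intros] =
  bounded_bilinear.continuous_on[OF bounded_bilinear_matrix_mult]
lemmas continuous_on_trace [continuous_intros] = bounded_linear.continuous_on[OF bounded_linear_trace]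
lemmas continuous_on_adjoint_matrix [continuous_intros] =
  bounded_linear.continuous_on[OF bounded_linear_adjoint_matrix]

lemma continuous_on_mat_power [continuous_intros]:
  fixes f :: "'a::topological_space \<Rightarrow> complex^'n^'n"
  shows "continuous_on S f \<Longrightarrow> continuous_on S (\<lambda>x. mat_power (f x) k)"
  by (induction k) (auto intro!: continuous_intros)

lemma mat_power_commute: "mat_power A k ** A = A ** mat_power A k"
  by (induction k) (simp_all add: matrix_mul_assoc[symmetric])

text \<open>The derivative of a matrix power is a sum over the positions of D, and these terms merge
  only under the trace. The commuting factor A carries the induction: each step moves one factor
  \<gamma> t into A.\<close>

lemma has_vector_derivative_mat_power:
  fixes \<gamma> :: "real \<Rightarrow> complex^'n^'n"
  assumes "(\<gamma> has_vector_derivative D) (at t)"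
  shows "\<exists>E. ((\<lambda>s. mat_power (\<gamma> s) (Suc k)) has_vector_derivative E) (at t) \<and>
    (\<forall>A. A ** \<gamma> t = \<gamma> t ** A \<longrightarrow> trace (A ** E) = of_nat (Suc k) * trace (A ** D ** mat_power (\<gamma> t) k))"
proof (induction k)
  case 0
  then show ?case using assms by auto
next
  case (Suc k)
  let ?g = "\<gamma> t"
  obtain E where E: "((\<lambda>s. mat_power (\<gamma> s) (Suc k)) has_vector_derivative E) (at t)"
    and tr: "\<And>A. A ** ?g = ?g ** A \<Longrightarrow> trace (A ** E) = of_nat (Suc k) * trace (A ** D ** mat_power ?g k)"
    using Suc.IH by blast
  let ?E = "?g ** E + D ** mat_power ?g (Suc k)"
  have "((\<lambda>s. mat_power (\<gamma> s) (Suc (Suc k))) has_vector_derivative ?E) (at t)"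
    unfolding mat_power.simps(2)[of _ "Suc k"]
    by (rule bounded_bilinear.has_vector_derivative[OF bounded_bilinear_matrix_mult assms E])
  moreover have "trace (A ** ?E) = of_nat (Suc (Suc k)) * trace (A ** D ** mat_power ?g (Suc k))"
    if A: "A ** ?g = ?g ** A" for A
  proof -
    have "trace ((A ** ?g) ** E) = of_nat (Suc k) * trace (A ** ?g ** D ** mat_power ?g k)"
      using A by (intro tr) (metis matrix_mul_assoc)
    also have "A ** ?g ** D ** mat_power ?g k = ?g ** (A ** D ** mat_power ?g k)"
      by (simp add: A matrix_mul_assoc)
    also have "trace \<dots> = trace (A ** D ** mat_power ?g k ** ?g)" by (rule trace_mul_sym)
    also have "A ** D ** mat_power ?g k ** ?g = A ** D ** mat_power ?g (Suc k)"
      by (simp add: mat_power_commute flip: matrix_mul_assoc)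
    finally have "trace (A ** (?g ** E)) = of_nat (Suc k) * trace (A ** D ** mat_power ?g (Suc k))"
      by (simp only: matrix_mul_assoc)
    then show ?thesis
      by (simp add: matrix_add_ldistrib trace_add matrix_mul_assoc algebra_simps del: mat_power.simps)
  qed
  ultimately show ?case by blast
qed

lemma has_vector_derivative_trace_mat_power:
  fixes \<gamma> :: "real \<Rightarrow> complex^'n^'n"
  assumes "(\<gamma> has_vector_derivative D) (at t)"
  shows "((\<lambda>s. trace (mat_power (\<gamma> s) (Suc k))) has_vector_derivative
    of_nat (Suc k) * trace (D ** mat_power (\<gamma> t) k)) (at t)"
proof -
  obtain E where E: "((\<lambda>s. mat_power (\<gamma> s) (Suc k)) has_vector_derivative E) (at t)"
    and tr: "\<And>A. A ** \<gamma> t = \<gamma> t ** A \<Longrightarrow> trace (A ** E) = of_nat (Suc k) * trace (A ** D ** mat_power (\<gamma> t) k)"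
    using has_vector_derivative_mat_power[OF assms, of k] by blast
  have "trace E = of_nat (Suc k) * trace (D ** mat_power (\<gamma> t) k)"
    using tr[of "mat 1"] by (simp del: of_nat_Suc)
  with bounded_linear.has_vector_derivative[OF bounded_linear_trace E] show ?thesis by simp
qed

text \<open>\<open>G X M\<close> is the derivative at \<open>M\<close> of \<open>F\<close> along \<open>s \<mapsto> exp (s X) M\<close>, extended
  complex-linearly from anti-hermitian \<open>X\<close> to all matrices \<open>X\<close>; the adjoint of \<open>M\<close>, which is the
  inverse of \<open>M\<close> on the unitary group, therefore has the derivative \<open>- M\<^sup>* X\<close>.\<close>

definition has_left_derivative ::
  "(complex^'n^'n \<Rightarrow> complex) \<Rightarrow> (complex^'n^'n \<Rightarrow> complex^'n^'n \<Rightarrow> complex) \<Rightarrow> bool" where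
  "has_left_derivative F G \<longleftrightarrow>
     continuous_on UNIV F \<and> (\<forall>X. continuous_on UNIV (G X)) \<and>
     (\<forall>M X Y. G (X + Y) M = G X M + G Y M) \<and> (\<forall>M c X. G (cscale c X) M = c * G X M) \<and>
     (\<forall>\<gamma> X t. (\<gamma> has_vector_derivative X ** \<gamma> t) (at t) \<longrightarrow>
        ((\<lambda>s. adjoint_matrix (\<gamma> s)) has_vector_derivative - (adjoint_matrix (\<gamma> t) ** X)) (at t) \<longrightarrow>
        ((\<lambda>s. F (\<gamma> s)) has_vector_derivative G X (\<gamma> t)) (at t))"

lemma has_left_derivativeD:
  assumes "has_left_derivative F G"
  shows "continuous_on UNIV F" "continuous_on UNIV (G X)"
    "G (X + Y) M = G X M + G Y M" "G (cscale c X) M = c * G X M"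
    "(\<gamma> has_vector_derivative X ** \<gamma> t) (at t) \<Longrightarrow>
        ((\<lambda>s. adjoint_matrix (\<gamma> s)) has_vector_derivative - (adjoint_matrix (\<gamma> t) ** X)) (at t) \<Longrightarrow>
        ((\<lambda>s. F (\<gamma> s)) has_vector_derivative G X (\<gamma> t)) (at t)"
  using assms unfolding has_left_derivative_def by blast+

section \<open>Product, sum and chain rules for left derivatives\<close>

lemma has_left_derivative_const: "has_left_derivative (\<lambda>M. c) (\<lambda>X M. 0)"
  by (auto simp: has_left_derivative_def)

lemma has_left_derivative_mult:
  assumes F: "has_left_derivative F G" and F': "has_left_derivative F' G'"
  shows "has_left_derivative (\<lambda>M. F M * F' M) (\<lambda>X M. F M * G' X M + G X M * F' M)"
  unfolding has_left_derivative_def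
proof (intro conjI allI impI, goal_cases)
  case (5 \<gamma> X t)
  then show ?case
    by (intro has_vector_derivative_mult has_left_derivativeD(5)[OF F] has_left_derivativeD(5)[OF F'])
qed (auto intro!: continuous_intros has_left_derivativeD(1,2)[OF F] has_left_derivativeD(1,2)[OF F']
    simp: has_left_derivativeD(3,4)[OF F] has_left_derivativeD(3,4)[OF F'] algebra_simps)

lemma has_left_derivative_add:
  assumes "has_left_derivative F G" "has_left_derivative F' G'"
  shows "has_left_derivative (\<lambda>M. F M + F' M) (\<lambda>X M. G X M + G' X M)"
  unfolding has_left_derivative_def
  using has_left_derivativeD[OF assms(1)] has_left_derivativeD[OF assms(2)]
  by (auto intro!: continuous_intros has_vector_derivative_add simp: algebra_simps)

lemma has_left_derivative_cmult:
  assumes "has_left_derivative F G"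
  shows "has_left_derivative (\<lambda>M. c * F M) (\<lambda>X M. c * G X M)"
  using has_left_derivative_mult[OF has_left_derivative_const[of c] assms] by simp

lemma has_left_derivative_sum:
  assumes "\<And>a. a \<in> A \<Longrightarrow> has_left_derivative (F a) (G a)"
  shows "has_left_derivative (\<lambda>M. \<Sum>a\<in>A. F a M) (\<lambda>X M. \<Sum>a\<in>A. G a X M)"
  using assms
  by (induction A rule: infinite_finite_induct)
    (auto intro!: has_left_derivative_add has_left_derivative_const)

lemma has_left_derivative_prod:
  assumes "finite A" "\<And>a. a \<in> A \<Longrightarrow> has_left_derivative (F a) (G a)"
  shows "has_left_derivative (\<lambda>M. \<Prod>a\<in>A. F a M) (\<lambda>X M. \<Sum>a\<in>A. G a X M * (\<Prod>b\<in>A - {a}. F b M))"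
  using assms
proof (induction A)
  case empty
  then show ?case by (simp add: has_left_derivative_const)
next
  case (insert a A)
  have *: "(\<Prod>b\<in>insert a A - {c}. F b M) = F a M * (\<Prod>b\<in>A - {c}. F b M)" if "c \<in> A" for c M
  proof -
    have "insert a A - {c} = insert a (A - {c})" using that insert.hyps by auto
    then show ?thesis using insert.hyps by simp
  qed
  have "insert a A - {a} = A" using insert.hyps by auto
  then have "(\<lambda>X M. \<Sum>c\<in>insert a A. G c X M * (\<Prod>b\<in>insert a A - {c}. F b M)) =
      (\<lambda>X M. F a M * (\<Sum>c\<in>A. G c X M * (\<Prod>b\<in>A - {c}. F b M)) + G a X M * (\<Prod>b\<in>A. F b M))"
    using insert.hyps by (simp add: fun_eq_iff * sum_distrib_left mult_ac cong: sum.cong)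
  moreover have "(\<lambda>M. \<Prod>b\<in>insert a A. F b M) = (\<lambda>M. F a M * (\<Prod>b\<in>A. F b M))"
    using insert.hyps by simp
  ultimately show ?case
    using insert by (simp only:) (intro has_left_derivative_mult, auto)
qed

lemma has_left_derivative_leibniz_det:
  assumes "finite S" "\<And>i j. has_left_derivative (F i j) (G i j)"
  shows "has_left_derivative (\<lambda>M. leibniz_det S (\<lambda>i j. F i j M))
    (\<lambda>X M. leibniz_det_deriv S (\<lambda>i j. F i j M) (\<lambda>i j. G i j X M))"
  unfolding leibniz_det_def leibniz_det_deriv_def
  by (intro has_left_derivative_sum has_left_derivative_cmult has_left_derivative_prod assms)

lemma has_left_derivative_exp:
  assumes "has_left_derivative F G"
  shows "has_left_derivative (\<lambda>M. exp (F M)) (\<lambda>X M. exp (F M) * G X M)"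
proof -
  have "((\<lambda>s. exp (f s)) has_vector_derivative exp (f t) * D) (at t)"
    if "(f has_vector_derivative D) (at t)" for f :: "real \<Rightarrow> complex" and D t
    using field_vector_diff_chain_at[OF that DERIV_exp] by (simp add: o_def mult.commute)
  note exp = this
  show ?thesis
    unfolding has_left_derivative_def
  proof (intro conjI allI impI, goal_cases)
    case (5 \<gamma> X t)
    then show ?case by (intro exp has_left_derivativeD(5)[OF assms])
  qed (auto intro!: continuous_intros has_left_derivativeD(1,2)[OF assms]
      simp: has_left_derivativeD(3,4)[OF assms] algebra_simps)
qed

lemma has_left_derivative_power_traces:
  "has_left_derivative (\<lambda>M :: complex^'n^'n. power_traces M (Suc k)) (\<lambda>X M. of_nat (Suc k) * trace (X ** mat_power M (Suc k)))"
  unfolding has_left_derivative_def power_traces_def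
proof (intro conjI allI impI)
  fix \<gamma> :: "real \<Rightarrow> complex^'n^'n" and X t
  assume "(\<gamma> has_vector_derivative X ** \<gamma> t) (at t)"
  from has_vector_derivative_trace_mat_power[OF this, of k]
  show "((\<lambda>s. trace (mat_power (\<gamma> s) (Suc k))) has_vector_derivative
      of_nat (Suc k) * trace (X ** mat_power (\<gamma> t) (Suc k))) (at t)"
    by (simp only: mat_power.simps matrix_mul_assoc)
qed (auto intro!: continuous_intros simp del: mat_power.simps of_nat_Suc
    simp: matrix_mult_add_left trace_add cscale_mult_left trace_cscale algebra_simps)

text \<open>With N the adjoint of M, N has the derivative - N X, and cyclicity of the trace brings X
  to the front.\<close>

lemma has_left_derivative_power_traces_adjoint:
  "has_left_derivative (\<lambda>M :: complex^'n^'n. power_traces (adjoint_matrix M) (Suc k))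
     (\<lambda>X M. of_nat (Suc k) * - trace (X ** mat_power (adjoint_matrix M) (Suc k)))"
  unfolding has_left_derivative_def power_traces_def
proof (intro conjI allI impI)
  fix \<gamma> :: "real \<Rightarrow> complex^'n^'n" and X t
  let ?g = "adjoint_matrix (\<gamma> t)"
  assume "((\<lambda>s. adjoint_matrix (\<gamma> s)) has_vector_derivative - (?g ** X)) (at t)"
  from has_vector_derivative_trace_mat_power[OF this, of k]
  have "((\<lambda>s. trace (mat_power (adjoint_matrix (\<gamma> s)) (Suc k))) has_vector_derivative
      of_nat (Suc k) * trace (- (?g ** X) ** mat_power ?g k)) (at t)" .
  also have "trace (- (?g ** X) ** mat_power ?g k) = - trace (?g ** (X ** mat_power ?g k))"
    by (simp add: matrix_mult_uminus_left trace_uminus matrix_mul_assoc)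
  also have "trace (?g ** (X ** mat_power ?g k)) = trace (X ** mat_power ?g k ** ?g)"
    by (rule trace_mul_sym)
  also have "X ** mat_power ?g k ** ?g = X ** mat_power ?g (Suc k)"
    by (simp add: mat_power_commute flip: matrix_mul_assoc)
  finally show "((\<lambda>s. trace (mat_power (adjoint_matrix (\<gamma> s)) (Suc k))) has_vector_derivative
      of_nat (Suc k) * - trace (X ** mat_power ?g (Suc k))) (at t)" .
qed (auto intro!: continuous_intros simp del: mat_power.simps of_nat_Suc
    simp: matrix_mult_add_left trace_add cscale_mult_left trace_cscale algebra_simps)

lemma has_left_derivative_adjoint_entry:
  "has_left_derivative (\<lambda>M :: complex^'n^'n. adjoint_matrix M $ i $ j) (\<lambda>X M. - (adjoint_matrix M ** X) $ i $ j)"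
  unfolding has_left_derivative_def
proof (intro conjI allI impI)
  fix \<gamma> :: "real \<Rightarrow> complex^'n^'n" and X t
  assume "((\<lambda>s. adjoint_matrix (\<gamma> s)) has_vector_derivative - (adjoint_matrix (\<gamma> t) ** X)) (at t)"
  from bounded_linear.has_vector_derivative[OF bounded_linear_entry this]
  show "((\<lambda>s. adjoint_matrix (\<gamma> s) $ i $ j) has_vector_derivative - (adjoint_matrix (\<gamma> t) ** X) $ i $ j) (at t)"
    by simp
qed (auto intro!: continuous_intros bounded_linear.continuous_on[OF bounded_linear_entry]
    simp: matrix_add_ldistrib cscale_mult_right, simp_all add: cscale_def)

text \<open>Both sides range over the pairs with k + j < s.\<close>

lemma triangular_sum_swap:
  fixes f :: "nat \<Rightarrow> nat \<Rightarrow> 'a::comm_monoid_add"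
  shows "(\<Sum>k\<le>s. \<Sum>j<s-k. f k j) = (\<Sum>j\<le>s. \<Sum>k<s-j. f k j)"
proof -
  have 1: "(\<Sum>j<s-k. g j) = (\<Sum>j\<le>s. if k + j < s then g j else 0)"
    and 2: "(\<Sum>j<s-k. g j) = (\<Sum>j\<le>s. if j + k < s then g j else 0)" for k and g :: "nat \<Rightarrow> 'a"
    by (intro sum.mono_neutral_cong_left; auto)+
  show ?thesis unfolding 1[of "f _"] 2[of "\<lambda>k. f k _"] by (rule sum.swap)
qed

text \<open>The chain rule with dh_r / dp_k = h_(r-k) / k; the factor k + 1 in the assumption
  cancels the denominator.\<close>

lemma has_left_derivative_newton_homogeneous:
  assumes "\<And>k. has_left_derivative (\<lambda>M. p M (Suc k)) (\<lambda>X M. of_nat (Suc k) * q X M k)"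
  shows "has_left_derivative (\<lambda>M. newton_homogeneous (p M) r)
    (\<lambda>X M. \<Sum>k<r. q X M k * newton_homogeneous (p M) (r - Suc k))"
proof (induction r rule: less_induct)
  case (less r)
  show ?case
  proof (cases r)
    case 0
    then show ?thesis by (simp add: has_left_derivative_const)
  next
    case (Suc s)
    let ?h = "\<lambda>M. newton_homogeneous (p M)"
    have "has_left_derivative
      (\<lambda>M. (1 / of_nat (Suc s)) * (\<Sum>k\<le>s. p M (Suc k) * ?h M (s - k)))
      (\<lambda>X M. (1 / of_nat (Suc s)) * (\<Sum>k\<le>s. p M (Suc k) * (\<Sum>j<s-k. q X M j * ?h M (s - k - Suc j))
         + (of_nat (Suc k) * q X M k) * ?h M (s - k)))"
      by (intro has_left_derivative_cmult has_left_derivative_sum has_left_derivative_mult assms less.IH) (simp add: Suc)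
    moreover have "(1 / of_nat (Suc s)) * (\<Sum>k\<le>s. p M (Suc k) * (\<Sum>j<s-k. q X M j * ?h M (s - k - Suc j))
         + (of_nat (Suc k) * q X M k) * ?h M (s - k)) = (\<Sum>k<r. q X M k * ?h M (r - Suc k))" for X M
    proof -
      have "(\<Sum>k\<le>s. p M (Suc k) * (\<Sum>j<s-k. q X M j * ?h M (s - k - Suc j))) =
          (\<Sum>k\<le>s. \<Sum>j<s-k. q X M j * (p M (Suc k) * ?h M (s - j - Suc k)))"
        by (simp add: sum_distrib_left mult_ac add.commute)
      also have "\<dots> = (\<Sum>j\<le>s. q X M j * (of_nat (s - j) * ?h M (s - j)))"
        by (simp only: triangular_sum_swap sum_distrib_left[symmetric] newton_identity)
      finally have "(\<Sum>k\<le>s. p M (Suc k) * (\<Sum>j<s-k. q X M j * ?h M (s - k - Suc j))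
         + (of_nat (Suc k) * q X M k) * ?h M (s - k)) =
         (\<Sum>j\<le>s. q X M j * (of_nat (s - j) * ?h M (s - j)) + (of_nat (Suc j) * q X M j) * ?h M (s - j))"
        by (simp add: sum.distrib)
      \<comment> \<open>The contributions to q_j h_(s-j) have weights s - j, from Newton's identity,
        and j + 1; their sum s + 1 cancels the denominator of the recursion.\<close>
      also have "\<dots> = (\<Sum>j\<le>s. of_nat (Suc s) * (q X M j * ?h M (s - j)))"
        by (intro sum.cong refl) (simp add: of_nat_diff algebra_simps)
      also have "\<dots> = of_nat (Suc s) * (\<Sum>k<r. q X M k * ?h M (r - Suc k))"
        by (simp add: Suc sum_distrib_left[symmetric] lessThan_Suc_atMost del: of_nat_Suc sum.lessThan_Suc)
      finally show ?thesis
        using of_nat_neq_0[of s, where 'a = complex] by (simp del: of_nat_Suc)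
    qed
    ultimately show ?thesis by (simp add: Suc)
  qed
qed

lemma has_left_derivative_homogeneous:
  assumes "\<And>k. has_left_derivative (\<lambda>M. p M (Suc k)) (\<lambda>X M. of_nat (Suc k) * q X M k)"
  shows "has_left_derivative (\<lambda>M. homogeneous (p M) r)
    (\<lambda>X M. \<Sum>k<nat r. q X M k * newton_homogeneous (p M) (nat r - Suc k))"
  using has_left_derivative_newton_homogeneous[OF assms, of "nat r"]
  by (cases "r < 0") (simp_all add: homogeneous_def has_left_derivative_const)

lemma has_left_derivative_schur_det:
  assumes "\<And>k. has_left_derivative (\<lambda>M. p M (Suc k)) (\<lambda>X M. of_nat (Suc k) * q X M k)"
  shows "has_left_derivative (\<lambda>M. schur_det n (p M) lam)
    (\<lambda>X M. leibniz_det_deriv {1..n} (\<lambda>i j. homogeneous (p M) (lam i - int i + int j))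
       (\<lambda>i j. \<Sum>k<nat (lam i - int i + int j).
          q X M k * newton_homogeneous (p M) (nat (lam i - int i + int j) - Suc k)))"
  unfolding schur_det_def
  by (intro has_left_derivative_leibniz_det has_left_derivative_homogeneous assms) simp

section \<open>Compactness of the unitary group and integration over it\<close>

lemma unitary_group_iff:
  "M \<in> unitary_group \<longleftrightarrow> M ** adjoint_matrix M = mat 1 \<and> adjoint_matrix M ** M = mat 1"
  by (simp add: unitary_group_def adjoint_matrix_def)

lemma unitary_group_mult:
  assumes "U \<in> unitary_group" "M \<in> unitary_group"
  shows "U ** M \<in> unitary_group"
proof -
  have "(U ** M) ** adjoint_matrix (U ** M) = U ** (M ** adjoint_matrix M) ** adjoint_matrix U"
    "adjoint_matrix (U ** M) ** (U ** M) = adjoint_matrix M ** (adjoint_matrix U ** U) ** M"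
    by (simp_all add: adjoint_matrix_mult matrix_mul_assoc)
  with assms show ?thesis by (simp add: unitary_group_iff)
qed

text \<open>Compactness bounds continuous functions on the group, which yields integrability and
  later the dominating constant. Rows of a unitary matrix have norm 1, so entries are at most 1 in
  modulus; the bound n * n is crude.\<close>

lemma compact_unitary_group: "compact (unitary_group :: (complex^'n^'n) set)"
proof -
  have "closed (unitary_group :: (complex^'n^'n) set)"
    unfolding unitary_group_iff[abs_def] set_eq_iff unitary_group_def adjoint_matrix_def[symmetric]
    by (intro closed_Collect_conj closed_Collect_eq continuous_intros)
  moreover have "norm M \<le> real CARD('n) * real CARD('n)" if "M \<in> unitary_group" for M :: "complex^'n^'n"
  proof -
    have entry: "norm (M $ i $ j) \<le> 1" for i j
    proof -
      have "(\<Sum>k\<in>UNIV. M $ i $ k * cnj (M $ i $ k)) = (M ** adjoint_matrix M) $ i $ i"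
        by (simp add: matrix_matrix_mult_def adjoint_matrix_nth)
      also have "\<dots> = 1" using that by (simp add: unitary_group_iff mat_def)
      finally have "complex_of_real (\<Sum>k\<in>UNIV. (norm (M $ i $ k))\<^sup>2) = complex_of_real 1"
        by (simp add: complex_norm_square del: of_real_power)
      then have "(\<Sum>k\<in>UNIV. (norm (M $ i $ k))\<^sup>2) = 1" by (simp only: of_real_eq_iff)
      moreover have "(norm (M $ i $ j))\<^sup>2 \<le> (\<Sum>k\<in>UNIV. (norm (M $ i $ k))\<^sup>2)"
        by (rule member_le_sum) auto
      ultimately show ?thesis by (simp add: abs_square_le_1)
    qed
    have "norm (M $ i) \<le> real CARD('n)" for i
    proof -
      have "norm (M $ i) \<le> (\<Sum>j\<in>UNIV. norm (M $ i $ j))"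
        unfolding norm_vec_def by (rule L2_set_le_sum) simp
      also have "\<dots> \<le> (\<Sum>j\<in>(UNIV :: 'n set). 1)" by (intro sum_mono entry)
      finally show ?thesis by simp
    qed
    then have "(\<Sum>i\<in>UNIV. norm (M $ i)) \<le> (\<Sum>i\<in>(UNIV :: 'n set). real CARD('n))" by (intro sum_mono)
    moreover have "norm M \<le> (\<Sum>i\<in>UNIV. norm (M $ i))"
      unfolding norm_vec_def[of M] by (rule L2_set_le_sum) simp
    ultimately show ?thesis by simp
  qed
  then have "bounded (unitary_group :: (complex^'n^'n) set)" by (auto simp: bounded_iff)
  ultimately show ?thesis by (simp add: compact_eq_bounded_closed)
qed

lemma continuous_bounded_on_unitary_group:
  fixes F :: "complex^'n^'n \<Rightarrow> complex"
  assumes "continuous_on UNIV F"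
  obtains B where "B \<ge> 0" "\<And>M. M \<in> unitary_group \<Longrightarrow> norm (F M) \<le> B"
proof -
  have "compact (F ` unitary_group)"
    by (intro compact_continuous_image compact_unitary_group continuous_on_subset[OF assms]) auto
  then obtain B where B: "\<forall>x\<in>F ` unitary_group. norm x \<le> B"
    using compact_imp_bounded bounded_iff by blast
  show ?thesis by (rule that[of "max B 0"]) (use B in \<open>auto simp: le_max_iff_disj\<close>)
qed

lemma space_normalized_haar: "normalized_haar H \<Longrightarrow> space H = unitary_group"
  by (metis normalized_haar_def sets_eq_imp_space_eq space_restrict_space Int_UNIV_right space_borel)

lemma measurable_normalized_haar:
  fixes H :: "(complex^'n^'n) measure" and F :: "complex^'n^'n \<Rightarrow> complex"
  assumes "normalized_haar H" "continuous_on UNIV F"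
  shows "F \<in> borel_measurable H"
proof -
  have "F \<in> borel_measurable (restrict_space borel unitary_group)"
    by (intro measurable_restrict_space1 borel_measurable_continuous_onI assms)
  moreover have "sets H = sets (restrict_space borel unitary_group)"
    using assms(1) by (simp add: normalized_haar_def)
  ultimately show ?thesis by (simp cong: measurable_cong_sets)
qed

lemma integrable_normalized_haar:
  fixes H :: "(complex^'n^'n) measure" and F :: "complex^'n^'n \<Rightarrow> complex"
  assumes H: "normalized_haar H" and F: "continuous_on UNIV F"
  shows "integrable H F"
proof -
  interpret prob_space H using H by (simp add: normalized_haar_def)
  obtain B where "\<And>M. M \<in> unitary_group \<Longrightarrow> norm (F M) \<le> B"
    using continuous_bounded_on_unitary_group[OF F] by blast
  then show ?thesis
    by (intro integrable_const_bound[of _ B] measurable_normalized_haar[OF H F])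
      (auto simp: space_normalized_haar[OF H])
qed

lemma integral_normalized_haar_translate:
  fixes H :: "(complex^'n^'n) measure" and F :: "complex^'n^'n \<Rightarrow> complex"
  assumes H: "normalized_haar H" and F: "continuous_on UNIV F" and U: "U \<in> unitary_group"
  shows "(LINT M|H. F (U ** M)) = (LINT M|H. F M)"
proof -
  have sets: "sets H = sets (restrict_space borel unitary_group)" using H by (simp add: normalized_haar_def)
  have "(\<lambda>M. U ** M) \<in> measurable (restrict_space borel unitary_group) borel"
    by (intro measurable_restrict_space1 borel_measurable_continuous_onI continuous_intros)
  then have "(\<lambda>M. U ** M) \<in> measurable (restrict_space borel unitary_group) (restrict_space borel unitary_group)"
    by (rule measurable_restrict_space2[rotated]) (auto simp: space_restrict_space unitary_group_mult U)
  then have "(\<lambda>M. U ** M) \<in> measurable H H" using sets by (simp cong: measurable_cong_sets)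
  then have "(LINT M|distr H H (\<lambda>M. U ** M). F M) = (LINT M|H. F (U ** M))"
    by (rule integral_distr) (rule measurable_normalized_haar[OF H F])
  moreover have "distr H H (\<lambda>M. U ** M) = H" using H U by (simp add: normalized_haar_def)
  ultimately show ?thesis by simp
qed

text \<open>\<open>exp (i t v v\<^sup>*)\<close> in closed form, for \<open>v\<close> of any length: since \<open>(v v\<^sup>*)\<^sup>2 = c v v\<^sup>*\<close> with
  \<open>c = |v|\<^sup>2\<close>. At \<open>v = 0\<close> the junk value of the division is harmless.\<close>

definition rank_one_rotation :: "complex^'n \<Rightarrow> real \<Rightarrow> complex^'n^'n" where
  "rank_one_rotation v t =
     mat 1 + cscale ((exp (\<i> * of_real t * of_real ((norm v)\<^sup>2)) - 1) / of_real ((norm v)\<^sup>2)) (outer v v)"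

lemma outer_mult_outer: "outer v v ** outer v v = cscale (of_real ((norm v)\<^sup>2)) (outer v v)"
proof -
  have "(\<Sum>k\<in>UNIV. cnj (v $ k) * v $ k) = of_real ((norm v)\<^sup>2)"
  proof -
    have "(norm v)\<^sup>2 = (\<Sum>k\<in>UNIV. (norm (v $ k))\<^sup>2)"
      by (simp add: norm_vec_def L2_set_def sum_nonneg)
    then show ?thesis by (simp add: complex_norm_square mult.commute del: of_real_power)
  qed
  moreover have "(outer v v ** outer v v) $ i $ j = v $ i * (\<Sum>k\<in>UNIV. cnj (v $ k) * v $ k) * cnj (v $ j)" for i j
    by (simp add: outer_def matrix_matrix_mult_def sum_distrib_left sum_distrib_right mult_ac)
  ultimately show ?thesis by (simp add: vec_eq_iff cscale_def outer_def mult_ac)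
qed

lemma adjoint_rank_one_rotation:
  "adjoint_matrix (rank_one_rotation v t) = rank_one_rotation v (- t)"
  by (auto simp: vec_eq_iff adjoint_matrix_nth rank_one_rotation_def cscale_def outer_def mat_def exp_cnj)

lemma rank_one_rotation_mult:
  "rank_one_rotation v s ** rank_one_rotation v t = rank_one_rotation v (s + t)"
proof (cases "v = 0")
  case True
  then have "outer v v = 0" by (simp add: outer_def vec_eq_iff)
  then have "rank_one_rotation v u = mat 1" for u by (simp add: rank_one_rotation_def cscale_def vec_eq_iff)
  then show ?thesis by simp
next
  case False
  define c where "c = complex_of_real ((norm v)\<^sup>2)"
  have c: "c \<noteq> 0" using False by (simp add: c_def)
  define a where "a u = (exp (\<i> * of_real u * c) - 1) / c" for u :: real
  have R: "rank_one_rotation v u = mat 1 + cscale (a u) (outer v v)" for u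
    by (simp add: rank_one_rotation_def a_def c_def)
  have "exp (\<i> * of_real (s + t) * c) = exp (\<i> * of_real s * c) * exp (\<i> * of_real t * c)"
    by (simp add: algebra_simps flip: exp_add)
  \<comment> \<open>Since 1 + c a(u) = exp (i u c), this is the product of two such factors, minus 1
    and divided by c.\<close>
  then have a: "a (s + t) = a s + (a t + a s * a t * c)"
    using c by (simp add: a_def field_simps)
  have "outer v v ** outer v v = cscale c (outer v v)" by (simp only: outer_mult_outer c_def)
  then show ?thesis
    unfolding R a cscale_add_left
    by (simp add: matrix_add_ldistrib matrix_mult_add_left cscale_mult_left cscale_mult_right
        cscale_cscale cscale_add_right mult_ac)
qed

lemma rank_one_rotation_0: "rank_one_rotation v 0 = mat 1"
  by (simp add: rank_one_rotation_def cscale_def vec_eq_iff)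

lemma rank_one_rotation_unitary: "rank_one_rotation v t \<in> unitary_group"
  by (simp add: unitary_group_iff adjoint_rank_one_rotation rank_one_rotation_mult rank_one_rotation_0)

lemma has_vector_derivative_rank_one_rotation:
  "(rank_one_rotation v has_vector_derivative cscale \<i> (outer v v) ** rank_one_rotation v t) (at t)"
proof (cases "v = 0")
  case True
  then have o: "outer v v = 0" by (simp add: outer_def vec_eq_iff)
  then have "rank_one_rotation v = (\<lambda>u. mat 1)" by (simp add: rank_one_rotation_def cscale_def vec_eq_iff fun_eq_iff)
  moreover have "cscale \<i> (outer v v) = 0" by (simp add: o cscale_def vec_eq_iff)
  ultimately show ?thesis by simp
next
  case False
  define c where "c = complex_of_real ((norm v)\<^sup>2)"
  have c: "c \<noteq> 0" using False by (simp add: c_def)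
  define a where "a z = (exp (\<i> * z * c) - 1) / c" for z
  have R: "rank_one_rotation v = (\<lambda>u. mat 1 + cscale (a (of_real u)) (outer v v))"
    by (simp add: fun_eq_iff rank_one_rotation_def a_def c_def)
  have "(a has_field_derivative \<i> * exp (\<i> * of_real t * c)) (at (of_real t))"
    unfolding a_def using c by (auto intro!: derivative_eq_intros)
  from has_vector_derivative_real_field[OF this, of UNIV]
  have "((\<lambda>u. cscale (a (of_real u)) (outer v v)) has_vector_derivative
      cscale (\<i> * exp (\<i> * of_real t * c)) (outer v v)) (at t)"
    by (rule bounded_linear.has_vector_derivative[OF bounded_linear_cscale_left])
  then have "(rank_one_rotation v has_vector_derivative cscale (\<i> * exp (\<i> * of_real t * c)) (outer v v)) (at t)"
    unfolding R using has_vector_derivative_add[OF has_vector_derivative_const[of "mat 1"]] by fastforce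
  moreover have "cscale \<i> (outer v v) ** rank_one_rotation v t = cscale (\<i> * exp (\<i> * of_real t * c)) (outer v v)"
  proof -
    have "\<i> + \<i> * (a (of_real t) * c) = \<i> * exp (\<i> * of_real t * c)"
    proof -
      have "a (of_real t) * c = exp (\<i> * of_real t * c) - 1" using c by (simp add: a_def)
      then show ?thesis by (simp add: right_diff_distrib)
    qed
    moreover have "outer v v ** outer v v = cscale c (outer v v)" by (simp only: outer_mult_outer c_def)
    ultimately show ?thesis
      unfolding R by (simp add: matrix_add_ldistrib cscale_mult_left cscale_mult_right
        cscale_cscale mult_ac flip: cscale_add_left)
  qed
  ultimately show ?thesis by simp
qed


section \<open>Vanishing integrals of left derivatives, from rank one to all directions\<close>

definition matrix_unit :: "'n \<Rightarrow> 'n \<Rightarrow> complex^'n^'n" where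
  "matrix_unit j k = (\<chi> a b. if a = j \<and> b = k then 1 else 0)"

lemma matrix_eq_sum_matrix_unit: "X = (\<Sum>j\<in>UNIV. \<Sum>k\<in>UNIV. cscale (X $ j $ k) (matrix_unit j k))"
proof -
  have "(\<Sum>j\<in>UNIV. \<Sum>k\<in>UNIV. cscale (X $ j $ k) (matrix_unit j k)) $ a $ b = X $ a $ b" for a b
  proof -
    have "(\<Sum>j\<in>UNIV. \<Sum>k\<in>UNIV. cscale (X $ j $ k) (matrix_unit j k)) $ a $ b =
        (\<Sum>j\<in>UNIV. \<Sum>k\<in>UNIV. X $ j $ k * (if a = j \<and> b = k then 1 else 0))"
      by (simp add: cscale_def matrix_unit_def)
    also have "\<dots> = (\<Sum>j\<in>UNIV. \<Sum>k\<in>UNIV. if k = b then (if j = a then X $ a $ b else 0) else 0)"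
      by (intro sum.cong refl) auto
    finally show ?thesis by simp
  qed
  then show ?thesis by (simp add: vec_eq_iff)
qed

lemma has_left_derivative_zero:
  fixes M :: "complex^'n^'n"
  shows "has_left_derivative F G \<Longrightarrow> G 0 M = 0"
proof -
  assume "has_left_derivative F G"
  moreover have "cscale 0 0 = (0 :: complex^'n^'n)" by (simp add: cscale_def vec_eq_iff)
  ultimately show ?thesis using has_left_derivativeD(4)[of F G 0 0 M] by simp
qed

lemma has_left_derivative_linear_sum:
  assumes "has_left_derivative F G"
  shows "G (\<Sum>a\<in>A. X a) M = (\<Sum>a\<in>A. G (X a) M)"
  by (induction A rule: infinite_finite_induct)
    (simp_all add: has_left_derivative_zero[OF assms] has_left_derivativeD(3)[OF assms])

lemma has_left_derivative_expand:
  assumes "has_left_derivative F G"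
  shows "G X M = (\<Sum>j\<in>UNIV. \<Sum>k\<in>UNIV. X $ j $ k * G (matrix_unit j k) M)"
  by (subst matrix_eq_sum_matrix_unit)
    (simp add: has_left_derivative_linear_sum[OF assms] has_left_derivativeD(4)[OF assms])

text \<open>By left invariance the difference quotients of F along the rotation integrate to 0. The
  limit may be taken under the integral, as the mean value inequality bounds the quotients by a
  bound of the derivative on the compact group.\<close>

lemma integral_left_derivative_rank_one:
  fixes H :: "(complex^'n^'n) measure"
  assumes H: "normalized_haar H" and F: "has_left_derivative F G"
  shows "(LINT M|H. G (cscale \<i> (outer v v)) M) = 0"
proof -
  let ?X = "cscale \<i> (outer v v)" and ?U = "rank_one_rotation v"
  interpret prob_space H using H by (simp add: normalized_haar_def)
  obtain B where B: "B \<ge> 0" "\<And>M. M \<in> unitary_group \<Longrightarrow> norm (G ?X M) \<le> B"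
    using continuous_bounded_on_unitary_group[OF has_left_derivativeD(2)[OF F]] by blast
  have deriv: "((\<lambda>s. F (?U s ** M)) has_vector_derivative G ?X (?U t ** M)) (at t)" for M t
  proof -
    have d: "((\<lambda>s. ?U s ** M) has_vector_derivative ?X ** (?U t ** M)) (at t)"
      using bounded_bilinear.has_vector_derivative[OF bounded_bilinear_matrix_mult
          has_vector_derivative_rank_one_rotation has_vector_derivative_const]
      by (simp add: matrix_mul_assoc)
    \<comment> \<open>The direction is anti-hermitian, which gives the adjoint curve the derivative
      demanded by \<open>has_left_derivative\<close>.\<close>
    have "adjoint_matrix ?X = - ?X"
      by (simp add: vec_eq_iff adjoint_matrix_nth cscale_def outer_def)
    then have "adjoint_matrix (?X ** (?U t ** M)) = - (adjoint_matrix (?U t ** M) ** ?X)"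
      by (subst adjoint_matrix_mult) (simp add: vec_eq_iff matrix_matrix_mult_def sum_negf)
    with bounded_linear.has_vector_derivative[OF bounded_linear_adjoint_matrix d]
    have "((\<lambda>s. adjoint_matrix (?U s ** M)) has_vector_derivative - (adjoint_matrix (?U t ** M) ** ?X)) (at t)"
      by simp
    with d show ?thesis by (rule has_left_derivativeD(5)[OF F])
  qed
  define h where "h m = inverse (real (Suc m))" for m
  have h: "h m > 0" for m by (simp add: h_def)
  define q where "q m M = (F (?U (h m) ** M) - F M) /\<^sub>R h m" for m M
  have cont: "continuous_on UNIV (\<lambda>M. F (U ** M))" for U :: "complex^'n^'n"
    by (rule continuous_on_compose2[OF has_left_derivativeD(1)[OF F] continuous_on_matrix_mult[OF continuous_on_const continuous_on_id]]) simp
  have int_q: "(LINT M|H. q m M) = 0" for m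
  proof -
    have "(LINT M|H. F (?U (h m) ** M) - F M) = (LINT M|H. F (?U (h m) ** M)) - (LINT M|H. F M)"
      by (intro Bochner_Integration.integral_diff integrable_normalized_haar[OF H] cont has_left_derivativeD(1)[OF F])
    also have "\<dots> = 0"
      using integral_normalized_haar_translate[OF H has_left_derivativeD(1)[OF F] rank_one_rotation_unitary] by simp
    finally show ?thesis unfolding q_def by simp
  qed
  have "(\<lambda>m. LINT M|H. q m M) \<longlonglongrightarrow> (LINT M|H. G ?X M)"
  proof (rule integral_dominated_convergence[where w = "\<lambda>_. B"])
    show "G ?X \<in> borel_measurable H"
      by (rule measurable_normalized_haar[OF H has_left_derivativeD(2)[OF F]])
    show "q m \<in> borel_measurable H" for m
      unfolding q_def
      by (intro measurable_normalized_haar[OF H] continuous_intros cont has_left_derivativeD(1)[OF F])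
    show "AE M in H. (\<lambda>m. q m M) \<longlonglongrightarrow> G ?X M"
    proof (rule AE_I2)
      fix M
      have "((\<lambda>s. norm (F (?U (0 + s) ** M) - F (?U 0 ** M) - s *\<^sub>R G ?X (?U 0 ** M)) / norm s) \<longlongrightarrow> 0) (at 0)"
        using deriv[of M 0] unfolding has_vector_derivative_def has_derivative_at by blast
      moreover have "filterlim h (at 0) sequentially"
      proof -
        have "h \<longlonglongrightarrow> 0" unfolding h_def[abs_def] by (rule LIMSEQ_inverse_real_of_nat)
        then show ?thesis using h by (simp add: filterlim_at less_imp_neq[symmetric])
      qed
      ultimately have "(\<lambda>m. norm (F (?U (0 + h m) ** M) - F (?U 0 ** M) - h m *\<^sub>R G ?X (?U 0 ** M)) / norm (h m)) \<longlonglongrightarrow> 0"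
        by (rule filterlim_compose)
      moreover have "norm (F (?U (0 + h m) ** M) - F (?U 0 ** M) - h m *\<^sub>R G ?X (?U 0 ** M)) / norm (h m) =
          norm (q m M - G ?X M)" for m
      proof -
        have "q m M - G ?X M = (F (?U (0 + h m) ** M) - F (?U 0 ** M) - h m *\<^sub>R G ?X (?U 0 ** M)) /\<^sub>R h m"
          using h[of m] by (simp add: q_def rank_one_rotation_0 scaleR_diff_right)
        then show ?thesis by (simp add: divide_inverse)
      qed
      ultimately have "(\<lambda>m. norm (q m M - G ?X M)) \<longlonglongrightarrow> 0" by simp
      then show "(\<lambda>m. q m M) \<longlonglongrightarrow> G ?X M" by (simp only: tendsto_norm_zero_iff LIM_zero_iff)
    qed
    show "AE M in H. norm (q m M) \<le> B" for m
    proof (rule AE_I2)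
      fix M assume "M \<in> space H"
      then have M: "M \<in> unitary_group" by (simp add: space_normalized_haar[OF H])
      \<comment> \<open>The rotated matrix stays in the group, so one constant B bounds the
        derivative at all times, not only at 0.\<close>
      have "norm (F (?U (h m) ** M) - F (?U 0 ** M)) \<le> B * norm (h m - 0)"
      proof (rule differentiable_bound[where S = UNIV])
        show "((\<lambda>s. F (?U s ** M)) has_derivative (\<lambda>x. x *\<^sub>R G ?X (?U t ** M))) (at t within UNIV)" for t
          using deriv[of M t] by (simp add: has_vector_derivative_def)
        show "onorm (\<lambda>x. x *\<^sub>R G ?X (?U t ** M)) \<le> B" for t
        proof (rule onorm_le)
          fix x :: real
          have "\<bar>x\<bar> * norm (G ?X (?U t ** M)) \<le> \<bar>x\<bar> * B"
            by (intro mult_left_mono B(2) unitary_group_mult rank_one_rotation_unitary M) simp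
          then show "norm (x *\<^sub>R G ?X (?U t ** M)) \<le> B * norm x" by (simp add: mult.commute)
        qed
      qed auto
      then show "norm (q m M) \<le> B"
        using h[of m] by (simp add: q_def rank_one_rotation_0 divide_simps mult.commute)
    qed
  qed simp
  then have "(\<lambda>m. 0) \<longlonglongrightarrow> (LINT M|H. G ?X M)" unfolding int_q .
  then show ?thesis by (simp add: LIMSEQ_const_iff)
qed

text \<open>\<open>G\<close> is complex-linear in X, and over the complex numbers the hermitian
  matrices \<open>outer v v\<close> span all matrices, so the rank one directions suffice.\<close>

lemma integral_left_derivative:
  fixes H :: "(complex^'n^'n) measure"
  assumes H: "normalized_haar H" and F: "has_left_derivative F G"
  shows "(LINT M|H. G X M) = 0"
proof -
  have int: "integrable H (G Y)" for Y
    by (rule integrable_normalized_haar[OF H has_left_derivativeD(2)[OF F]])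
  have add: "(LINT M|H. G (Y + Z) M) = (LINT M|H. G Y M) + (LINT M|H. G Z M)" for Y Z
    by (simp add: has_left_derivativeD(3)[OF F] int)
  have scale: "(LINT M|H. G (cscale c Y) M) = c * (LINT M|H. G Y M)" for c Y
    by (simp add: has_left_derivativeD(4)[OF F])
  have outer0: "(LINT M|H. G (cscale c (outer v v)) M) = 0" for c v
    using integral_left_derivative_rank_one[OF H F, of v] by (simp add: scale)
  have unit: "(LINT M|H. G (matrix_unit j k) M) = 0" for j k
  proof -
    let ?u = "\<lambda>i. if i = j then 1 else 0 :: complex" and ?w = "\<lambda>i. if i = k then 1 else 0 :: complex"
    define v where "v c = (\<chi> i. ?u i + c * ?w i)" for c
    have v: "outer (v c) (v c) $ a $ b = (?u a + c * ?w a) * (?u b + cnj c * ?w b)" for a b c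
      by (simp only: outer_def v_def vec_lambda_beta complex_cnj_add complex_cnj_mult if_distrib[of cnj] complex_cnj_one complex_cnj_zero)
    \<comment> \<open>Polarization: with v = e_j + c e_k for the four fourth roots of unity c, all
      contributions except that of E_jk cancel.\<close>
    have polar: "p * q' = 1/4 * ((p + 1 * q) * (p' + cnj 1 * q')) + (- 1/4 * ((p + -1 * q) * (p' + cnj (-1) * q'))
        + (\<i>/4 * ((p + \<i> * q) * (p' + cnj \<i> * q')) + - \<i>/4 * ((p + -\<i> * q) * (p' + cnj (-\<i>) * q'))))" for p q p' q' :: complex
      by (simp add: field_simps)
    have "matrix_unit j k $ a $ b = ?u a * ?w b" for a b by (simp add: matrix_unit_def)
    then have "matrix_unit j k = cscale (1/4) (outer (v 1) (v 1)) + (cscale (- 1/4) (outer (v (-1)) (v (-1)))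
        + (cscale (\<i>/4) (outer (v \<i>) (v \<i>)) + cscale (- \<i>/4) (outer (v (-\<i>)) (v (-\<i>)))))"
      unfolding vec_eq_iff by (simp only: vector_add_component cscale_def vec_lambda_beta v) (intro allI polar)
    then show ?thesis by (simp only: add outer0) simp
  qed
  have "(LINT M|H. G X M) = (\<Sum>j\<in>UNIV. \<Sum>k\<in>UNIV. X $ j $ k * (LINT M|H. G (matrix_unit j k) M))"
    by (subst has_left_derivative_expand[OF F]) (simp add: int)
  then show ?thesis by (simp add: unit)
qed

section \<open>Straightening\<close>

text \<open>Row i of the Jacobi-Trudi matrix depends only on lam i - i. Up to reversal and a
  constant these numbers are walker positions, so equal rows are colliding walkers.\<close>

lemma schur_det_equal_rows:
  assumes "i \<in> {1..n}" "j \<in> {1..n}" "i \<noteq> j" "lam i - int i = lam j - int j"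
  shows "schur_det n p lam = 0"
  unfolding schur_det_def
  by (rule leibniz_det_equal_rows[OF _ assms(1-3)]) (simp_all add: assms(4))

lemma schur_det_swap_rows:
  assumes "i \<in> {1..n}" "j \<in> {1..n}" "i \<noteq> j"
    and "lam' i - int i = lam j - int j" "lam' j - int j = lam i - int i"
    and "\<And>l. l \<noteq> i \<Longrightarrow> l \<noteq> j \<Longrightarrow> lam' l = lam l"
  shows "schur_det n p lam' = - schur_det n p lam"
proof -
  have "schur_det n p lam' =
      leibniz_det {1..n} (\<lambda>l. (\<lambda>l m. homogeneous p (lam l - int l + int m)) (Transposition.transpose i j l))"
    unfolding schur_det_def
  proof (rule leibniz_det_cong)
    fix l m
    have "lam' l - int l = lam (Transposition.transpose i j l) - int (Transposition.transpose i j l)"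
      using assms(4-6) by (auto simp: Transposition.transpose_def)
    then show "homogeneous p (lam' l - int l + int m) =
      homogeneous p (lam (Transposition.transpose i j l) - int (Transposition.transpose i j l) + int m)" by simp
  qed
  also have "\<dots> = - schur_det n p lam"
    unfolding schur_det_def by (rule leibniz_det_swap_rows[OF _ assms(1-3)]) simp
  finally show ?thesis .
qed

lemma partition_Suc_le: "is_partition n lam \<Longrightarrow> i \<in> {1..<n} \<Longrightarrow> lam (i + 1) \<le> lam i"
  by (simp add: is_partition_def)

text \<open>Two things can go wrong. Either lam (i + 1) = lam i, and two rows agree; or lam i = 0,
  which otherwise happens only for i = n, and then the coefficient lam i - i + n of the difference
  equation is 0.\<close>

lemma partition_diff_unit:
  assumes lam: "is_partition n lam" and i: "i \<in> {1..n}" and not: "\<not> is_partition n (lam - \<e> i)"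
  shows "lam i - int i + int n = 0 \<or> schur_det n p (lam - \<e> i) = 0"
proof (cases "i < n \<and> lam (i + 1) = lam i")
  case True
  then have "schur_det n p (lam - \<e> i) = 0"
    using i by (intro schur_det_equal_rows[of i n "i + 1"]) (auto simp: unit_tuple_apply)
  then show ?thesis ..
next
  case False
  have "(lam - \<e> i) (j + 1) \<le> (lam - \<e> i) j" if "j \<in> {1..<n}" for j
    using partition_Suc_le[OF lam that] False that by (auto simp: unit_tuple_apply)
  with not obtain j where j: "j \<in> {1..n}" "(lam - \<e> i) j < 0" unfolding is_partition_def by force
  have ji: "j = i" and l0: "lam i = 0"
    using j partition_entry_nonneg[OF lam j(1)] by (auto simp: unit_tuple_apply split: if_splits)
  have "i = n"
  proof (rule ccontr)
    assume "i \<noteq> n"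
    with i have "i \<in> {1..<n}" by auto
    with False l0 partition_Suc_le[OF lam this] partition_entry_nonneg[OF lam, of "i + 1"] show False by auto
  qed
  with l0 show ?thesis by simp
qed

lemma partition_add_unit:
  assumes mu: "is_partition n mu" and i: "i \<in> {1..n}" and not: "\<not> is_partition n (mu + \<e> i)"
  shows "schur_det n p (mu + \<e> i) = 0"
proof -
  have "0 \<le> (mu + \<e> i) j" if "j \<in> {1..n}" for j
    using partition_entry_nonneg[OF mu that] by (auto simp: unit_tuple_apply)
  with not obtain j where j: "j \<in> {1..<n}" "(mu + \<e> i) j < (mu + \<e> i) (j + 1)"
    unfolding is_partition_def by force
  with partition_Suc_le[OF mu j(1)] have "(mu + \<e> i) j + 1 = (mu + \<e> i) (j + 1)"
    by (auto simp: unit_tuple_apply split: if_splits)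
  with j(1) show ?thesis by (intro schur_det_equal_rows[of j n "j + 1"]) auto
qed

lemma partition_add_adjacent_units:
  assumes mu: "is_partition n mu" and i: "i \<in> {1..<n}" and eq: "mu i = mu (i + 1)"
    and not: "\<not> is_partition n (mu + \<e> i + \<e> (i + 1))"
  shows "schur_det n p (mu + \<e> i + \<e> (i + 1)) = 0"
proof -
  let ?nu = "mu + \<e> i + \<e> (i + 1)"
  have "0 \<le> ?nu j" if "j \<in> {1..n}" for j
    using partition_entry_nonneg[OF mu that] by (auto simp: unit_tuple_apply)
  with not obtain j where j: "j \<in> {1..<n}" "?nu j < ?nu (j + 1)"
    unfolding is_partition_def by force
  with partition_Suc_le[OF mu j(1)] eq have "?nu j + 1 = ?nu (j + 1)"
    by (auto simp: unit_tuple_apply split: if_splits)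
  with j(1) show ?thesis by (intro schur_det_equal_rows[of j n "j + 1"]) auto
qed

text \<open>The row parameters nu j - j at j = i, i + 1 are mu i - i and mu i - i + 1, in this order
  for one tuple and reversed for the other.\<close>

lemma schur_det_double_unit_straighten:
  assumes i: "i \<in> {1..<n}" and eq: "mu i = mu (i + 1)"
  shows "schur_det n p (mu + \<e> (i + 1) + \<e> (i + 1)) = - schur_det n p (mu + \<e> i + \<e> (i + 1))"
  using i eq by (intro schur_det_swap_rows[of i n "i + 1"]) (auto simp: unit_tuple_apply)

text \<open>If mu (i - 1) and mu i differ, the order can fail only because the raised entry exceeds
  mu (i - 1) by 1, and then two rows agree.\<close>

lemma partition_add_double_unit:
  assumes mu: "is_partition n mu" and i: "i \<in> {1..n}" and not: "\<not> is_partition n (mu + \<e> i + \<e> i)"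
    and nadj: "\<not> (i \<ge> 2 \<and> mu (i - 1) = mu i)"
  shows "schur_det n p (mu + \<e> i + \<e> i) = 0"
proof -
  let ?nu = "mu + \<e> i + \<e> i"
  have "0 \<le> ?nu j" if "j \<in> {1..n}" for j
    using partition_entry_nonneg[OF mu that] by (auto simp: unit_tuple_apply)
  with not obtain j where j: "j \<in> {1..<n}" "?nu j < ?nu (j + 1)"
    unfolding is_partition_def by force
  with partition_Suc_le[OF mu j(1)] nadj have "?nu j + 1 = ?nu (j + 1)"
    by (auto simp: unit_tuple_apply split: if_splits)
  with j(1) show ?thesis by (intro schur_det_equal_rows[of j n "j + 1"]) auto
qed

lemma not_partition_double_unit:
  assumes "i \<in> {1..<n}" "mu i = mu (i + 1)"
  shows "\<not> is_partition n (mu + \<e> (i + 1) + \<e> (i + 1))"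
proof
  assume "is_partition n (mu + \<e> (i + 1) + \<e> (i + 1))"
  from partition_Suc_le[OF this assms(1)] assms(2) show False by (simp add: unit_tuple_apply)
qed

text \<open>\<open>J\<close> stands for the integral as a function of one tuple, through its
  response to vanishing and to sign changes of the Schur determinant. If mu (i - 1) = mu i, then mu
  + 2 e_i is no partition, and its value under \<open>J\<close> is minus that of the adjacent pair:
  this is the correction term.\<close>

lemma sum_double_units:
  fixes J :: "(nat \<Rightarrow> int) \<Rightarrow> complex"
  assumes mu: "is_partition n mu"
    and zero: "\<And>nu. (\<And>p. schur_det n p nu = 0) \<Longrightarrow> J nu = 0"
    and neg: "\<And>nu nu'. (\<And>p. schur_det n p nu = - schur_det n p nu') \<Longrightarrow> J nu = - J nu'"
  defines "a \<equiv> \<lambda>nu. if is_partition n nu then J nu else 0"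
  shows "(\<Sum>i=1..n. a (mu + \<e> i + \<e> i))
      - (\<Sum>i\<in>{i. 1 \<le> i \<and> i \<le> n - 1 \<and> mu i = mu (i + 1)}. a (mu + \<e> i + \<e> (i + 1)))
    = (\<Sum>i=1..n. J (mu + \<e> i + \<e> i))"
proof -
  let ?A = "{i. 1 \<le> i \<and> i \<le> n - 1 \<and> mu i = mu (i + 1)}"
  let ?adj = "\<lambda>i. i \<ge> 2 \<and> mu (i - 1) = mu i"
  have "(\<Sum>i\<in>?A. a (mu + \<e> i + \<e> (i + 1))) = (\<Sum>i\<in>?A. J (mu + \<e> i + \<e> (i + 1)))"
  proof (intro sum.cong refl)
    fix i assume "i \<in> ?A"
    then have "i \<in> {1..<n}" "mu i = mu (i + 1)" by auto
    then have "\<not> is_partition n (mu + \<e> i + \<e> (i + 1)) \<Longrightarrow> J (mu + \<e> i + \<e> (i + 1)) = 0"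
      by (intro zero partition_add_adjacent_units[OF mu])
    then show "a (mu + \<e> i + \<e> (i + 1)) = J (mu + \<e> i + \<e> (i + 1))" 
      by (cases "is_partition n (mu + \<e> i + \<e> (i + 1))") (simp_all only: a_def if_True if_False simp_thms)
  qed
  \<comment> \<open>The index moves from the first to the second row of the pair, whose double step
    needs straightening.\<close>
  also have "\<dots> = (\<Sum>i\<in>{i \<in> {1..n}. ?adj i}. J (mu + \<e> (i - 1) + \<e> i))"
    by (rule sum.reindex_bij_witness[of _ "\<lambda>i. i - 1" "\<lambda>i. i + 1"]) auto
  also have "\<dots> = (\<Sum>i=1..n. if ?adj i then J (mu + \<e> (i - 1) + \<e> i) else 0)"
    by (rule sum.inter_filter) simp
  finally have adj: "(\<Sum>i\<in>?A. a (mu + \<e> i + \<e> (i + 1))) = (\<Sum>i=1..n. if ?adj i then J (mu + \<e> (i - 1) + \<e> i) else 0)" .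
  have "a (mu + \<e> i + \<e> i) - (if ?adj i then J (mu + \<e> (i - 1) + \<e> i) else 0) = J (mu + \<e> i + \<e> i)"
    if i: "i \<in> {1..n}" for i
  proof (cases "?adj i")
    case True
    then obtain j where j: "i = j + 1" "j \<in> {1..<n}" "mu j = mu (j + 1)"
      using i by (cases i) auto
    have "J (mu + \<e> i + \<e> i) = - J (mu + \<e> (i - 1) + \<e> i)"
      unfolding j(1) add_diff_cancel_right' by (intro neg schur_det_double_unit_straighten j)
    moreover have "a (mu + \<e> i + \<e> i) = 0"
      unfolding j(1) a_def using not_partition_double_unit[OF j(2,3)] by simp
    ultimately show ?thesis using True by (simp only: if_True diff_0 simp_thms)
  next
    case False
    have "a (mu + \<e> i + \<e> i) = J (mu + \<e> i + \<e> i)"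
      using zero[of "mu + \<e> i + \<e> i"] partition_add_double_unit[OF mu i _ False] by (auto simp: a_def)
    with False show ?thesis by (simp only: if_False diff_0_right)
  qed
  then show ?thesis unfolding adj sum_subtractf[symmetric] by (rule sum.cong[OF refl])
qed

section \<open>The difference equations for the integrals\<close>

lemma mat_power_transpose: "mat_power (transpose A) k = transpose (mat_power (A :: complex^'n^'n) k)"
  by (induction k) (simp_all add: mat_power_commute transpose_mat flip: matrix_transpose_mul)

lemma trace_transpose: "trace (transpose A) = trace A"
  by (simp add: trace_def transpose_def)

lemma power_traces_adjoint_matrix: "power_traces (adjoint_matrix M) = power_traces (cnj_matrix M)"
  by (simp add: fun_eq_iff power_traces_def adjoint_matrix_def mat_power_transpose trace_transpose)

lemma power_traces_0: "power_traces (M :: complex^'n^'n) 0 = of_nat CARD('n)"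
  by (simp add: power_traces_def trace_def mat_def)

lemma power_traces_1: "power_traces M 1 = trace M" "power_traces M (Suc 0) = trace M"
  by (simp_all add: power_traces_def)

text \<open>The integrand without the convention that non-partitions give \<open>0\<close>; the adjoint instead of the
  complex conjugate of \<open>M\<close> is harmless because the power traces are invariant under transposition.\<close>

definition schur_integrand ::
  "complex \<Rightarrow> (nat \<Rightarrow> int) \<Rightarrow> (nat \<Rightarrow> int) \<Rightarrow> complex^'n^'n \<Rightarrow> complex" where
  "schur_integrand z lam mu M =
     schur_det CARD('n) (power_traces M) lam * schur_det CARD('n) (power_traces (adjoint_matrix M)) mu
     * exp (z * (power_traces M 1 + power_traces (adjoint_matrix M) 1))"

definition schur_integral ::
  "(complex^'n^'n) measure \<Rightarrow> complex \<Rightarrow> (nat \<Rightarrow> int) \<Rightarrow> (nat \<Rightarrow> int) \<Rightarrow> complex" where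
  "schur_integral H z lam mu = (LINT M|H. schur_integrand z lam mu M)"

lemma unitary_integral_eq:
  fixes H :: "(complex^'n^'n) measure"
  shows "unitary_integral H lam mu z =
    (if is_partition CARD('n) lam \<and> is_partition CARD('n) mu then schur_integral H z lam mu else 0)"
proof -
  have "trace (M + cnj_matrix M) = power_traces M 1 + power_traces (adjoint_matrix M) 1" for M :: "complex^'n^'n"
    by (simp add: power_traces_adjoint_matrix power_traces_1 trace_add)
  then show ?thesis
    by (simp add: unitary_integral_def schur_integral_def schur_integrand_def schur_matrix_eq_schur_det
        power_traces_adjoint_matrix)
qed

lemma newton_homogeneous_cnj: "newton_homogeneous (\<lambda>k. cnj (p k)) r = cnj (newton_homogeneous p r)"
proof (induction r rule: less_induct)
  case (less r)
  then show ?case by (cases r) simp_all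
qed

lemma schur_det_cnj: "schur_det n (\<lambda>k. cnj (p k)) lam = cnj (schur_det n p lam)"
proof -
  have "homogeneous (\<lambda>k. cnj (p k)) r = cnj (homogeneous p r)" for r
    by (simp add: homogeneous_def newton_homogeneous_cnj)
  then show ?thesis by (simp add: schur_det_def leibniz_det_def)
qed

lemma mat_power_cnj: "mat_power (cnj_matrix A) k = cnj_matrix (mat_power A k)"
  by (induction k) (auto simp: vec_eq_iff cnj_matrix_def matrix_matrix_mult_def mat_def)

lemma power_traces_cnj_matrix: "power_traces (cnj_matrix M) = (\<lambda>k. cnj (power_traces M k))"
  by (simp add: fun_eq_iff power_traces_def mat_power_cnj) (simp add: trace_def cnj_matrix_def)

text \<open>Newton's recursion has rational coefficients, so conjugation passes through the Schur
  determinants to the power traces and exchanges the roles of M and its conjugate, hence of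
  \<open>lam\<close> and \<open>mu\<close>.\<close>

lemma cnj_unitary_integral:
  fixes H :: "(complex^'n^'n) measure"
  shows "cnj (unitary_integral H lam mu z) = unitary_integral H mu lam (cnj z)"
proof -
  have "cnj (schur_integrand z lam mu M) = schur_integrand (cnj z) mu lam M" for M :: "complex^'n^'n"
    by (simp add: schur_integrand_def power_traces_adjoint_matrix power_traces_cnj_matrix schur_det_cnj
        exp_cnj mult_ac add.commute)
  then have "cnj (schur_integral H z lam mu) = schur_integral H (cnj z) mu lam"
    unfolding schur_integral_def by (simp only: Bochner_Integration.integral_cnj[symmetric])
  then show ?thesis by (simp add: unitary_integral_eq)
qed

text \<open>The recurrence coefficients enter only through c 1 = Tr M and c 1 ^ 2 + 2 c 2 = Tr M^2
  and are eliminated here. The first two parts are the rules of Pieri and Murnaghan-Nakayama for p_1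
  and p_2, before straightening.\<close>

lemma sum_schur_det_power_traces:
  fixes M :: "complex^'n^'n"
  assumes "is_partition CARD('n) lam"
  shows "(\<Sum>a=1..CARD('n). schur_det CARD('n) (power_traces M) (lam + \<e> a)) =
      power_traces M 1 * schur_det CARD('n) (power_traces M) lam" (is ?one)
    and "(\<Sum>a=1..CARD('n). schur_det CARD('n) (power_traces M) (lam + \<e> a + \<e> a)) =
      power_traces M 2 * schur_det CARD('n) (power_traces M) lam" (is ?two)
    and "leibniz_det_deriv {1..CARD('n)} (\<lambda>i j. homogeneous (power_traces M) (lam i - int i + int j))
     (\<lambda>i j. of_int (lam i - int i + int j + 1) * homogeneous (power_traces M) (lam i - int i + int j + 1)
        - power_traces M 1 * homogeneous (power_traces M) (lam i - int i + int j)) =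
     (\<Sum>a=1..CARD('n). of_int (lam a - int a + 1) * schur_det CARD('n) (power_traces M) (lam + \<e> a))" (is ?three)
proof -
  have n: "CARD('n) \<ge> 1" by (simp add: Suc_leI)
  obtain c where c: "satisfies_recurrence CARD('n) c (homogeneous (power_traces M))"
    using eigenvalues_satisfy_recurrence by blast
  show ?one ?two ?three
    using sum_schur_det_unit_step(1)[OF c n assms] sum_schur_det_double_step[OF c n assms]
      leibniz_det_deriv_raised[OF c n assms]
    unfolding recurrence_power_sums(2)[OF c n] unfolding recurrence_power_sums(1)[OF c n] by blast+
qed

section \<open>Left derivatives of the integrand in the two directions\<close>

definition schur_left_deriv :: "(nat \<Rightarrow> int) \<Rightarrow> complex^'n^'n \<Rightarrow> complex^'n^'n \<Rightarrow> complex" where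
  "schur_left_deriv lam X M =
     leibniz_det_deriv {1..CARD('n)} (\<lambda>i j. homogeneous (power_traces M) (lam i - int i + int j))
       (\<lambda>i j. \<Sum>k<nat (lam i - int i + int j). trace (X ** mat_power M (Suc k)) *
          newton_homogeneous (power_traces M) (nat (lam i - int i + int j) - Suc k))"

definition schur_adjoint_left_deriv :: "(nat \<Rightarrow> int) \<Rightarrow> complex^'n^'n \<Rightarrow> complex^'n^'n \<Rightarrow> complex" where
  "schur_adjoint_left_deriv mu X M =
     leibniz_det_deriv {1..CARD('n)} (\<lambda>i j. homogeneous (power_traces (adjoint_matrix M)) (mu i - int i + int j))
       (\<lambda>i j. \<Sum>k<nat (mu i - int i + int j). - trace (X ** mat_power (adjoint_matrix M) (Suc k)) *
          newton_homogeneous (power_traces (adjoint_matrix M)) (nat (mu i - int i + int j) - Suc k))"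

definition integrand_left_deriv ::
  "complex \<Rightarrow> (nat \<Rightarrow> int) \<Rightarrow> (nat \<Rightarrow> int) \<Rightarrow> complex^'n^'n \<Rightarrow> complex^'n^'n \<Rightarrow> complex" where
  "integrand_left_deriv z lam mu X M =
     (schur_left_deriv lam X M * schur_det CARD('n) (power_traces (adjoint_matrix M)) mu
      + schur_det CARD('n) (power_traces M) lam * schur_adjoint_left_deriv mu X M
      + schur_det CARD('n) (power_traces M) lam * schur_det CARD('n) (power_traces (adjoint_matrix M)) mu
        * (z * (trace (X ** M) - trace (X ** adjoint_matrix M))))
     * exp (z * (power_traces M 1 + power_traces (adjoint_matrix M) 1))"

lemma has_left_derivative_schur_integrand:
  "has_left_derivative (schur_integrand z lam mu :: complex^'n^'n \<Rightarrow> complex) (integrand_left_deriv z lam mu)"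
proof -
  have 1: "has_left_derivative (\<lambda>M :: complex^'n^'n. schur_det CARD('n) (power_traces M) lam) (schur_left_deriv lam)"
    unfolding schur_left_deriv_def
    by (rule has_left_derivative_schur_det[OF has_left_derivative_power_traces])
  have 2: "has_left_derivative (\<lambda>M :: complex^'n^'n. schur_det CARD('n) (power_traces (adjoint_matrix M)) mu)
      (schur_adjoint_left_deriv mu)"
    unfolding schur_adjoint_left_deriv_def
    by (rule has_left_derivative_schur_det[OF has_left_derivative_power_traces_adjoint])
  have 3: "has_left_derivative (\<lambda>M :: complex^'n^'n. z * (power_traces M 1 + power_traces (adjoint_matrix M) 1))
      (\<lambda>X M. z * (trace (X ** M) + - trace (X ** adjoint_matrix M)))"
    using has_left_derivative_cmult[OF has_left_derivative_add[OF has_left_derivative_power_traces[of 0]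
        has_left_derivative_power_traces_adjoint[of 0]], of z] by simp
  have "integrand_left_deriv z lam mu = (\<lambda>X M :: complex^'n^'n.
      (schur_det CARD('n) (power_traces M) lam * schur_det CARD('n) (power_traces (adjoint_matrix M)) mu) *
        (exp (z * (power_traces M 1 + power_traces (adjoint_matrix M) 1)) * (z * (trace (X ** M) + - trace (X ** adjoint_matrix M))))
      + (schur_det CARD('n) (power_traces M) lam * schur_adjoint_left_deriv mu X M
         + schur_left_deriv lam X M * schur_det CARD('n) (power_traces (adjoint_matrix M)) mu)
        * exp (z * (power_traces M 1 + power_traces (adjoint_matrix M) 1)))"
    by (simp add: fun_eq_iff integrand_left_deriv_def algebra_simps)
  then show ?thesis
    unfolding schur_integrand_def[abs_def]
    using has_left_derivative_mult[OF has_left_derivative_mult[OF 1 2] has_left_derivative_exp[OF 3]] by (simp only:)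
qed

lemma integrable_schur_integrand:
  "normalized_haar H \<Longrightarrow> integrable H (schur_integrand z lam mu)"
  by (rule integrable_normalized_haar, assumption) (rule has_left_derivativeD(1)[OF has_left_derivative_schur_integrand])

text \<open>X = 1 acts on s_lam as the Euler operator, with eigenvalue |lam|, and with the opposite
  sign on the adjoint factor. The exponential contributes a difference of two traces, which Pieri's
  rule turns into unit steps.\<close>

lemma integrand_left_deriv_mat_1:
  fixes M :: "complex^'n^'n"
  assumes lam: "is_partition CARD('n) lam" and mu: "is_partition CARD('n) mu"
  shows "integrand_left_deriv z lam mu (mat 1) M =
    of_int ((\<Sum>i=1..CARD('n). lam i) - (\<Sum>i=1..CARD('n). mu i)) * schur_integrand z lam mu M
    + z * (\<Sum>i=1..CARD('n). schur_integrand z (lam + \<e> i) mu M - schur_integrand z lam (mu + \<e> i) M)"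
proof -
  let ?p = "power_traces M" and ?q = "power_traces (adjoint_matrix M)" and ?n = "CARD('n)"
  let ?S = "schur_det ?n ?p" and ?T = "schur_det ?n ?q"
  let ?E = "exp (z * (?p 1 + ?q 1))"
  have euler: "(\<Sum>k<nat r. p (Suc k) * newton_homogeneous p (nat r - Suc k)) = of_int r * homogeneous p r" for p r
    by (simp add: newton_identity homogeneous_def)
  have 1: "schur_left_deriv lam (mat 1) M = of_int (\<Sum>i=1..?n. lam i) * ?S lam"
    unfolding schur_left_deriv_def matrix_mul_lid power_traces_def[symmetric] euler
    by (rule leibniz_det_deriv_degree)
  have 2: "schur_adjoint_left_deriv mu (mat 1) M = - of_int (\<Sum>i=1..?n. mu i) * ?T mu"
  proof -
    have "(\<Sum>k<nat r. - ?q (Suc k) * newton_homogeneous ?q (nat r - Suc k)) = (-1) * (of_int r * homogeneous ?q r)" for r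
      unfolding euler[symmetric] by (simp add: sum_negf)
    then show ?thesis
      unfolding schur_adjoint_left_deriv_def matrix_mul_lid power_traces_def[symmetric]
      by (simp only: leibniz_det_deriv_scale leibniz_det_deriv_degree) simp
  qed
  have 3: "(\<Sum>i=1..?n. schur_integrand z (lam + \<e> i) mu M - schur_integrand z lam (mu + \<e> i) M) =
      (?p 1 * ?S lam * ?T mu - ?S lam * (?q 1 * ?T mu)) * ?E"
    unfolding sum_schur_det_power_traces(1)[OF lam, of M, symmetric]
      sum_schur_det_power_traces(1)[OF mu, of "adjoint_matrix M", symmetric]
    by (simp add: schur_integrand_def sum_subtractf sum_distrib_left sum_distrib_right algebra_simps)
  show ?thesis
    unfolding 3 integrand_left_deriv_def 1 2
    by (simp add: schur_integrand_def power_traces_1 algebra_simps)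
qed

text \<open>Let N be the adjoint of M. On the group Tr (N M^(k+1)) = Tr M^k, so X = N acts on s_lam
  as the sum of the d/dx_j. On the other factor, in the eigenvalues y_j of N, it acts as minus the
  sum of the y_j^2 d/dy_j. The exponential contributes z (n - Tr N^2).\<close>

lemma integrand_left_deriv_adjoint_matrix:
  fixes M :: "complex^'n^'n"
  assumes lam: "is_partition CARD('n) lam" and mu: "is_partition CARD('n) mu" and M: "M \<in> unitary_group"
  shows "integrand_left_deriv z lam mu (adjoint_matrix M) M
      - of_nat CARD('n) * trace (adjoint_matrix M) * schur_integrand z lam mu M =
    (\<Sum>i=1..CARD('n). of_int (lam i - int i + int CARD('n)) * schur_integrand z (lam - \<e> i) mu M
        - of_int (mu i - int i + int CARD('n) + 1) * schur_integrand z lam (mu + \<e> i) M)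
    + z * (of_nat CARD('n) * schur_integrand z lam mu M
       - (\<Sum>i=1..CARD('n). schur_integrand z lam (mu + \<e> i + \<e> i) M))"
proof -
  let ?p = "power_traces M" and ?q = "power_traces (adjoint_matrix M)" and ?n = "CARD('n)"
  let ?S = "schur_det ?n ?p" and ?T = "schur_det ?n ?q"
  let ?E = "exp (z * (?p 1 + ?q 1))"
  have inv: "adjoint_matrix M ** M = mat 1" using M by (simp add: unitary_group_iff)
  have 1: "schur_left_deriv lam (adjoint_matrix M) M = (\<Sum>a=1..?n. of_int (lam a - int a + int ?n) * ?S (lam - \<e> a))"
  proof -
    have "trace (adjoint_matrix M ** mat_power M (Suc k)) = ?p k" for k
      by (simp add: matrix_mul_assoc inv power_traces_def)
    moreover have "(\<Sum>k<nat r. ?p k * newton_homogeneous ?p (nat r - Suc k)) =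
        of_int (int ?n + r - 1) * homogeneous ?p (r - 1)" for r
      by (cases "r < 0") (simp_all add: newton_identity_lowered power_traces_0 homogeneous_def)
    ultimately show ?thesis
      unfolding schur_left_deriv_def by (simp only: leibniz_det_deriv_lowered)
  qed
  have 2: "schur_adjoint_left_deriv mu (adjoint_matrix M) M = - (\<Sum>a=1..?n. of_int (mu a - int a + 1) * ?T (mu + \<e> a))"
  proof -
    have "trace (adjoint_matrix M ** mat_power (adjoint_matrix M) (Suc k)) = ?q (Suc (Suc k))" for k
      by (simp add: power_traces_def)
    moreover have "(\<Sum>k<nat r. - ?q (Suc (Suc k)) * newton_homogeneous ?q (nat r - Suc k)) =
        (-1) * (of_int (r + 1) * homogeneous ?q (r + 1) - ?q 1 * homogeneous ?q r)" for r
    proof (cases "r < 0")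
      case True
      \<comment> \<open>At r = -1 the value h_0 = 1 does occur, but with the coefficient r + 1 =
        0.\<close>
      then show ?thesis by (cases "r = -1") (simp_all add: homogeneous_def)
    next
      case False
      have "nat (r + 1) = nat r + 1" using False by simp
      then show ?thesis
        using newton_identity_raised[of ?q "nat r"] False
        by (simp add: homogeneous_def sum_negf del: newton_homogeneous.simps)
    qed
    ultimately show ?thesis
      unfolding schur_adjoint_left_deriv_def
      by (simp only: leibniz_det_deriv_scale sum_schur_det_power_traces(3)[OF mu]) simp
  qed
  have 3: "trace (adjoint_matrix M ** M) = of_nat ?n" "trace (adjoint_matrix M ** adjoint_matrix M) = ?q 2"
    "trace (adjoint_matrix M) = ?q 1"
    by (simp add: inv trace_def mat_def) (simp_all add: power_traces_def numeral_2_eq_2)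
  have q1: "?q 1 * ?T mu = (\<Sum>a=1..?n. ?T (mu + \<e> a))" and q2: "?q 2 * ?T mu = (\<Sum>a=1..?n. ?T (mu + \<e> a + \<e> a))"
    using sum_schur_det_power_traces(1,2)[OF mu, of "adjoint_matrix M"] by simp_all
  have "integrand_left_deriv z lam mu (adjoint_matrix M) M - of_nat ?n * trace (adjoint_matrix M) * schur_integrand z lam mu M
     = ((\<Sum>a=1..?n. of_int (lam a - int a + int ?n) * ?S (lam - \<e> a)) * ?T mu
        - ?S lam * ((\<Sum>a=1..?n. of_int (mu a - int a + 1) * ?T (mu + \<e> a)) + of_nat ?n * (?q 1 * ?T mu))
        + z * ?S lam * (of_nat ?n * ?T mu - ?q 2 * ?T mu)) * ?E"
    unfolding integrand_left_deriv_def schur_integrand_def 1 2 3 by (simp add: algebra_simps)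
  also have "(\<Sum>a=1..?n. of_int (mu a - int a + 1) * ?T (mu + \<e> a)) + of_nat ?n * (?q 1 * ?T mu) =
      (\<Sum>a=1..?n. of_int (mu a - int a + int ?n + 1) * ?T (mu + \<e> a))"
    unfolding q1 by (simp add: sum_distrib_left sum.distrib[symmetric] algebra_simps)
  also have "((\<Sum>a=1..?n. of_int (lam a - int a + int ?n) * ?S (lam - \<e> a)) * ?T mu
        - ?S lam * (\<Sum>a=1..?n. of_int (mu a - int a + int ?n + 1) * ?T (mu + \<e> a))
        + z * ?S lam * (of_nat ?n * ?T mu - ?q 2 * ?T mu)) * ?E
    = (\<Sum>a=1..?n. of_int (lam a - int a + int ?n) * (?S (lam - \<e> a) * ?T mu * ?E))
      - (\<Sum>a=1..?n. of_int (mu a - int a + int ?n + 1) * (?S lam * ?T (mu + \<e> a) * ?E))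
      + z * (of_nat ?n * (?S lam * ?T mu * ?E) - (\<Sum>a=1..?n. ?S lam * ?T (mu + \<e> a + \<e> a) * ?E))"
    unfolding q2 left_diff_distrib distrib_right sum_distrib_left sum_distrib_right right_diff_distrib
    by (simp only: mult_ac)
  finally show ?thesis unfolding schur_integrand_def sum_subtractf .
qed

text \<open>With N the adjoint of M, the product rule for N_jk F in the direction E_jk subtracts
  N_jj F, which does not depend on k; hence the factor n in front of the trace.\<close>

lemma integral_adjoint_left_derivative:
  fixes H :: "(complex^'n^'n) measure"
  assumes H: "normalized_haar H" and F: "has_left_derivative F G"
  shows "(LINT M|H. G (adjoint_matrix M) M - of_nat CARD('n) * trace (adjoint_matrix M) * F M) = 0"
proof -
  define K where "K j k = (\<lambda>X M. adjoint_matrix M $ j $ k * G X M + - (adjoint_matrix M ** X) $ j $ k * F M)" for j k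
  have K: "has_left_derivative (\<lambda>M. adjoint_matrix M $ j $ k * F M) (K j k)" for j k
    unfolding K_def by (rule has_left_derivative_mult[OF has_left_derivative_adjoint_entry F])
  have int: "integrable H (K j k (matrix_unit j k))" for j k
    by (rule integrable_normalized_haar[OF H has_left_derivativeD(2)[OF K]])
  have entry: "(adjoint_matrix M ** matrix_unit j k) $ j $ k = adjoint_matrix M $ j $ j" for M and j k :: 'n
  proof -
    have "(adjoint_matrix M ** matrix_unit j k) $ j $ k = (\<Sum>l\<in>UNIV. if l = j then adjoint_matrix M $ j $ j else 0)"
      unfolding matrix_matrix_mult_def vec_lambda_beta by (intro sum.cong refl) (simp add: matrix_unit_def)
    then show ?thesis by simp
  qed
  have "(\<Sum>j\<in>UNIV. \<Sum>k\<in>UNIV. K j k (matrix_unit j k) M) =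
      G (adjoint_matrix M) M - of_nat CARD('n) * trace (adjoint_matrix M) * F M" for M
    unfolding K_def has_left_derivative_expand[OF F, of "adjoint_matrix M"]
    by (simp add: entry sum.distrib sum_subtractf trace_def sum_distrib_left sum_distrib_right mult_ac)
  then have "(LINT M|H. G (adjoint_matrix M) M - of_nat CARD('n) * trace (adjoint_matrix M) * F M) =
      (LINT M|H. (\<Sum>j\<in>UNIV. \<Sum>k\<in>UNIV. K j k (matrix_unit j k) M))"
    by simp
  also have "\<dots> = (\<Sum>j\<in>UNIV. \<Sum>k\<in>UNIV. (LINT M|H. K j k (matrix_unit j k) M))"
    by (simp add: int)
  also have "\<dots> = 0" by (simp add: integral_left_derivative[OF H K])
  finally show ?thesis .
qed

section \<open>From Schur determinants to the integrals with the zero convention\<close>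

lemma schur_integral_eq_0:
  fixes H :: "(complex^'n^'n) measure"
  shows "(\<And>p. schur_det CARD('n) p lam = 0) \<Longrightarrow> schur_integral H z lam mu = 0"
    and "(\<And>p. schur_det CARD('n) p mu = 0) \<Longrightarrow> schur_integral H z lam mu = 0"
  by (simp_all add: schur_integral_def schur_integrand_def)

lemma schur_integral_neg:
  fixes H :: "(complex^'n^'n) measure"
  shows "(\<And>p. schur_det CARD('n) p mu = - schur_det CARD('n) p mu') \<Longrightarrow>
    schur_integral H z lam mu = - schur_integral H z lam mu'"
  by (simp add: schur_integral_def schur_integrand_def)

lemma unitary_integral_add_unit:
  fixes H :: "(complex^'n^'n) measure"
  assumes lam: "is_partition CARD('n) lam" and mu: "is_partition CARD('n) mu" and i: "i \<in> {1..CARD('n)}"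
  shows "unitary_integral H (lam + \<e> i) mu z = schur_integral H z (lam + \<e> i) mu"
    and "unitary_integral H lam (mu + \<e> i) z = schur_integral H z lam (mu + \<e> i)"
proof -
  show "unitary_integral H (lam + \<e> i) mu z = schur_integral H z (lam + \<e> i) mu"
    unfolding unitary_integral_eq
    using mu schur_integral_eq_0(1)[where H = H and lam = "lam + \<e> i"] partition_add_unit[OF lam i] by auto
  show "unitary_integral H lam (mu + \<e> i) z = schur_integral H z lam (mu + \<e> i)"
    unfolding unitary_integral_eq
    using lam schur_integral_eq_0(2)[where H = H and mu = "mu + \<e> i"] partition_add_unit[OF mu i] by auto
qed

text \<open>The coefficient stays on both sides because for i = n and lam n = 0 it is the
  coefficient that is seen to vanish.\<close>

lemma unitary_integral_diff_unit:
  fixes H :: "(complex^'n^'n) measure"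
  assumes lam: "is_partition CARD('n) lam" and mu: "is_partition CARD('n) mu" and i: "i \<in> {1..CARD('n)}"
  shows "of_int (lam i - int i + int CARD('n)) * unitary_integral H (lam - \<e> i) mu z =
    of_int (lam i - int i + int CARD('n)) * schur_integral H z (lam - \<e> i) mu"
proof (cases "is_partition CARD('n) (lam - \<e> i)")
  case False
  show ?thesis
  proof (cases "lam i - int i + int CARD('n) = 0")
    case nz: False
    then have "schur_det CARD('n) p (lam - \<e> i) = 0" for p
      using partition_diff_unit[OF lam i False, of p] by blast
    then have "schur_integral H z (lam - \<e> i) mu = 0" by (rule schur_integral_eq_0(1))
    with False show ?thesis by (simp add: unitary_integral_eq)
  qed simp
qed (simp add: unitary_integral_eq mu)

lemma unitary_integral_difference_1:
  fixes H :: "(complex^'n^'n) measure"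
  assumes H: "normalized_haar H" and lam: "is_partition CARD('n) lam" and mu: "is_partition CARD('n) mu"
  shows "(\<Sum>i=1..CARD('n). of_int (lam i - int i + int CARD('n)) * unitary_integral H (lam - \<e> i) mu z
            - of_int (mu i - int i + int CARD('n) + 1) * unitary_integral H lam (mu + \<e> i) z)
    + z * (of_nat CARD('n) * unitary_integral H lam mu z
           - (\<Sum>i=1..CARD('n). unitary_integral H lam (mu + \<e> i + \<e> i) z)
           + (\<Sum>i\<in>{i. 1 \<le> i \<and> i \<le> CARD('n) - 1 \<and> mu i = mu (i + 1)}.
                unitary_integral H lam (mu + \<e> i + \<e> (i + 1)) z)) = 0"
proof -
  let ?n = "CARD('n)"
  let ?J = "schur_integral H z" and ?\<Phi> = "schur_integrand z"
  let ?c = "\<lambda>i. of_int (lam i - int i + int ?n) :: complex" and ?d = "\<lambda>i. of_int (mu i - int i + int ?n + 1) :: complex"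
  note [simp] = integrable_schur_integrand[OF H]
  have "0 = (LINT M|H. integrand_left_deriv z lam mu (adjoint_matrix M) M
      - of_nat ?n * trace (adjoint_matrix M) * ?\<Phi> lam mu M)"
    by (rule integral_adjoint_left_derivative[OF H has_left_derivative_schur_integrand, symmetric])
  also have "\<dots> = (LINT M|H. (\<Sum>i=1..?n. ?c i * ?\<Phi> (lam - \<e> i) mu M - ?d i * ?\<Phi> lam (mu + \<e> i) M)
    + z * (of_nat ?n * ?\<Phi> lam mu M - (\<Sum>i=1..?n. ?\<Phi> lam (mu + \<e> i + \<e> i) M)))"
    by (intro Bochner_Integration.integral_cong refl integrand_left_deriv_adjoint_matrix[OF lam mu])
      (simp add: space_normalized_haar[OF H])
  also have "\<dots> = (\<Sum>i=1..?n. ?c i * ?J (lam - \<e> i) mu - ?d i * ?J lam (mu + \<e> i))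
    + z * (of_nat ?n * ?J lam mu - (\<Sum>i=1..?n. ?J lam (mu + \<e> i + \<e> i)))"
    unfolding schur_integral_def by simp
  also have "(\<Sum>i=1..?n. ?c i * ?J (lam - \<e> i) mu - ?d i * ?J lam (mu + \<e> i)) =
      (\<Sum>i=1..?n. ?c i * unitary_integral H (lam - \<e> i) mu z - ?d i * unitary_integral H lam (mu + \<e> i) z)"
    by (intro sum.cong refl) (simp only: unitary_integral_diff_unit[OF lam mu] unitary_integral_add_unit[OF lam mu])
  \<comment> \<open>Straightening of the double steps, applied to the integral as a function of the
    second tuple.\<close>
  also have "(\<Sum>i=1..?n. ?J lam (mu + \<e> i + \<e> i)) =
      (\<Sum>i=1..?n. unitary_integral H lam (mu + \<e> i + \<e> i) z)
      - (\<Sum>i\<in>{i. 1 \<le> i \<and> i \<le> ?n - 1 \<and> mu i = mu (i + 1)}. unitary_integral H lam (mu + \<e> i + \<e> (i + 1)) z)"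
    using sum_double_units[OF mu, of "?J lam"] schur_integral_eq_0(2)[where H = H] schur_integral_neg[where H = H]
    by (simp only: unitary_integral_eq lam simp_thms)
  also have "?J lam mu = unitary_integral H lam mu z" by (simp add: unitary_integral_eq lam mu)
  finally show ?thesis unfolding diff_diff_eq2 diff_add_eq by (rule sym)
qed

lemma unitary_integral_difference_2:
  fixes H :: "(complex^'n^'n) measure"
  assumes H: "normalized_haar H" and lam: "is_partition CARD('n) lam" and mu: "is_partition CARD('n) mu"
  shows "of_int ((\<Sum>i=1..CARD('n). lam i) - (\<Sum>i=1..CARD('n). mu i)) * unitary_integral H lam mu z
    + z * (\<Sum>i=1..CARD('n). unitary_integral H (lam + \<e> i) mu z - unitary_integral H lam (mu + \<e> i) z) = 0"
proof -
  let ?n = "CARD('n)"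
  let ?J = "schur_integral H z" and ?\<Phi> = "schur_integrand z"
  note [simp] = integrable_schur_integrand[OF H]
  let ?c = "of_int ((\<Sum>i=1..?n. lam i) - (\<Sum>i=1..?n. mu i)) :: complex"
  have "0 = (LINT M|H. integrand_left_deriv z lam mu (mat 1) M)"
    by (rule integral_left_derivative[OF H has_left_derivative_schur_integrand, symmetric])
  also have "\<dots> = (LINT M|H. ?c * ?\<Phi> lam mu M + z * (\<Sum>i=1..?n. ?\<Phi> (lam + \<e> i) mu M - ?\<Phi> lam (mu + \<e> i) M))"
    unfolding integrand_left_deriv_mat_1[OF lam mu] ..
  also have "\<dots> = ?c * ?J lam mu + z * (\<Sum>i=1..?n. ?J (lam + \<e> i) mu - ?J lam (mu + \<e> i))"
    unfolding schur_integral_def by simp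
  also have "(\<Sum>i=1..?n. ?J (lam + \<e> i) mu - ?J lam (mu + \<e> i)) =
      (\<Sum>i=1..?n. unitary_integral H (lam + \<e> i) mu z - unitary_integral H lam (mu + \<e> i) z)"
    by (intro sum.cong refl) (simp only: unitary_integral_add_unit[OF lam mu])
  also have "?J lam mu = unitary_integral H lam mu z" by (simp add: unitary_integral_eq lam mu)
  finally show ?thesis by (rule sym)
qed

text \<open>Conjugation also conjugates z, so the first equation is taken at \<open>cnj z\<close>
  with the two partitions exchanged.\<close>

lemma unitary_integral_difference_3:
  fixes H :: "(complex^'n^'n) measure"
  assumes H: "normalized_haar H" and lam: "is_partition CARD('n) lam" and mu: "is_partition CARD('n) mu"
  shows "(\<Sum>i=1..CARD('n). of_int (mu i - int i + int CARD('n)) * unitary_integral H lam (mu - \<e> i) z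
            - of_int (lam i - int i + int CARD('n) + 1) * unitary_integral H (lam + \<e> i) mu z)
    + z * (of_nat CARD('n) * unitary_integral H lam mu z
           - (\<Sum>i=1..CARD('n). unitary_integral H (lam + \<e> i + \<e> i) mu z)
           + (\<Sum>i\<in>{i. 1 \<le> i \<and> i \<le> CARD('n) - 1 \<and> lam i = lam (i + 1)}.
                unitary_integral H (lam + \<e> i + \<e> (i + 1)) mu z)) = 0"
  using arg_cong[OF unitary_integral_difference_1[OF H mu lam, of "cnj z"], of cnj]
  by (simp only: complex_cnj_add complex_cnj_diff complex_cnj_mult cnj_sum complex_cnj_of_int complex_cnj_of_nat
      complex_cnj_cnj complex_cnj_zero cnj_unitary_integral)

theorem mainTheorem7:
  fixes n :: nat
  assumes n_def: "n = CARD('n::finite)"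
  shows
    "(\<forall>(H :: (complex^'n^'n) measure) lam mu z.
        normalized_haar H \<and> is_partition n lam \<and> is_partition n mu \<longrightarrow>
        (let a = (\<lambda>l m. unitary_integral H l m z) in
          (\<Sum>i=1..n. of_int (lam i - int i + int n) * a (lam - \<e> i) mu
                  - of_int (mu i - int i + int n + 1) * a lam (mu + \<e> i))
          + z * (of_nat n * a lam mu
                 - (\<Sum>i=1..n. a lam (mu + \<e> i + \<e> i))
                 + (\<Sum>i\<in>{i. 1 \<le> i \<and> i \<le> n - 1 \<and> mu i = mu (i + 1)}.
                      a lam (mu + \<e> i + \<e> (i + 1)))) = 0
        \<and>
          of_int ((\<Sum>i=1..n. lam i) - (\<Sum>i=1..n. mu i)) * a lam mu
          + z * (\<Sum>i=1..n. a (lam + \<e> i) mu - a lam (mu + \<e> i)) = 0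
        \<and>
          (\<Sum>i=1..n. of_int (mu i - int i + int n) * a lam (mu - \<e> i)
                  - of_int (lam i - int i + int n + 1) * a (lam + \<e> i) mu)
          + z * (of_nat n * a lam mu
                 - (\<Sum>i=1..n. a (lam + \<e> i + \<e> i) mu)
                 + (\<Sum>i\<in>{i. 1 \<le> i \<and> i \<le> n - 1 \<and> lam i = lam (i + 1)}.
                      a (lam + \<e> i + \<e> (i + 1)) mu)) = 0))
     \<and>
     (\<forall>(x :: nat \<Rightarrow> int) y (k :: nat).
        strictly_increasing n x \<and> (\<forall>i\<in>{1..n}. 0 \<le> x i) \<and>
        strictly_increasing n y \<and> (\<forall>i\<in>{1..n}. 0 \<le> y i) \<longrightarrow>
        (let b = walk_count n in
          - (\<Sum>i=1..n. (y i + 1) * b k x (y + \<e> i) - x i * b k (x - \<e> i) y)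
          + int k * (int n * b (k - 1) x y
                     - (\<Sum>i=1..n. b (k - 1) x (y + \<e> i + \<e> i))
                     + (\<Sum>i\<in>{i. 1 \<le> i \<and> i \<le> n - 1 \<and> y (i + 1) - y i = 1}.
                          b (k - 1) x (y + \<e> i + \<e> (i + 1)))) = 0
        \<and>
          - b k x y * (\<Sum>i=1..n. y i - x i)
          + int k * ((\<Sum>i=1..n. b (k - 1) (x + \<e> i) y)
                     - (\<Sum>i=1..n. b (k - 1) x (y + \<e> i))) = 0
        \<and>
          - (\<Sum>i=1..n. (x i + 1) * b k (x + \<e> i) y - y i * b k x (y - \<e> i))
          + int k * (int n * b (k - 1) x y
                     - (\<Sum>i=1..n. b (k - 1) (x + \<e> i + \<e> i) y)
                     + (\<Sum>i\<in>{i. 1 \<le> i \<and> i \<le> n - 1 \<and> x (i + 1) - x i = 1}.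
                          b (k - 1) (x + \<e> i + \<e> (i + 1)) y)) = 0))"
  unfolding n_def Let_def
  by (intro conjI allI impI; elim conjE;
      rule unitary_integral_difference_1 unitary_integral_difference_2 unitary_integral_difference_3
        walk_count_difference_1 walk_count_difference_2 walk_count_difference_3; assumption)

end
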